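(* Let $T>0$ and let $u_0\in H$. Suppose that for some $R>0$ $$F\in C^\infty(\mathbb{R}^3\times[0,T);\mathbb{R}^3)\quad\text{and}\quad \operatorname{supp}F(t)\subset B(0,R)\ \text{ for } t\in[0,T).$$ Then the pair of functions $$u(t):=\Phi(t)\ast u_0+\int_0^t\mathcal{T}(t-s)\ast F(s)\,ds,\qquad p(t):=-(-\Delta)^{-1}(\operatorname{div}F(t))$$ is a classical solution of the Stokes equations $$\partial_tu-\Delta u+\nabla p=F,\qquad\operatorname{div}u=0\qquad\text{in }\mathbb{R}^3\times(0,T)$$ with $u(0)=u_0$ (in the sense that $\|u(t)-u_0\|\to0$ as $t\to0^+$). Moreover $u\in C([0,T);L^2)$.
   Context: All function spaces are over $\mathbb{R}^3$; $\|\cdot\|$ is the $L^2$ norm; $\ast$ is convolution in space. $H$ is the space of vector fields $f\in L^2$ that are weakly divergence free, i.e. $\int f\cdot\nabla g=0$ for all $g\in C_0^\infty(\mathbb{R}^3)$. Heat kernel: $\Phi(x,t)=(4\pi t)^{-3/2}e^{-|x|^2/4t}$. Oseen kernel: the $3\times3$ matrix $\mathcal{T}=[\mathcal{T}_{ij}]$ with $\mathcal{T}_{ij}(x,t)=\delta_{ij}\Phi(x,t)+\partial_i\partial_jP(x,t)$, $x\in\mathbb{R}^3$, $t>0$, where $P(x,t)=\frac{1}{4\pi^{3/2}t^{1/2}|x|}\int_0^{|x|}e^{-\xi^2/4t}\,d\xi$ (which extends smoothly to $x=0$). The convolution is a matrix-vector operation: the $i$-th component of $\int_0^t\mathcal{T}(t-s)\ast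 F(s)\,ds$ at $x$ is $\int_0^t\int\mathcal{T}_{ij}(x-y,t-s)F_j(y,s)\,dy\,ds$ (summation over $j$). $(-\Delta)^{-1}f(x)=\int\frac{f(y)}{4\pi|x-y|}\,dy$. *)

theory Defs
  imports "HOL-Analysis.Analysis"
begin

section \<open>Differential calculus\<close>

definition partial :: "3 \<Rightarrow> (real^3 \<Rightarrow> real) \<Rightarrow> real^3 \<Rightarrow> real" where
  "partial i f x = deriv (\<lambda>h. f (x + h *\<^sub>R axis i 1)) 0"

definition partial_exists :: "3 \<Rightarrow> (real^3 \<Rightarrow> real) \<Rightarrow> real^3 \<Rightarrow> bool" where
  "partial_exists i f x \<longleftrightarrow> (\<lambda>h. f (x + h *\<^sub>R axis i 1)) differentiable (at 0)"

definition grad :: "(real^3 \<Rightarrow> real) \<Rightarrow> real^3 \<Rightarrow> real^3" where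
  "grad f x = (\<chi> i. partial i f x)"

definition divergence :: "(real^3 \<Rightarrow> real^3) \<Rightarrow> real^3 \<Rightarrow> real" where
  "divergence v x = (\<Sum>i\<in>UNIV. partial i (\<lambda>y. v y $ i) x)"

definition laplacian :: "(real^3 \<Rightarrow> real) \<Rightarrow> real^3 \<Rightarrow> real" where
  "laplacian f x = (\<Sum>i\<in>UNIV. partial i (partial i f) x)"

text \<open>
  Derivatives are taken within \<open>S\<close>, so on \<open>\<real>\<^sup>3 \<times> [0,T)\<close> they are one-sided in time at \<open>t = 0\<close>.
  The predicate is meant for sets on which such derivatives are unique, e.g. convex sets with
  nonempty interior.
\<close>
primrec C_on :: "nat \<Rightarrow> 'a::euclidean_space set \<Rightarrow> ('a \<Rightarrow> 'b::real_normed_vector) \<Rightarrow> bool" where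
  "C_on 0 S f \<longleftrightarrow> continuous_on S f"
| "C_on (Suc k) S f \<longleftrightarrow>
     (\<exists>f'. (\<forall>x\<in>S. (f has_derivative f' x) (at x within S)) \<and> (\<forall>v. C_on k S (\<lambda>x. f' x v)))"

definition smooth_on :: "'a::euclidean_space set \<Rightarrow> ('a \<Rightarrow> 'b::real_normed_vector) \<Rightarrow> bool" where
  "smooth_on S f \<longleftrightarrow> (\<forall>k. C_on k S f)"

definition supp :: "('a::topological_space \<Rightarrow> 'b::zero) \<Rightarrow> 'a set" where
  "supp f = closure {x. f x \<noteq> 0}"

section \<open>Function spaces\<close>

text \<open>Elements of \<open>L\<^sup>2\<close> are represented by functions; equality in \<open>L\<^sup>2\<close> is equality almost everywhere.\<close>

definition L2 :: "(real^3 \<Rightarrow> real^3) set" where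
  "L2 = {f. f \<in> borel_measurable lebesgue \<and> integrable lebesgue (\<lambda>x. (norm (f x))\<^sup>2)}"

definition L2_norm :: "(real^3 \<Rightarrow> real^3) \<Rightarrow> real" where
  "L2_norm f = sqrt (LINT x|lebesgue. (norm (f x))\<^sup>2)"

definition H_space :: "(real^3 \<Rightarrow> real^3) set" where
  "H_space = {f \<in> L2. \<forall>g :: real^3 \<Rightarrow> real. smooth_on UNIV g \<and> compact (supp g) \<longrightarrow>
                 (LINT x|lebesgue. f x \<bullet> grad g x) = 0}"

definition continuous_into_L2 :: "real set \<Rightarrow> (real \<Rightarrow> real^3 \<Rightarrow> real^3) \<Rightarrow> bool" where
  "continuous_into_L2 I u \<longleftrightarrow>
     (\<forall>t\<in>I. u t \<in> L2) \<and>
     (\<forall>t\<in>I. ((\<lambda>s. L2_norm (\<lambda>x. u s x - u t x)) \<longlongrightarrow> 0) (at t within I))"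

section \<open>Kernels and potentials\<close>

definition heat_kernel :: "real^3 \<Rightarrow> real \<Rightarrow> real" where
  "heat_kernel x t = (4 * pi * t) powr (- 3 / 2) * exp (- (norm x)\<^sup>2 / (4 * t))"

text \<open>The value at \<open>x = 0\<close> is the continuous extension: the mean of the integrand over
  \<open>[0,|x|]\<close> tends to \<open>1\<close> as \<open>x \<rightarrow> 0\<close>.\<close>
definition oseen_P :: "real^3 \<Rightarrow> real \<Rightarrow> real" where
  "oseen_P x t =
     (if x = 0 then 1 / (4 * pi powr (3/2) * sqrt t)
      else 1 / (4 * pi powr (3/2) * sqrt t * norm x) *
             integral {0..norm x} (\<lambda>\<xi>. exp (- \<xi>\<^sup>2 / (4 * t))))"

definition oseen_kernel :: "real^3 \<Rightarrow> real \<Rightarrow> real^3^3" where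
  "oseen_kernel x t =
     (\<chi> i j. (if i = j then heat_kernel x t else 0) + partial i (partial j (\<lambda>y. oseen_P y t)) x)"

text \<open>\<open>\<Phi>(t) * f\<close>, where \<open>\<Phi>(0)\<close> is read as the Dirac mass.\<close>
definition heat_conv :: "real \<Rightarrow> (real^3 \<Rightarrow> real^3) \<Rightarrow> real^3 \<Rightarrow> real^3" where
  "heat_conv t f x =
     (if t = 0 then f x else (LINT y|lebesgue. heat_kernel (x - y) t *\<^sub>R f y))"

definition oseen_conv :: "real \<Rightarrow> (real^3 \<Rightarrow> real^3) \<Rightarrow> real^3 \<Rightarrow> real^3" where
  "oseen_conv t f x = (LINT y|lebesgue. oseen_kernel (x - y) t *v f y)"

definition inv_neg_laplacian :: "(real^3 \<Rightarrow> real) \<Rightarrow> real^3 \<Rightarrow> real" where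
  "inv_neg_laplacian f x = (LINT y|lebesgue. f y / (4 * pi * norm (x - y)))"

section \<open>The Stokes equations\<close>

definition stokes_velocity ::
  "(real^3 \<Rightarrow> real^3) \<Rightarrow> (real \<Rightarrow> real^3 \<Rightarrow> real^3) \<Rightarrow> real \<Rightarrow> real^3 \<Rightarrow> real^3" where
  "stokes_velocity u\<^sub>0 F t x =
     heat_conv t u\<^sub>0 x + (LINT s:{0..t}|lebesgue. oseen_conv (t - s) (F s) x)"

definition stokes_pressure :: "(real \<Rightarrow> real^3 \<Rightarrow> real^3) \<Rightarrow> real \<Rightarrow> real^3 \<Rightarrow> real" where
  "stokes_pressure F t x = - inv_neg_laplacian (divergence (F t)) x"

text \<open>Existence and joint continuity on \<open>\<real>\<^sup>3 \<times> (0,T)\<close> of the derivatives of \<open>f\<close> named.\<close>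

definition C1_space :: "real \<Rightarrow> (real \<Rightarrow> real^3 \<Rightarrow> real) \<Rightarrow> bool" where
  "C1_space T f \<longleftrightarrow>
     continuous_on (UNIV \<times> {0<..<T}) (\<lambda>(x, t). f t x) \<and>
     (\<forall>i. (\<forall>t\<in>{0<..<T}. \<forall>x. partial_exists i (f t) x) \<and>
          continuous_on (UNIV \<times> {0<..<T}) (\<lambda>(x, t). partial i (f t) x))"

definition C2_space :: "real \<Rightarrow> (real \<Rightarrow> real^3 \<Rightarrow> real) \<Rightarrow> bool" where
  "C2_space T f \<longleftrightarrow> C1_space T f \<and> (\<forall>i. C1_space T (\<lambda>t. partial i (f t)))"

definition C1_time :: "real \<Rightarrow> (real \<Rightarrow> real^3 \<Rightarrow> real) \<Rightarrow> bool" where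
  "C1_time T f \<longleftrightarrow>
     (\<forall>t\<in>{0<..<T}. \<forall>x. (\<lambda>s. f s x) differentiable (at t)) \<and>
     continuous_on (UNIV \<times> {0<..<T}) (\<lambda>(x, t). deriv (\<lambda>s. f s x) t)"

text \<open>Classical: the derivatives occurring in the equations exist and are continuous, and the
  equations hold at every point of \<open>\<real>\<^sup>3 \<times> (0,T)\<close>.\<close>
definition classical_stokes_solution ::
  "real \<Rightarrow> (real \<Rightarrow> real^3 \<Rightarrow> real^3) \<Rightarrow> (real \<Rightarrow> real^3 \<Rightarrow> real^3) \<Rightarrow> (real \<Rightarrow> real^3 \<Rightarrow> real) \<Rightarrow> bool"
where
  "classical_stokes_solution T F u p \<longleftrightarrow>
     (\<forall>i. C1_time T (\<lambda>t x. u t x $ i) \<and> C2_space T (\<lambda>t x. u t x $ i)) \<and>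
     C1_space T p \<and>
     (\<forall>t\<in>{0<..<T}. \<forall>x.
        (\<forall>i. deriv (\<lambda>s. u s x $ i) t - laplacian (\<lambda>y. u t y $ i) x + partial i (p t) x = F t x $ i) \<and>
        divergence (u t) x = 0)"

end

theory Submission
  imports Defs "HOL-Probability.Probability" "HOL-Real_Asymp.Real_Asymp"
begin

text \<open>
  Let \<open>N\<close> be the Newtonian potential. Since \<open>\<partial>\<^sub>t P = - \<Phi>\<close> and \<open>P(\<cdot>, t)\<close> tends to the Newtonian kernel
  as \<open>t \<rightarrow> 0\<close>, we have \<open>P(r) * f = N f - \<integral>\<^sub>0\<^sup>r \<Phi>(\<rho>) * f d\<rho>\<close>; letting \<open>r \<rightarrow> \<infinity>\<close> with \<open>\<Delta>f\<close> for \<open>f\<close> yields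
  \<open>N \<Delta>f = - f\<close>. Moving the derivatives of \<open>P\<close> onto \<open>F\<close> gives
  \<open>\<T>(r) * F = F + N \<nabla>div F + \<integral>\<^sub>0\<^sup>r \<Phi>(\<rho>) * G d\<rho>\<close> with \<open>G = \<Delta>F - \<nabla>div F\<close>, which involves no singular
  integral. By Fubini the forcing part of the velocity is \<open>v(t) = \<integral>\<^sub>0\<^sup>t g\<close> with \<open>g = F + N \<nabla>div F + E\<close> and
  \<open>E(t) = \<integral>\<^sub>0\<^sup>t \<Phi>(t-s) * G(s) ds\<close>. Then \<open>\<partial>\<^sub>t v = g\<close>, and \<open>\<Delta>v = E\<close> follows from Poisson's equation and the heat
  equation for \<open>E\<close>, so that \<open>\<partial>\<^sub>t v - \<Delta>v = F + N \<nabla>div F = F - \<nabla>p\<close>; similarly \<open>div v = 0\<close> because \<open>div G = 0\<close>.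
  The bound \<open>|g| \<le> C / (1 + |x|\<^sup>2)\<close>, locally uniform in time, makes \<open>v\<close> Lipschitz in time with values in
  \<open>L\<^sup>2\<close>. For the heat flow of \<open>u\<^sub>0\<close> one differentiates the Gaussian under the integral; it is divergence free
  because the Gaussian is a limit of test functions, and continuous into \<open>L\<^sup>2\<close> by contractivity and density.
\<close>

section \<open>Integrals depending on a parameter\<close>

text \<open>The obstacle is the endpoint s = t: the Oseen kernel degenerates as its time argument
  tends to 0, and the second derivatives of P decay only like |x|^-3. The right-hand side of the
  identity for \<T>(r) * F is continuous in r up to r = 0 and carries every derivative on F, so the
  integrand in s is continuous on [0,t] once its value at the single point s = t is changed. The
  heat semigroup appears in two forms. \<open>heat_flow\<close> differentiates the kernel and serves
  data in L^2 at positive times; \<open>gauss_avg\<close> rescales the kernel to time 1, makes sense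
  at time 0 and differentiates the function. The weight 1 + |x|^2 comes from one derivative falling
  on a kernel that behaves like 1/|x|: the reciprocal of this weight is square integrable in
  dimension three, whereas 1/|x| is not square integrable at infinity. The definitions integrate
  against Lebesgue measure, while Fubini and substitutions are carried out for Borel functions and
  \<open>lborel\<close>; the initial field is therefore replaced by a Borel version that equals it
  almost everywhere.\<close>

lemma has_real_derivative_integral:
  fixes k k' :: "real \<Rightarrow> 'a \<Rightarrow> real"
  assumes "d > 0"
    and int: "\<And>h. \<bar>h - a\<bar> < d \<Longrightarrow> integrable M (k h)"
    and der: "\<And>h w. \<bar>h - a\<bar> < d \<Longrightarrow> w \<in> space M \<Longrightarrow>
      ((\<lambda>h. k h w) has_real_derivative k' h w) (at h)"
    and bound: "\<And>h w. \<bar>h - a\<bar> < d \<Longrightarrow> w \<in> space M \<Longrightarrow> \<bar>k' h w\<bar> \<le> W w"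
    and W: "integrable M W"
    and meas: "k' a \<in> borel_measurable M"
  shows "((\<lambda>h. \<integral>w. k h w \<partial>M) has_real_derivative (\<integral>w. k' a w \<partial>M)) (at a)"
proof -
  have "((\<lambda>h. \<integral>w. k h w \<partial>M) has_real_derivative (\<integral>w. k' a w \<partial>M)) (at a within ball a d)"
    unfolding has_field_derivative_iff tendsto_at_iff_sequentially
  proof (intro allI impI)
    fix X :: "nat \<Rightarrow> real"
    assume X: "\<forall>i. X i \<in> ball a d - {a}" and lim: "X \<longlonglongrightarrow> a"
    have Xd: "\<bar>X i - a\<bar> < d" "X i \<noteq> a" for i
      using X[rule_format, of i] by (auto simp: dist_real_def)
    have ad: "\<bar>a - a\<bar> < d" using \<open>d > 0\<close> by simp
    have "(\<lambda>i. \<integral>w. (k (X i) w - k a w) / (X i - a) \<partial>M) \<longlonglongrightarrow> (\<integral>w. k' a w \<partial>M)"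
    proof (rule integral_dominated_convergence[where w = W])
      show "(\<lambda>w. (k (X i) w - k a w) / (X i - a)) \<in> borel_measurable M" for i
        using int[OF Xd(1)[of i]] int[OF ad] by (intro borel_measurable_integrable) auto
      show "AE w in M. (\<lambda>i. (k (X i) w - k a w) / (X i - a)) \<longlonglongrightarrow> k' a w"
      proof (rule AE_I2)
        fix w assume w: "w \<in> space M"
        have "((\<lambda>h. (k h w - k a w) / (h - a)) \<longlongrightarrow> k' a w) (at a)"
          using der[OF ad w] by (simp add: has_field_derivative_iff)
        then show "(\<lambda>i. (k (X i) w - k a w) / (X i - a)) \<longlonglongrightarrow> k' a w"
          using Xd(2) lim unfolding tendsto_at_iff_sequentially comp_def by auto
      qed
      show "AE w in M. norm ((k (X i) w - k a w) / (X i - a)) \<le> W w" for i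
      proof (rule AE_I2)
        fix w assume w: "w \<in> space M"
        \<comment> \<open>The mean value inequality turns the bound on the derivative into a bound
          on the difference quotients that does not depend on \<open>i\<close>.\<close>
        have "norm (k (X i) w - k a w) \<le> W w * norm (X i - a)"
        proof (rule field_differentiable_bound[where S = "ball a d" and f' = "\<lambda>h. k' h w"])
          show "((\<lambda>h. k h w) has_field_derivative k' z w) (at z within ball a d)" if "z \<in> ball a d" for z
            using der[of z w] w that by (auto simp: dist_real_def abs_minus_commute intro: has_field_derivative_at_within)
          show "norm (k' z w) \<le> W w" if "z \<in> ball a d" for z
            using bound[of z w] w that by (auto simp: dist_real_def abs_minus_commute)
        qed (use Xd(1)[of i] \<open>d > 0\<close> in \<open>auto simp: dist_real_def abs_minus_commute\<close>)
        then show "norm ((k (X i) w - k a w) / (X i - a)) \<le> W w"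
          using Xd(2)[of i] by (simp add: divide_simps)
      qed
    qed (use W meas in auto)
    note lim' = this
    have eq: "(\<lambda>i. \<integral>w. (k (X i) w - k a w) / (X i - a) \<partial>M)
        = (\<lambda>i. ((\<integral>w. k (X i) w \<partial>M) - (\<integral>w. k a w \<partial>M)) / (X i - a))"
      using int[OF Xd(1)] int[OF ad] by (intro ext) simp
    show "((\<lambda>y. ((\<integral>w. k y w \<partial>M) - (\<integral>w. k a w \<partial>M)) / (y - a)) \<circ> X) \<longlonglongrightarrow> (\<integral>w. k' a w \<partial>M)"
      using lim' by (simp only: comp_def eq)
  qed
  moreover have "at a within ball a d = at a"
    using \<open>d > 0\<close> by (intro at_within_open) auto
  ultimately show ?thesis by metis
qed

text \<open>The dominating function is local in the parameter, because the bounds at hand are: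
  sources are bounded on [0,T'] for each T' < T, and Gaussian kernels are controlled near one
  positive time.\<close>

lemma continuous_on_integral_dominated:
  fixes k :: "'p::metric_space \<Rightarrow> 'a \<Rightarrow> real"
  assumes meas: "\<And>p. p \<in> S \<Longrightarrow> k p \<in> borel_measurable M"
    and cont: "\<And>w. w \<in> space M \<Longrightarrow> continuous_on S (\<lambda>p. k p w)"
    and dom: "\<And>p. p \<in> S \<Longrightarrow> \<exists>d>0. \<exists>W. integrable M W \<and>
      (\<forall>q\<in>S. dist q p < d \<longrightarrow> (\<forall>w\<in>space M. \<bar>k q w\<bar> \<le> W w))"
  shows "continuous_on S (\<lambda>p. \<integral>w. k p w \<partial>M)"
  unfolding continuous_on_def tendsto_at_iff_sequentially
proof (intro ballI allI impI)
  fix p X assume p: "p \<in> S" and X: "\<forall>i::nat. X i \<in> S - {p}" and lim: "X \<longlonglongrightarrow> p"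
  obtain d W where d: "d > 0" and W: "integrable M W"
    and b: "\<And>q w. q \<in> S \<Longrightarrow> dist q p < d \<Longrightarrow> w \<in> space M \<Longrightarrow> \<bar>k q w\<bar> \<le> W w"
    using dom[OF p] by blast
  obtain N where N: "\<And>i. i \<ge> N \<Longrightarrow> dist (X i) p < d"
    using lim d by (auto simp: lim_sequentially)
  have "(\<lambda>i. \<integral>w. k (X (i + N)) w \<partial>M) \<longlonglongrightarrow> (\<integral>w. k p w \<partial>M)"
  proof (rule integral_dominated_convergence[where w = W])
    show "AE w in M. (\<lambda>i. k (X (i + N)) w) \<longlonglongrightarrow> k p w"
    proof (rule AE_I2)
      fix w assume "w \<in> space M"
      then have "((\<lambda>p. k p w) \<longlongrightarrow> k p w) (at p within S)"
        using cont p by (auto simp: continuous_on_def)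
      then have "(\<lambda>i. k (X i) w) \<longlonglongrightarrow> k p w"
        using X lim unfolding tendsto_at_iff_sequentially comp_def by auto
      then show "(\<lambda>i. k (X (i + N)) w) \<longlonglongrightarrow> k p w" by (rule LIMSEQ_ignore_initial_segment)
    qed
  qed (use X W b N meas p in \<open>auto intro!: AE_I2\<close>)
  then show "((\<lambda>p. \<integral>w. k p w \<partial>M) \<circ> X) \<longlonglongrightarrow> (\<integral>w. k p w \<partial>M)"
    unfolding comp_def by (rule LIMSEQ_offset)
qed

section \<open>Affine substitutions\<close>

lemma nn_integral_lborel_affine:
  fixes f :: "'a::euclidean_space \<Rightarrow> ennreal"
  assumes "c \<noteq> 0" and [measurable]: "f \<in> borel_measurable borel"
  shows "(\<integral>\<^sup>+x. f x \<partial>lborel) = ennreal (\<bar>c\<bar> ^ DIM('a)) * (\<integral>\<^sup>+x. f (t + c *\<^sub>R x) \<partial>lborel)"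
  by (subst lborel_affine[OF assms(1), of t])
    (simp add: nn_integral_density nn_integral_distr nn_integral_cmult)

lemma lborel_integrable_affine:
  fixes f :: "'a::euclidean_space \<Rightarrow> 'b::{banach, second_countable_topology}"
  assumes "c \<noteq> 0" and [measurable]: "f \<in> borel_measurable borel"
  shows "integrable lborel (\<lambda>x. f (t + c *\<^sub>R x)) \<longleftrightarrow> integrable lborel f"
proof -
  have "ennreal (\<bar>c\<bar> ^ DIM('a)) * a < \<infinity> \<longleftrightarrow> a < \<infinity>" for a
    using assms(1) by (cases a) (auto simp: ennreal_mult_less_top)
  then show ?thesis
    using nn_integral_lborel_affine[OF assms(1), of "\<lambda>x. ennreal (norm (f x))" t]
    by (simp add: integrable_iff_bounded)
qed

lemma lborel_integral_affine:
  fixes f :: "'a::euclidean_space \<Rightarrow> 'b::{banach, second_countable_topology}"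
  assumes "c \<noteq> 0" and [measurable]: "f \<in> borel_measurable borel"
  shows "(\<integral>x. f x \<partial>lborel) = (\<bar>c\<bar> ^ DIM('a)) *\<^sub>R (\<integral>x. f (t + c *\<^sub>R x) \<partial>lborel)"
  by (subst lborel_affine[OF assms(1), of t])
    (simp add: integral_density integral_distr)

lemma lborel_integral_reflect:
  fixes f :: "'a::euclidean_space \<Rightarrow> 'b::{banach, second_countable_topology}"
  assumes [measurable]: "f \<in> borel_measurable borel"
  shows "(\<integral>y. f (x - y) \<partial>lborel) = (\<integral>y. f y \<partial>lborel)"
  using lborel_integral_affine[of "-1" f x] by simp

lemma lborel_integrable_reflect:
  fixes f :: "'a::euclidean_space \<Rightarrow> 'b::{banach, second_countable_topology}"
  assumes "f \<in> borel_measurable borel"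
  shows "integrable lborel (\<lambda>y. f (x - y)) \<longleftrightarrow> integrable lborel f"
  using lborel_integrable_affine[of "-1" f x] assms by simp

section \<open>Gaussian integrals\<close>

lemma has_bochner_integral_gaussian_real:
  assumes "c > 0"
  shows "has_bochner_integral lborel (\<lambda>x::real. exp (- (c * x\<^sup>2))) (sqrt (pi / c))"
proof -
  \<comment> \<open>Chosen so that 1 / (2 \<sigma>^2) = c, which makes the Gaussian a multiple of a
    normal density.\<close>
  define \<sigma> where "\<sigma> = sqrt (1 / (2 * c))"
  have s: "\<sigma> > 0" "\<sigma>\<^sup>2 = 1 / (2 * c)" using assms by (auto simp: \<sigma>_def)
  have "has_bochner_integral lborel (\<lambda>x. sqrt (pi / c) * normal_density 0 \<sigma> x) (sqrt (pi / c) * 1)"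
    using s by (intro has_bochner_integral_mult_right) (auto simp: has_bochner_integral_iff)
  moreover have "sqrt (pi / c) * normal_density 0 \<sigma> x = exp (- (c * x\<^sup>2))" for x
  proof -
    have "2 * pi * \<sigma>\<^sup>2 = pi / c" "- (x - 0)\<^sup>2 / (2 * \<sigma>\<^sup>2) = - (c * x\<^sup>2)"
      using assms s by (auto simp: field_simps)
    then have "normal_density 0 \<sigma> x = 1 / sqrt (pi / c) * exp (- (c * x\<^sup>2))"
      by (simp only: normal_density_def)
    moreover have "sqrt (pi / c) \<noteq> 0" using assms by simp
    ultimately show ?thesis by (metis mult.assoc mult_1 nonzero_mult_div_cancel_left times_divide_eq_right mult.right_neutral)
  qed
  ultimately show ?thesis by simp
qed

text \<open>The Gaussian factors over the coordinates, so its integral is a power of the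
  one-dimensional one.\<close>

lemma nn_integral_gaussian:
  assumes "c > 0"
  shows "(\<integral>\<^sup>+x. ennreal (exp (- (c * (norm (x::'a::euclidean_space))\<^sup>2))) \<partial>lborel)
    = ennreal (sqrt (pi / c) ^ DIM('a))"
proof -
  have "exp (- (c * (norm x)\<^sup>2)) = (\<Prod>b\<in>Basis. exp (- (c * (x \<bullet> b)\<^sup>2)))" for x :: 'a
    unfolding exp_sum[OF finite_Basis, symmetric] power2_norm_eq_inner
    by (subst euclidean_inner) (simp add: sum_distrib_left sum_negf power2_eq_square)
  then have "(\<integral>\<^sup>+x. ennreal (exp (- (c * (norm (x::'a))\<^sup>2))) \<partial>lborel)
    = (\<integral>\<^sup>+x. (\<Prod>b\<in>Basis. ennreal (exp (- (c * ((x::'a) \<bullet> b)\<^sup>2)))) \<partial>lborel)"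
    by (simp add: prod_ennreal)
  also have "\<dots> = (\<Prod>b\<in>(Basis::'a set). \<integral>\<^sup>+x. ennreal (exp (- (c * x\<^sup>2))) \<partial>lborel)"
    by (rule nn_integral_lborel_prod) auto
  also have "(\<integral>\<^sup>+x. ennreal (exp (- (c * (x::real)\<^sup>2))) \<partial>lborel) = ennreal (sqrt (pi / c))"
    using has_bochner_integral_gaussian_real[OF assms]
    by (subst nn_integral_eq_integral) (auto simp: has_bochner_integral_iff)
  finally show ?thesis
    using assms by (simp add: ennreal_power)
qed

lemma has_bochner_integral_gaussian:
  assumes "c > 0"
  shows "has_bochner_integral lborel (\<lambda>x::'a::euclidean_space. exp (- (c * (norm x)\<^sup>2)))
    (sqrt (pi / c) ^ DIM('a))"
  using nn_integral_gaussian[OF assms, where 'a = 'a] assms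
  by (intro has_bochner_integral_nn_integral) auto

lemma integrable_gaussian:
  "c > 0 \<Longrightarrow> integrable lborel (\<lambda>x::'a::euclidean_space. exp (- (c * (norm x)\<^sup>2)))"
  using has_bochner_integral_gaussian has_bochner_integral_iff by blast

lemma heat_kernel_nonneg: "heat_kernel x t \<ge> 0"
  by (simp add: heat_kernel_def)

lemma heat_kernel_measurable [measurable]: "(\<lambda>x. heat_kernel x t) \<in> borel_measurable borel"
  unfolding heat_kernel_def by measurable

lemma has_bochner_integral_heat_kernel:
  assumes "t > 0"
  shows "has_bochner_integral lborel (\<lambda>x. heat_kernel x t) 1"
proof -
  have "has_bochner_integral lborel
    (\<lambda>x::real^3. (4 * pi * t) powr (- 3 / 2) * exp (- (1 / (4 * t) * (norm x)\<^sup>2)))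
    ((4 * pi * t) powr (- 3 / 2) * sqrt (pi / (1 / (4 * t))) ^ DIM(real^3))"
    using assms by (intro has_bochner_integral_mult_right has_bochner_integral_gaussian) auto
  moreover have "sqrt (pi / (1 / (4 * t))) ^ DIM(real^3) = (4 * pi * t) powr (3 / 2)"
  proof -
    have "sqrt (4 * pi * t) ^ 3 = (4 * pi * t) powr (3 / 2)"
      using assms by (simp add: powr_half_sqrt[symmetric] powr_power)
    moreover have "pi / (1 / (4 * t)) = 4 * pi * t" by simp
    moreover have "DIM(real^3) = 3" by simp
    ultimately show ?thesis by (simp only:)
  qed
  ultimately show ?thesis
    using assms by (simp add: heat_kernel_def powr_add[symmetric])
qed

lemma integrable_heat_kernel: "t > 0 \<Longrightarrow> integrable lborel (\<lambda>x. heat_kernel x t)"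
  and integral_heat_kernel: "t > 0 \<Longrightarrow> (\<integral>x. heat_kernel x t \<partial>lborel) = 1"
  using has_bochner_integral_heat_kernel has_bochner_integral_iff by blast+

lemma le_exp_of_ge_0: "0 \<le> x \<Longrightarrow> x \<le> exp (x::real)"
  using exp_ge_add_one_self[of x] by linarith

lemma power2_le_exp: "0 \<le> x \<Longrightarrow> x\<^sup>2 \<le> 2 * exp (x::real)"
  using exp_lower_Taylor_quadratic[of x] by (simp add: field_simps)

text \<open>Half of the Gaussian exponent absorbs the factor |x|^2, by y \<le> exp y with y = |x|^2
  / (8t).\<close>

lemma integrable_norm_sq_heat_kernel:
  assumes "t > 0"
  shows "integrable lborel (\<lambda>x. (norm x)\<^sup>2 * heat_kernel x t)"
proof -
  have "integrable lborel (\<lambda>x::real^3. (4 * pi * t) powr (- 3 / 2) * (8 * t) * exp (- (1 / (8 * t) * (norm x)\<^sup>2)))"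
    using assms by (intro integrable_mult_right integrable_gaussian) auto
  then show ?thesis
  proof (rule Bochner_Integration.integrable_bound)
    show "AE x in lborel. norm ((norm x)\<^sup>2 * heat_kernel x t)
       \<le> norm ((4 * pi * t) powr (- 3 / 2) * (8 * t) * exp (- (1 / (8 * t) * (norm (x::real^3))\<^sup>2)))"
    proof (rule AE_I2)
      fix x :: "real^3"
      have "(norm x)\<^sup>2 / (8 * t) \<le> exp ((norm x)\<^sup>2 / (8 * t))"
        using assms by (intro le_exp_of_ge_0) auto
      then have "(norm x)\<^sup>2 * exp (- (norm x)\<^sup>2 / (4 * t)) \<le> 8 * t * exp ((norm x)\<^sup>2 / (8 * t)) * exp (- (norm x)\<^sup>2 / (4 * t))"
        using assms by (intro mult_right_mono) (auto simp: field_simps)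
      also have "\<dots> = 8 * t * exp (- (1 / (8 * t) * (norm x)\<^sup>2))"
        by (simp add: exp_add[symmetric] field_simps)
      finally have "(norm x)\<^sup>2 * exp (- (norm x)\<^sup>2 / (4 * t)) \<le> 8 * t * exp (- (1 / (8 * t) * (norm x)\<^sup>2))" .
      from mult_left_mono[OF this, of "(4 * pi * t) powr (- 3 / 2)"]
      show "norm ((norm x)\<^sup>2 * heat_kernel x t)
         \<le> norm ((4 * pi * t) powr (- 3 / 2) * (8 * t) * exp (- (1 / (8 * t) * (norm x)\<^sup>2)))"
        using assms by (simp add: heat_kernel_def abs_mult mult_ac)
    qed
  qed measurable
qed

section \<open>Partial derivatives\<close>

text \<open>\<open>partial\<close> is a total function built from \<open>deriv\<close>; this
  relation records existence and value together and can be fed to the derivative rules.\<close>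

definition has_partial :: "3 \<Rightarrow> (real^3 \<Rightarrow> real) \<Rightarrow> real \<Rightarrow> real^3 \<Rightarrow> bool" where
  "has_partial i f f' x \<longleftrightarrow> ((\<lambda>h. f (x + h *\<^sub>R axis i 1)) has_real_derivative f') (at 0)"

lemma has_partial_imp_partial: "has_partial i f f' x \<Longrightarrow> partial i f x = f'"
  unfolding has_partial_def partial_def by (rule DERIV_imp_deriv)

lemma has_partial_imp_partial_exists: "has_partial i f f' x \<Longrightarrow> partial_exists i f x"
  unfolding has_partial_def partial_exists_def
  by (meson field_differentiable_def field_differentiable_imp_differentiable)

text \<open>Moves the point of differentiation along the line from 0 to \<open>h\<close>, the form
  in which differentiation under the integral needs it.\<close>

lemma has_partial_line:
  assumes "\<And>x. has_partial i f (f' x) x"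
  shows "((\<lambda>h. f (x + h *\<^sub>R axis i 1)) has_real_derivative f' (x + h *\<^sub>R axis i 1)) (at h)"
proof -
  have "((\<lambda>k. f (x + h *\<^sub>R axis i 1 + k *\<^sub>R axis i 1)) has_real_derivative f' (x + h *\<^sub>R axis i 1)) (at 0)"
    using assms[of "x + h *\<^sub>R axis i 1"] by (simp add: has_partial_def)
  then have "((\<lambda>k. f (x + (h + k) *\<^sub>R axis i 1)) has_real_derivative f' (x + h *\<^sub>R axis i 1)) (at 0)"
    by (simp add: scaleR_add_left add.assoc)
  then show ?thesis
    using DERIV_at_within_shift[of "\<lambda>k. f (x + k *\<^sub>R axis i 1)" "f' (x + h *\<^sub>R axis i 1)" h 0 UNIV]
    by (simp add: add.commute)
qed

lemma has_partial_add: "has_partial i f f' x \<Longrightarrow> has_partial i g g' x \<Longrightarrow> has_partial i (\<lambda>x. f x + g x) (f' + g') x"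
  and has_partial_diff: "has_partial i f f' x \<Longrightarrow> has_partial i g g' x \<Longrightarrow> has_partial i (\<lambda>x. f x - g x) (f' - g') x"
  and has_partial_minus: "has_partial i f f' x \<Longrightarrow> has_partial i (\<lambda>x. - f x) (- f') x"
  and has_partial_cmult: "has_partial i f f' x \<Longrightarrow> has_partial i (\<lambda>x. c * f x) (c * f') x"
  unfolding has_partial_def by (auto intro!: derivative_eq_intros)

lemma has_partial_sum:
  assumes "\<And>j. j \<in> A \<Longrightarrow> has_partial i (f j) (f' j) x"
  shows "has_partial i (\<lambda>x. \<Sum>j\<in>A. f j x) (\<Sum>j\<in>A. f' j) x"
  using assms unfolding has_partial_def by (auto intro!: derivative_eq_intros)

lemma has_partial_mult:
  assumes "has_partial i f f' x" "has_partial i g g' x"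
  shows "has_partial i (\<lambda>x. f x * g x) (f' * g x + f x * g') x"
  using assms unfolding has_partial_def
  by (auto intro!: derivative_eq_intros)

text \<open>Differentiate
  \<open>f (x + a e\<^sub>j) = f x + \<integral>\<^sub>0\<^sup>a \<partial>\<^sub>j f (x + s e\<^sub>j) ds\<close> in direction \<open>i\<close> under the integral, then in \<open>a\<close>.\<close>
lemma has_partial_commute:
  assumes i: "\<And>x. has_partial i f (fi x) x" and j: "\<And>x. has_partial j f (fj x) x"
    and ij: "\<And>x. has_partial i fj (fji x) x" and ji: "has_partial j fi fij x"
    and cont: "continuous_on UNIV fj" "continuous_on UNIV fji"
  shows "fij = fji x"
proof -
  let ?i = "axis i 1 :: real^3" and ?j = "axis j 1 :: real^3"
  have ftc: "integral {0..a} (\<lambda>s. fj ((x + h *\<^sub>R ?i) + s *\<^sub>R ?j)) = f ((x + a *\<^sub>R ?j) + h *\<^sub>R ?i) - f (x + h *\<^sub>R ?i)"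
    if "a \<ge> 0" for a h
  proof -
    have "((\<lambda>s. fj ((x + h *\<^sub>R ?i) + s *\<^sub>R ?j)) has_integral
      (f ((x + h *\<^sub>R ?i) + a *\<^sub>R ?j) - f ((x + h *\<^sub>R ?i) + 0 *\<^sub>R ?j))) {0..a}"
      using has_partial_line[OF j] that
      by (intro fundamental_theorem_of_calculus)
        (auto simp: has_real_derivative_iff_has_vector_derivative[symmetric] intro: has_field_derivative_at_within)
    note I = integral_unique[OF this]
    have "(x + a *\<^sub>R ?j) + h *\<^sub>R ?i = (x + h *\<^sub>R ?i) + a *\<^sub>R ?j"
      "x + h *\<^sub>R ?i = x + h *\<^sub>R ?i + 0 *\<^sub>R ?j" by auto
    then show ?thesis using I by metis
  qed
  have *: "fi (x + a *\<^sub>R ?j) - fi x = integral {0..a} (\<lambda>s. fji (x + s *\<^sub>R ?j))" if "a \<ge> 0" for a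
  proof -
    have "((\<lambda>h. integral (cbox 0 a) (\<lambda>s. fj ((x + h *\<^sub>R ?i) + s *\<^sub>R ?j)))
       has_real_derivative integral (cbox 0 a) (\<lambda>s. fji ((x + 0 *\<^sub>R ?i) + s *\<^sub>R ?j))) (at 0 within UNIV)"
    proof (rule leibniz_rule_field_derivative[where fx = "\<lambda>h s. fji ((x + h *\<^sub>R ?i) + s *\<^sub>R ?j)"])
      show "((\<lambda>h. fj ((x + h *\<^sub>R ?i) + s *\<^sub>R ?j)) has_real_derivative fji ((x + h *\<^sub>R ?i) + s *\<^sub>R ?j)) (at h within UNIV)" for h s
        using has_partial_line[OF ij, of "x + s *\<^sub>R ?j" h] by (simp add: add_ac)
      show "(\<lambda>s. fj ((x + h *\<^sub>R ?i) + s *\<^sub>R ?j)) integrable_on cbox 0 a" for h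
        by (intro integrable_continuous continuous_on_compose2[OF cont(1)] continuous_intros) auto
      show "continuous_on (UNIV \<times> cbox 0 a) (\<lambda>(h, s). fji ((x + h *\<^sub>R ?i) + s *\<^sub>R ?j))"
        unfolding split_beta by (intro continuous_on_compose2[OF cont(2)] continuous_intros) auto
    qed auto
    moreover have "((\<lambda>h. f ((x + a *\<^sub>R ?j) + h *\<^sub>R ?i) - f (x + h *\<^sub>R ?i)) has_real_derivative (fi (x + a *\<^sub>R ?j) - fi x)) (at 0)"
      using i by (intro DERIV_diff) (auto simp: has_partial_def)
    ultimately have "fi (x + a *\<^sub>R ?j) - fi x = integral {0..a} (\<lambda>s. fji ((x + 0 *\<^sub>R ?i) + s *\<^sub>R ?j))"
      unfolding cbox_interval ftc[OF that] by (rule DERIV_unique[rotated])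
    then show ?thesis by simp
  qed
  \<comment> \<open>The integral formula was obtained for a \<ge> 0 only, so derivatives in
    \<open>a\<close> at 0 are compared within {0..1}, where they are still unique.\<close>
  have "((\<lambda>a. integral {0..a} (\<lambda>s. fji (x + s *\<^sub>R ?j))) has_real_derivative fji (x + 0 *\<^sub>R ?j)) (at 0 within {0..1})"
  proof (rule integral_has_real_derivative)
    show "continuous_on {0..1} (\<lambda>s. fji (x + s *\<^sub>R ?j))"
      by (intro continuous_on_compose2[OF cont(2)] continuous_intros) auto
  qed auto
  then have I: "((\<lambda>a. integral {0..a} (\<lambda>s. fji (x + s *\<^sub>R ?j))) has_real_derivative fji x) (at 0 within {0..1})"
    by simp
  have "((\<lambda>a. fi (x + a *\<^sub>R ?j) - fi x) has_real_derivative fji x) (at 0 within {0..1})"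
  proof (rule has_field_derivative_transform_within[OF I, of 1])
    show "integral {0..a} (\<lambda>s. fji (x + s *\<^sub>R ?j)) = fi (x + a *\<^sub>R ?j) - fi x" if "a \<in> {0..1}" for a
      by (rule *[symmetric]) (use that in auto)
  qed auto
  moreover have "((\<lambda>a. fi (x + a *\<^sub>R ?j) - fi x) has_real_derivative (fij - 0)) (at 0 within {0..1})"
    using DERIV_diff[OF ji[unfolded has_partial_def] DERIV_const]
    by (rule has_field_derivative_at_within)
  moreover have "at 0 within {0..1::real} \<noteq> bot"
    by (simp add: at_within_Icc_at_right)
  ultimately have "fji x = fij - 0"
    unfolding has_real_derivative_iff_has_vector_derivative
    by (intro vector_derivative_unique_within)
  then show ?thesis by (simp only: diff_0_right)
qed

section \<open>Smooth functions\<close>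

lemma C_on_cong: "C_on k S f \<Longrightarrow> (\<And>x. x \<in> S \<Longrightarrow> f x = g x) \<Longrightarrow> C_on k S g"
proof (cases k)
  case 0
  assume "C_on k S f" "\<And>x. x \<in> S \<Longrightarrow> f x = g x"
  then show ?thesis using 0 by (simp cong: continuous_on_cong)
next
  case (Suc n)
  assume f: "C_on k S f" and eq: "\<And>x. x \<in> S \<Longrightarrow> f x = g x"
  then obtain f' where "\<And>x. x \<in> S \<Longrightarrow> (f has_derivative f' x) (at x within S)" "\<And>v. C_on n S (\<lambda>x. f' x v)"
    using Suc by auto
  then have "\<forall>x\<in>S. (g has_derivative f' x) (at x within S)"
    using has_derivative_transform[of _ S g f] eq by auto
  then show ?thesis
    using Suc \<open>\<And>v. C_on n S (\<lambda>x. f' x v)\<close> by auto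
qed

lemma C_on_bounded_linear:
  assumes "bounded_linear L"
  shows "C_on k S f \<Longrightarrow> C_on k S (\<lambda>x. L (f x))"
proof (induction k arbitrary: f)
  case 0
  then show ?case using assms by (auto intro: bounded_linear.continuous_on)
next
  case (Suc k)
  then obtain f' where "\<And>x. x \<in> S \<Longrightarrow> (f has_derivative f' x) (at x within S)" "\<And>v. C_on k S (\<lambda>x. f' x v)"
    by auto
  then have "\<forall>x\<in>S. ((\<lambda>x. L (f x)) has_derivative (\<lambda>v. L (f' x v))) (at x within S)"
    "\<forall>v. C_on k S (\<lambda>x. L (f' x v))"
    using Suc.IH bounded_linear.has_derivative[OF assms] by blast+
  then show ?case
    unfolding C_on.simps by (intro exI[of _ "\<lambda>x v. L (f' x v)"] conjI)
qed

lemma C_on_add: "C_on k S f \<Longrightarrow> C_on k S g \<Longrightarrow> C_on k S (\<lambda>x. f x + g x)"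
proof (induction k arbitrary: f g)
  case 0
  then show ?case by (auto intro: continuous_intros)
next
  case (Suc k)
  obtain f' where "\<And>x. x \<in> S \<Longrightarrow> (f has_derivative f' x) (at x within S)" "\<And>v. C_on k S (\<lambda>x. f' x v)"
    using Suc.prems(1) by auto
  moreover obtain g' where "\<And>x. x \<in> S \<Longrightarrow> (g has_derivative g' x) (at x within S)" "\<And>v. C_on k S (\<lambda>x. g' x v)"
    using Suc.prems(2) by auto
  ultimately have "\<forall>x\<in>S. ((\<lambda>x. f x + g x) has_derivative (\<lambda>v. f' x v + g' x v)) (at x within S)"
    "\<forall>v. C_on k S (\<lambda>x. f' x v + g' x v)"
    using Suc.IH has_derivative_add by blast+
  then show ?case
    unfolding C_on.simps by (intro exI[of _ "\<lambda>x v. f' x v + g' x v"] conjI)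
qed

lemma smooth_on_imp_continuous_on: "smooth_on S f \<Longrightarrow> continuous_on S f"
  unfolding smooth_on_def using C_on.simps(1) by blast

lemma smooth_on_add: "smooth_on S f \<Longrightarrow> smooth_on S g \<Longrightarrow> smooth_on S (\<lambda>x. f x + g x)"
  by (simp add: smooth_on_def C_on_add)

lemma smooth_on_bounded_linear: "bounded_linear L \<Longrightarrow> smooth_on S f \<Longrightarrow> smooth_on S (\<lambda>x. L (f x))"
  by (simp add: smooth_on_def C_on_bounded_linear)

text \<open>A spatial partial derivative is the full derivative applied to the vector (e_i, 0). The
  line through (x, t) in this direction stays inside the domain, so even at t = 0 the derivative
  within the set yields an ordinary derivative in space.\<close>

lemma smooth_on_partial:
  fixes f :: "real \<Rightarrow> real^3 \<Rightarrow> real"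
  assumes "smooth_on (UNIV \<times> {0..<T}) (\<lambda>(x, t). f t x)"
  shows "smooth_on (UNIV \<times> {0..<T}) (\<lambda>(x, t). partial i (f t) x)"
    and "t \<in> {0..<T} \<Longrightarrow> has_partial i (f t) (partial i (f t) x) x"
proof -
  let ?S = "UNIV \<times> {0..<T} :: ((real^3) \<times> real) set"
  have hp: "has_partial i (f t) (D (axis i 1, 0)) x"
    if "((\<lambda>(x, t). f t x) has_derivative D) (at (x, t) within ?S)" "t \<in> {0..<T}" for D x t
  proof -
    have "((\<lambda>h. (x + h *\<^sub>R axis i 1, t)) has_derivative (\<lambda>h. (h *\<^sub>R axis i 1, 0))) (at 0)"
      by (auto intro!: derivative_eq_intros)
    moreover have "((\<lambda>(x, t). f t x) has_derivative D)
        (at (x + 0 *\<^sub>R axis i 1, t) within (range (\<lambda>h. (x + h *\<^sub>R axis i 1, t))))"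
      using that by (auto intro: has_derivative_subset)
    ultimately have "((\<lambda>h. case (x + h *\<^sub>R axis i 1, t) of (x, t) \<Rightarrow> f t x) has_derivative
        (\<lambda>h. D (h *\<^sub>R axis i 1, 0))) (at 0)"
      by (rule has_derivative_in_compose)
    moreover have "D (h *\<^sub>R axis i 1, 0) = D (axis i 1, 0) * h" for h
      using linear_scale[OF has_derivative_linear[OF that(1)], of h "(axis i 1, 0)"] by simp
    ultimately show ?thesis by (simp add: has_partial_def has_field_derivative_def)
  qed
  have ex: "\<exists>f'. (\<forall>p\<in>?S. ((\<lambda>(x, t). f t x) has_derivative f' p) (at p within ?S)) \<and> (\<forall>v. C_on k ?S (\<lambda>p. f' p v))" for k
    using assms unfolding smooth_on_def by (metis C_on.simps(2))
  show "has_partial i (f t) (partial i (f t) x) x" if t: "t \<in> {0..<T}"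
  proof -
    obtain f' where "\<forall>p\<in>?S. ((\<lambda>(x, t). f t x) has_derivative f' p) (at p within ?S)" using ex by blast
    then have "has_partial i (f t) (f' (x, t) (axis i 1, 0)) x" using t by (intro hp) auto
    then show ?thesis using has_partial_imp_partial by metis
  qed
  show "smooth_on ?S (\<lambda>(x, t). partial i (f t) x)"
    unfolding smooth_on_def
  proof
    fix k
    \<comment> \<open>The derivative \<open>f'\<close> obtained here depends on \<open>k\<close>,
      but its value at (e_i, 0) is the same partial derivative for every \<open>k\<close>.\<close>
    obtain f' where f': "\<forall>p\<in>?S. ((\<lambda>(x, t). f t x) has_derivative f' p) (at p within ?S)"
      and C: "\<forall>v. C_on k ?S (\<lambda>p. f' p v)" using ex by blast
    have "C_on k ?S (\<lambda>p. f' p (axis i 1, 0))" using C by blast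
    then show "C_on k ?S (\<lambda>(x, t). partial i (f t) x)"
    proof (rule C_on_cong)
      fix p assume p: "p \<in> ?S"
      obtain x t where [simp]: "p = (x, t)" by (cases p)
      have "has_partial i (f t) (f' p (axis i 1, 0)) x" using f' p by (intro hp) auto
      then show "f' p (axis i 1, 0) = (case p of (x, t) \<Rightarrow> partial i (f t) x)"
        by (simp add: has_partial_imp_partial)
    qed
  qed
qed

section \<open>Time-dependent families and sources with compact support\<close>

definition continuous_family :: "real \<Rightarrow> (real \<Rightarrow> real^3 \<Rightarrow> real) \<Rightarrow> bool" where
  "continuous_family T f \<longleftrightarrow> continuous_on ({0..<T} \<times> UNIV) (\<lambda>(t, x). f t x)"

definition continuous_source :: "real \<Rightarrow> real \<Rightarrow> (real \<Rightarrow> real^3 \<Rightarrow> real) \<Rightarrow> bool" where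
  "continuous_source T R f \<longleftrightarrow>
     continuous_family T f \<and> (\<forall>t\<in>{0..<T}. \<forall>x. R < norm x \<longrightarrow> f t x = 0)"

text \<open>The function is asked to vanish for |x| > R. This set is open, so the condition passes
  to all spatial partial derivatives with the same \<open>R\<close>.\<close>

definition smooth_source :: "real \<Rightarrow> real \<Rightarrow> (real \<Rightarrow> real^3 \<Rightarrow> real) \<Rightarrow> bool" where
  "smooth_source T R f \<longleftrightarrow>
     smooth_on (UNIV \<times> {0..<T}) (\<lambda>(x, t). f t x) \<and> (\<forall>t\<in>{0..<T}. \<forall>x. R < norm x \<longrightarrow> f t x = 0)"

text \<open>Joint continuity of function and derivative is bundled with differentiability, so that
  the relation survives convolution, Duhamel integrals and time integrals.\<close>

definition family_partial :: "real \<Rightarrow> 3 \<Rightarrow> (real \<Rightarrow> real^3 \<Rightarrow> real) \<Rightarrow> (real \<Rightarrow> real^3 \<Rightarrow> real) \<Rightarrow> bool" where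
  "family_partial T i f f' \<longleftrightarrow> continuous_family T f \<and> continuous_family T f' \<and>
     (\<forall>t\<in>{0..<T}. \<forall>x. has_partial i (f t) (f' t x) x)"

lemma continuous_family_compose:
  assumes "continuous_family T f" "continuous_on A a" "continuous_on A b" "\<And>p. p \<in> A \<Longrightarrow> a p \<in> {0..<T}"
  shows "continuous_on A (\<lambda>p. f (a p) (b p))"
proof -
  have "continuous_on A (\<lambda>p. (a p, b p))" using assms by (intro continuous_intros)
  moreover have "(\<lambda>p. (a p, b p)) ` A \<subseteq> {0..<T} \<times> UNIV" using assms(4) by auto
  ultimately show ?thesis
    using continuous_on_compose2[OF assms(1)[unfolded continuous_family_def], of A "\<lambda>p. (a p, b p)"] by simp
qed

lemma continuous_family_slice: "continuous_family T f \<Longrightarrow> t \<in> {0..<T} \<Longrightarrow> continuous_on A (f t)"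
  using continuous_family_compose[of T f A "\<lambda>_. t" "\<lambda>x. x"] by (auto intro: continuous_intros)

lemma borel_measurable_continuous_family:
  "continuous_family T f \<Longrightarrow> t \<in> {0..<T} \<Longrightarrow> f t \<in> borel_measurable borel"
  by (intro borel_measurable_continuous_onI continuous_family_slice)

lemma continuous_family_add: "continuous_family T f \<Longrightarrow> continuous_family T g \<Longrightarrow> continuous_family T (\<lambda>t x. f t x + g t x)"
  and continuous_family_minus: "continuous_family T f \<Longrightarrow> continuous_family T (\<lambda>t x. - f t x)"
  unfolding continuous_family_def case_prod_unfold by (auto intro: continuous_intros)

lemma family_partial_add:
  "family_partial T i f f' \<Longrightarrow> family_partial T i g g' \<Longrightarrow> family_partial T i (\<lambda>t x. f t x + g t x) (\<lambda>t x. f' t x + g' t x)"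
  by (auto simp: family_partial_def continuous_family_add has_partial_add)

lemma family_partial_minus:
  "family_partial T i f f' \<Longrightarrow> family_partial T i (\<lambda>t x. - f t x) (\<lambda>t x. - f' t x)"
  by (auto simp: family_partial_def continuous_family_minus has_partial_minus)

lemma smooth_source_imp_continuous_source: "smooth_source T R f \<Longrightarrow> continuous_source T R f"
proof -
  assume f: "smooth_source T R f"
  then have "continuous_on (UNIV \<times> {0..<T}) (\<lambda>(x, t). f t x)"
    by (simp add: smooth_source_def smooth_on_imp_continuous_on)
  then have "continuous_on ({0..<T} \<times> UNIV) (\<lambda>p. case (snd p, fst p) of (x, t) \<Rightarrow> f t x)"
    by (rule continuous_on_compose2) (auto intro!: continuous_intros)
  then have "continuous_family T f"
    by (simp add: continuous_family_def case_prod_unfold)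
  then show ?thesis using f by (auto simp: continuous_source_def smooth_source_def)
qed

lemma smooth_source_imp_continuous_family: "smooth_source T R f \<Longrightarrow> continuous_family T f"
  using smooth_source_imp_continuous_source continuous_source_def by blast

lemma smooth_source_partial:
  assumes "smooth_source T R f"
  shows "smooth_source T R (\<lambda>t. partial i (f t))"
    and "family_partial T i f (\<lambda>t. partial i (f t))"
proof -
  have hp: "has_partial i (f t) (partial i (f t) x) x" if "t \<in> {0..<T}" for t x
    using assms that smooth_on_partial(2) unfolding smooth_source_def by blast
  have "partial i (f t) x = 0" if t: "t \<in> {0..<T}" and x: "R < norm x" for t x
  proof -
    have "((\<lambda>h. f t (x + h *\<^sub>R axis i 1)) has_real_derivative 0) (at 0)"
    proof (rule has_field_derivative_transform_within[where S = UNIV and d = "norm x - R"])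
      show "((\<lambda>h::real. 0::real) has_real_derivative 0) (at 0 within UNIV)" by simp
      show "0 < norm x - R" using x by simp
      fix h :: real assume "dist h 0 < norm x - R"
      moreover have "norm (x + h *\<^sub>R axis i 1) \<ge> norm x - \<bar>h\<bar>"
        using norm_diff_ineq[of x "h *\<^sub>R axis i 1"] by (simp add: norm_axis_1)
      ultimately have "R < norm (x + h *\<^sub>R axis i 1)" by (simp add: dist_real_def)
      then show "0 = f t (x + h *\<^sub>R axis i 1)" using assms t by (simp add: smooth_source_def)
    qed auto
    then show ?thesis by (intro has_partial_imp_partial) (simp add: has_partial_def)
  qed
  then show s: "smooth_source T R (\<lambda>t. partial i (f t))"
    using assms smooth_on_partial(1) by (auto simp: smooth_source_def)
  show "family_partial T i f (\<lambda>t. partial i (f t))"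
    using assms s hp by (auto simp: family_partial_def intro: smooth_source_imp_continuous_family)
qed

lemma smooth_source_add:
  "smooth_source T R f \<Longrightarrow> smooth_source T R g \<Longrightarrow> smooth_source T R (\<lambda>t x. f t x + g t x)"
  using smooth_on_add[of "UNIV \<times> {0..<T}" "\<lambda>(x, t). f t x" "\<lambda>(x, t). g t x"]
  by (auto simp: smooth_source_def case_prod_unfold)

lemma smooth_source_minus: "smooth_source T R f \<Longrightarrow> smooth_source T R (\<lambda>t x. - f t x)"
  using smooth_on_bounded_linear[OF bounded_linear_minus[OF bounded_linear_ident], of "UNIV \<times> {0..<T}" "\<lambda>(x, t). f t x"]
  by (auto simp: smooth_source_def case_prod_unfold)

lemma smooth_source_diff:
  "smooth_source T R f \<Longrightarrow> smooth_source T R g \<Longrightarrow> smooth_source T R (\<lambda>t x. f t x - g t x)"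
  using smooth_source_add[OF _ smooth_source_minus, of T R f g] by simp

lemma smooth_source_sum3:
  assumes "\<And>j::3. smooth_source T R (f j)"
  shows "smooth_source T R (\<lambda>t x. \<Sum>j\<in>UNIV. f j t x)"
  unfolding sum_3 by (intro smooth_source_add assms)

lemma partial_partial_commute:
  assumes "smooth_source T R f" "t \<in> {0..<T}"
  shows "partial i (partial j (f t)) x = partial j (partial i (f t)) x"
proof -
  note s = smooth_source_partial[OF assms(1)]
  have 1: "has_partial k (f t) (partial k (f t) y) y" for k y
    using s(2)[of k] assms(2) by (auto simp: family_partial_def)
  have 2: "has_partial k (partial l (f t)) (partial k (partial l (f t)) y) y" for k l y
    using smooth_source_partial(2)[OF s(1)[of l], of k] assms(2) by (auto simp: family_partial_def)
  have 3: "continuous_on UNIV (partial l (f t))" for l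
    using s(1)[of l, THEN smooth_source_imp_continuous_family] assms(2) continuous_family_slice by blast
  have 4: "continuous_on UNIV (partial k (partial l (f t)))" for k l
    using smooth_source_partial(1)[OF s(1)[of l], of k, THEN smooth_source_imp_continuous_family] assms(2) continuous_family_slice by blast
  show ?thesis
    using has_partial_commute[OF 1[of j] 1[of i] 2[of j i] 2[of i j x] 3 4] .
qed

text \<open>Compactness of [0,T'] times the closed ball; beyond the ball the source vanishes. The
  bound may blow up as T' tends to T.\<close>

lemma continuous_source_bounded:
  assumes "continuous_source T R f" "T' < T"
  obtains B where "B \<ge> 0" "\<And>t x. t \<in> {0..T'} \<Longrightarrow> \<bar>f t x\<bar> \<le> B"
proof -
  have "compact ((\<lambda>(t, x). f t x) ` ({0..T'} \<times> cball 0 R))"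
    using assms by (intro compact_continuous_image compact_Times)
      (auto simp: continuous_source_def continuous_family_def elim: continuous_on_subset)
  then obtain B where B: "\<And>y. y \<in> (\<lambda>(t, x). f t x) ` ({0..T'} \<times> cball 0 R) \<Longrightarrow> norm y \<le> B"
    using compact_imp_bounded bounded_iff by metis
  show ?thesis
  proof
    show "max B 0 \<ge> 0" by simp
    fix t x assume t: "t \<in> {0..T'}"
    show "\<bar>f t x\<bar> \<le> max B 0"
    proof (cases "norm x \<le> R")
      case True
      then have "f t x \<in> (\<lambda>(t, x). f t x) ` ({0..T'} \<times> cball 0 R)" using t by force
      then show ?thesis using B by fastforce
    next
      case False
      then show ?thesis using assms t by (auto simp: continuous_source_def)
    qed
  qed
qed

section \<open>The heat flow of square integrable data\<close>

definition heat_partial :: "3 \<Rightarrow> real \<Rightarrow> real^3 \<Rightarrow> real" where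
  "heat_partial i t z = - (z $ i / (2 * t)) * heat_kernel z t"

definition heat_partial2 :: "3 \<Rightarrow> 3 \<Rightarrow> real \<Rightarrow> real^3 \<Rightarrow> real" where
  "heat_partial2 i j t z =
     (z $ i * z $ j / (4 * t\<^sup>2) - (if i = j then 1 / (2 * t) else 0)) * heat_kernel z t"

lemma norm_sq_add_axis:
  fixes x :: "real^3"
  shows "(norm (x + h *\<^sub>R axis i 1))\<^sup>2 = (norm x)\<^sup>2 + 2 * h * x $ i + h\<^sup>2"
  using dot_norm[of x "h *\<^sub>R axis i 1"] by (simp add: inner_axis norm_axis_1 field_simps)

lemma has_partial_component: "has_partial j (\<lambda>x. x $ i) (if i = j then 1 else 0) x"
  unfolding has_partial_def by (auto intro!: derivative_eq_intros simp: axis_def)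

text \<open>The time enters as a constant. At t = 0 both kernel and derivative are 0, since
  \<open>0 powr a = 0\<close>; otherwise the exponential is differentiated.\<close>

lemma has_partial_heat_kernel: "has_partial i (\<lambda>z. heat_kernel z t) (heat_partial i t z) z"
  unfolding has_partial_def heat_kernel_def norm_sq_add_axis heat_partial_def
  by (cases "t = 0") (auto intro!: derivative_eq_intros)

lemma has_partial_heat_partial: "has_partial j (heat_partial i t) (heat_partial2 i j t z) z"
proof -
  have "has_partial j (\<lambda>z. (- 1 / (2 * t)) * (z $ i * heat_kernel z t))
    ((- 1 / (2 * t)) * ((if i = j then 1 else 0) * heat_kernel z t + z $ i * heat_partial j t z)) z"
    by (intro has_partial_cmult has_partial_mult has_partial_component has_partial_heat_kernel)
  moreover have "(\<lambda>z. (- 1 / (2 * t)) * (z $ i * heat_kernel z t)) = heat_partial i t"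
    by (auto simp: heat_partial_def)
  moreover have "(- 1 / (2 * t)) * ((if i = j then 1 else 0) * heat_kernel z t + z $ i * heat_partial j t z) = heat_partial2 i j t z"
    by (auto simp: heat_partial_def heat_partial2_def power2_eq_square algebra_simps)
  ultimately show ?thesis by simp
qed

text \<open>The heat equation for the kernel: both sides equal (|z|^2 / (4t^2) - 3 / (2t))
  \<Phi>(z,t), where the 3 is the dimension and comes from the power of t on one side and from the
  trace on the other.\<close>

lemma heat_kernel_time_derivative:
  assumes "t > 0"
  shows "(heat_kernel z has_real_derivative (\<Sum>i\<in>UNIV. heat_partial2 i i t z)) (at t)"
proof -
  have p: "(4 * pi * t) powr (- 3 / 2 - 1) = (4 * pi * t) powr (- 3 / 2) / (4 * pi * t)"
    using assms by (subst powr_diff) auto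
  have "((\<lambda>t. (4 * pi * t) powr (- 3 / 2)) has_real_derivative
      (- 3 / 2 * (4 * pi * t) powr (- 3 / 2 - 1)) * (4 * pi)) (at t)"
    using assms by (intro DERIV_chain'[where f = "\<lambda>t. 4 * pi * t" and g = "\<lambda>u. u powr (- 3 / 2)"]
        has_real_derivative_powr DERIV_cmult_Id) auto
  moreover have "((\<lambda>t. exp (- (norm z)\<^sup>2 / (4 * t))) has_real_derivative
      exp (- (norm z)\<^sup>2 / (4 * t)) * ((norm z)\<^sup>2 / (4 * t\<^sup>2))) (at t)"
    using assms by (auto intro!: derivative_eq_intros simp: field_simps power2_eq_square)
  ultimately have "(heat_kernel z has_real_derivative
      ((- 3 / 2 * (4 * pi * t) powr (- 3 / 2 - 1)) * (4 * pi)) * exp (- (norm z)\<^sup>2 / (4 * t))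
      + (exp (- (norm z)\<^sup>2 / (4 * t)) * ((norm z)\<^sup>2 / (4 * t\<^sup>2))) * (4 * pi * t) powr (- 3 / 2)) (at t)"
    unfolding heat_kernel_def by (rule DERIV_mult)
  moreover have "((- 3 / 2 * (4 * pi * t) powr (- 3 / 2 - 1)) * (4 * pi)) * exp (- (norm z)\<^sup>2 / (4 * t))
      + (exp (- (norm z)\<^sup>2 / (4 * t)) * ((norm z)\<^sup>2 / (4 * t\<^sup>2))) * (4 * pi * t) powr (- 3 / 2)
      = ((norm z)\<^sup>2 / (4 * t\<^sup>2) - 3 / (2 * t)) * heat_kernel z t"
    unfolding p heat_kernel_def using assms by (simp add: algebra_simps)
  moreover have "(\<Sum>i\<in>UNIV. heat_partial2 i i t z) = ((norm z)\<^sup>2 / (4 * t\<^sup>2) - 3 / (2 * t)) * heat_kernel z t"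
    unfolding heat_partial2_def power2_norm_eq_inner inner_vec_def sum_3
    by (simp add: algebra_simps add_divide_distrib)
  ultimately show ?thesis by simp
qed

text \<open>A common class for the Gaussian and its first and second derivatives: at most a
  quadratic factor times the Gaussian, with a constant uniform for times comparable to
  \<open>t0\<close>. One domination argument then serves all of them.\<close>

definition heat_type :: "(real \<Rightarrow> real^3 \<Rightarrow> real) \<Rightarrow> bool" where
  "heat_type K \<longleftrightarrow> continuous_on ({0<..} \<times> UNIV) (\<lambda>(t, z). K t z) \<and>
     (\<forall>t0>0. \<exists>D\<ge>0. \<forall>t\<in>{t0 / 2..2 * t0}. \<forall>z. \<bar>K t z\<bar> \<le> D * ((1 + (norm z)\<^sup>2) * heat_kernel z t))"

lemma continuous_on_heat_kernel: "continuous_on ({0<..} \<times> UNIV) (\<lambda>(t, z). heat_kernel z t)"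
  unfolding heat_kernel_def case_prod_unfold by (intro continuous_intros) auto

lemma heat_type_multiple:
  assumes "continuous_on ({0<..} \<times> UNIV) (\<lambda>(t, z). a t z)"
    and "\<And>t0. t0 > 0 \<Longrightarrow> \<exists>D\<ge>0. \<forall>t\<in>{t0 / 2..2 * t0}. \<forall>z. \<bar>a t z\<bar> \<le> D * (1 + (norm z)\<^sup>2)"
  shows "heat_type (\<lambda>t z. a t z * heat_kernel z t)"
  unfolding heat_type_def
proof (intro conjI allI impI)
  show "continuous_on ({0<..} \<times> UNIV) (\<lambda>(t, z). a t z * heat_kernel z t)"
    using continuous_on_mult[OF assms(1) continuous_on_heat_kernel] unfolding case_prod_unfold .
  fix t0 :: real assume "t0 > 0"
  then obtain D where D: "D \<ge> 0" "\<And>t z. t \<in> {t0 / 2..2 * t0} \<Longrightarrow> \<bar>a t z\<bar> \<le> D * (1 + (norm z)\<^sup>2)"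
    using assms(2) by blast
  show "\<exists>D\<ge>0. \<forall>t\<in>{t0 / 2..2 * t0}. \<forall>z. \<bar>a t z * heat_kernel z t\<bar> \<le> D * ((1 + (norm z)\<^sup>2) * heat_kernel z t)"
  proof (intro exI[of _ D] conjI ballI allI)
    fix t z assume "t \<in> {t0 / 2..2 * t0}"
    from mult_right_mono[OF D(2)[OF this, of z] heat_kernel_nonneg[of z t]]
    show "\<bar>a t z * heat_kernel z t\<bar> \<le> D * ((1 + (norm z)\<^sup>2) * heat_kernel z t)"
      by (simp add: abs_mult heat_kernel_nonneg mult.assoc)
  qed (rule D)
qed

lemma component_le_norm_sq: "\<bar>z $ i\<bar> \<le> 1 + (norm (z::real^3))\<^sup>2"
proof -
  have "\<bar>z $ i\<bar> \<le> norm z" by (rule component_le_norm_cart)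
  moreover have "norm z \<le> 1 + (norm z)\<^sup>2"
    using zero_le_power2[of "norm z - 1/2"] by (simp add: power2_eq_square algebra_simps)
  ultimately show ?thesis by linarith
qed

lemma heat_type_heat_kernel: "heat_type (\<lambda>t z. heat_kernel z t)"
proof -
  have "heat_type (\<lambda>t z. 1 * heat_kernel z t)"
    by (rule heat_type_multiple) (auto simp: case_prod_unfold intro!: exI[of _ 1])
  then show ?thesis by simp
qed

lemma heat_type_heat_partial: "heat_type (heat_partial i)"
proof -
  have "heat_type (\<lambda>t z. (- (z $ i / (2 * t))) * heat_kernel z t)"
  proof (rule heat_type_multiple)
    show "continuous_on ({0<..} \<times> UNIV) (\<lambda>(t, z::real^3). - (z $ i / (2 * t)))"
      unfolding case_prod_unfold by (intro continuous_intros) auto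
    fix t0 :: real assume t0: "t0 > 0"
    have "\<bar>- (z $ i / (2 * t))\<bar> \<le> (1 / t0) * (1 + (norm z)\<^sup>2)" if t: "t \<in> {t0 / 2..2 * t0}" for t and z :: "real^3"
    proof -
      have "\<bar>- (z $ i / (2 * t))\<bar> = (1 / (2 * t)) * \<bar>z $ i\<bar>" using t t0 by (simp add: abs_mult)
      also have "\<dots> \<le> (1 / t0) * (1 + (norm z)\<^sup>2)"
        using t t0 component_le_norm_sq[of z i] by (intro mult_mono) (auto simp: field_simps)
      finally show ?thesis .
    qed
    then show "\<exists>D\<ge>0. \<forall>t\<in>{t0 / 2..2 * t0}. \<forall>z. \<bar>- ((z::real^3) $ i / (2 * t))\<bar> \<le> D * (1 + (norm z)\<^sup>2)"
      using t0 by (intro exI[of _ "1 / t0"]) auto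
  qed
  then show ?thesis by (simp add: heat_partial_def[abs_def])
qed

lemma heat_type_heat_partial2: "heat_type (heat_partial2 i j)"
proof -
  have "heat_type (\<lambda>t z. (z $ i * z $ j / (4 * t\<^sup>2) - (if i = j then 1 / (2 * t) else 0)) * heat_kernel z t)"
  proof (rule heat_type_multiple)
    show "continuous_on ({0<..} \<times> UNIV) (\<lambda>(t, z::real^3). z $ i * z $ j / (4 * t\<^sup>2) - (if i = j then 1 / (2 * t) else 0))"
      unfolding case_prod_unfold by (cases "i = j") (auto intro!: continuous_intros)
    fix t0 :: real assume t0: "t0 > 0"
    have "\<bar>z $ i * z $ j / (4 * t\<^sup>2) - (if i = j then 1 / (2 * t) else 0)\<bar> \<le> (1 / t0\<^sup>2 + 1 / t0) * (1 + (norm z)\<^sup>2)"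
      if t: "t \<in> {t0 / 2..2 * t0}" for t and z :: "real^3"
    proof -
      have "t0\<^sup>2 \<le> (2 * t)\<^sup>2" using t t0 by (intro power_mono) auto
      then have t2: "1 / (4 * t\<^sup>2) \<le> 1 / t0\<^sup>2" using t t0 by (intro divide_left_mono) (auto simp: power_mult_distrib)
      have "\<bar>z $ i\<bar> * \<bar>z $ j\<bar> \<le> norm z * norm z"
        by (intro mult_mono component_le_norm_cart) auto
      then have "\<bar>z $ i * z $ j\<bar> \<le> 1 + (norm z)\<^sup>2" by (simp add: abs_mult power2_eq_square)
      then have "(1 / (4 * t\<^sup>2)) * \<bar>z $ i * z $ j\<bar> \<le> (1 / t0\<^sup>2) * (1 + (norm z)\<^sup>2)"
        using t2 by (intro mult_mono) auto
      moreover have "1 / (2 * t) \<le> (1 / t0) * (1 + (norm z)\<^sup>2)"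
      proof -
        have "1 / (2 * t) * 1 \<le> (1 / t0) * (1 + (norm z)\<^sup>2)"
          using t t0 by (intro mult_mono) (auto simp: field_simps)
        then show ?thesis by simp
      qed
      moreover have "\<bar>z $ i * z $ j / (4 * t\<^sup>2)\<bar> = (1 / (4 * t\<^sup>2)) * \<bar>z $ i * z $ j\<bar>" by simp
      moreover have "\<bar>if i = j then 1 / (2 * t) else 0\<bar> \<le> 1 / (2 * t)" using t t0 by simp
      ultimately show ?thesis unfolding distrib_right by linarith
    qed
    then show "\<exists>D\<ge>0. \<forall>t\<in>{t0 / 2..2 * t0}. \<forall>z. \<bar>(z::real^3) $ i * z $ j / (4 * t\<^sup>2) - (if i = j then 1 / (2 * t) else 0)\<bar> \<le> D * (1 + (norm z)\<^sup>2)"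
      using t0 by (intro exI[of _ "1 / t0\<^sup>2 + 1 / t0"]) auto
  qed
  then show ?thesis by (simp add: heat_partial2_def[abs_def])
qed

text \<open>Produces a Gaussian in \<open>y\<close> alone, uniformly for x in a ball and t near
  \<open>t0\<close>, from |x - y|^2 \<ge> |y|^2 / 2 - M^2.\<close>

lemma heat_type_gaussian_bound:
  assumes "heat_type K" "t0 > 0"
  obtains C c where "C \<ge> 0" "c > 0"
    "\<And>t x (y::real^3). t \<in> {t0 / 2..2 * t0} \<Longrightarrow> norm x \<le> M \<Longrightarrow> \<bar>K t (x - y)\<bar> \<le> C * exp (- (c * (norm y)\<^sup>2))"
proof -
  obtain D where D: "D \<ge> 0" "\<And>t z. t \<in> {t0 / 2..2 * t0} \<Longrightarrow> \<bar>K t z\<bar> \<le> D * ((1 + (norm z)\<^sup>2) * heat_kernel z t)"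
    using assms unfolding heat_type_def by metis
  \<comment> \<open>For t \<le> 2 t0 the exponent is at least s / (8 t0) with s = |x - y|^2. Half of
    it, s / (16 t0), pays for the factor 1 + s, and \<open>A\<close> is the price: 1 + s \<le> A (1
    + s / (16 t0)). Passing from s to |y|^2 / 2 in the other half leaves 1 / (32 t0) and the factor
    exp (M^2 / (16 t0)).\<close>
  define A where "A = max 1 (16 * t0)"
  define C where "C = D * (A * (2 * pi * t0) powr (- 3 / 2)) * exp (M\<^sup>2 / (16 * t0))"
  show ?thesis
  proof
    show "C \<ge> 0" using D(1) assms(2) by (simp add: C_def A_def)
    show "1 / (32 * t0) > 0" using assms(2) by simp
    fix t and x y :: "real^3" assume t: "t \<in> {t0 / 2..2 * t0}" and x: "norm x \<le> M"
    define s where "s = (norm (x - y))\<^sup>2"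
    have s0: "s \<ge> 0" by (simp add: s_def)
    have "(norm y)\<^sup>2 = (norm (x - (x - y)))\<^sup>2" by simp
    also have "\<dots> \<le> (norm x + norm (x - y))\<^sup>2" by (intro power_mono norm_triangle_ineq4) auto
    also have "\<dots> \<le> 2 * (norm x)\<^sup>2 + 2 * s"
      using zero_le_power2[of "norm x - norm (x - y)"] by (simp add: s_def power2_eq_square algebra_simps)
    also have "(norm x)\<^sup>2 \<le> M\<^sup>2" using x by (intro power_mono) auto
    finally have sy: "(norm y)\<^sup>2 / 2 - M\<^sup>2 \<le> s" by simp
    have "1 + s \<le> A * (1 + s / (16 * t0))"
    proof -
      have "s \<le> A * (s / (16 * t0))"
      proof -
        have "16 * t0 * (s / (16 * t0)) \<le> A * (s / (16 * t0))"
          using s0 assms(2) by (intro mult_right_mono) (auto simp: A_def)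
        then show ?thesis using assms(2) by simp
      qed
      moreover have "1 \<le> A" by (simp add: A_def)
      ultimately show ?thesis by (simp add: distrib_left)
    qed
    also have "\<dots> \<le> A * exp (s / (16 * t0))"
      by (intro mult_left_mono exp_ge_add_one_self) (auto simp: A_def)
    finally have s1: "1 + s \<le> A * exp (s / (16 * t0))" .
    have "(4 * pi * t) powr (- 3 / 2) \<le> (2 * pi * t0) powr (- 3 / 2)"
      using t assms(2) by (intro powr_mono2') auto
    moreover have "exp (- s / (4 * t)) \<le> exp (- s / (8 * t0))"
      using t assms(2) s0 by (auto simp: field_simps intro!: mult_left_mono)
    ultimately have h: "heat_kernel (x - y) t \<le> (2 * pi * t0) powr (- 3 / 2) * exp (- s / (8 * t0))"
      unfolding heat_kernel_def s_def by (intro mult_mono) auto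
    have "\<bar>K t (x - y)\<bar> \<le> D * ((1 + s) * heat_kernel (x - y) t)" using D(2)[OF t] by (simp add: s_def)
    also have "\<dots> \<le> D * ((A * exp (s / (16 * t0))) * ((2 * pi * t0) powr (- 3 / 2) * exp (- s / (8 * t0))))"
      using D(1) s1 h s0 by (intro mult_left_mono mult_mono) (auto simp: heat_kernel_nonneg A_def)
    also have "\<dots> = D * (A * (2 * pi * t0) powr (- 3 / 2)) * (exp (s / (16 * t0)) * exp (- s / (8 * t0)))"
      by (simp add: mult_ac)
    also have "exp (s / (16 * t0)) * exp (- s / (8 * t0)) = exp (- s / (16 * t0))"
      using assms(2) by (simp add: exp_add[symmetric] field_simps)
    also have "\<dots> \<le> exp (M\<^sup>2 / (16 * t0) - 1 / (32 * t0) * (norm y)\<^sup>2)"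
      using sy assms(2) by (simp add: field_simps)
    also have "\<dots> = exp (M\<^sup>2 / (16 * t0)) * exp (- (1 / (32 * t0) * (norm y)\<^sup>2))"
      by (simp add: exp_add[symmetric])
    finally show "\<bar>K t (x - y)\<bar> \<le> C * exp (- (1 / (32 * t0) * (norm y)\<^sup>2))"
      using D(1) assms(2) by (simp add: C_def mult.assoc A_def mult_left_mono)
  qed
qed

text \<open>The scalar Borel counterpart of \<open>L2\<close>, to which product measures and
  substitutions apply.\<close>

definition square_integrable :: "(real^3 \<Rightarrow> real) \<Rightarrow> bool" where
  "square_integrable f \<longleftrightarrow> f \<in> borel_measurable borel \<and> integrable lborel (\<lambda>x. (f x)\<^sup>2)"

text \<open>By 2ab \<le> a^2 + b^2 the product is dominated by a squared Gaussian plus f^2, a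
  function of \<open>y\<close> that does not see \<open>t\<close> and \<open>x\<close>.\<close>

lemma heat_type_dominated:
  assumes "heat_type K" "t0 > 0" "square_integrable f"
  obtains W where "integrable lborel W"
    "\<And>t x (y::real^3). t \<in> {t0 / 2..2 * t0} \<Longrightarrow> norm x \<le> M \<Longrightarrow> \<bar>K t (x - y) * f y\<bar> \<le> W y"
proof -
  obtain C c where C: "C \<ge> 0" "c > 0"
    "\<And>t x (y::real^3). t \<in> {t0 / 2..2 * t0} \<Longrightarrow> norm x \<le> M \<Longrightarrow> \<bar>K t (x - y)\<bar> \<le> C * exp (- (c * (norm y)\<^sup>2))"
    using heat_type_gaussian_bound[OF assms(1,2)] by metis
  show ?thesis
  proof
    show "integrable lborel (\<lambda>y. C\<^sup>2 * exp (- ((2 * c) * (norm y)\<^sup>2)) + (f y)\<^sup>2)"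
      using C(2) assms(3) by (intro Bochner_Integration.integrable_add integrable_mult_right integrable_gaussian) (auto simp: square_integrable_def)
    fix t and x y :: "real^3" assume "t \<in> {t0 / 2..2 * t0}" "norm x \<le> M"
    then have k: "\<bar>K t (x - y)\<bar> \<le> C * exp (- (c * (norm y)\<^sup>2))" (is "_ \<le> ?e") by (rule C)
    have "\<bar>K t (x - y) * f y\<bar> \<le> ?e * \<bar>f y\<bar>" using k by (simp add: abs_mult mult_right_mono)
    also have "\<dots> \<le> ?e\<^sup>2 + (f y)\<^sup>2"
    proof -
      have "0 \<le> ?e * \<bar>f y\<bar>" using C(1) by simp
      moreover have "2 * (?e * \<bar>f y\<bar>) \<le> ?e\<^sup>2 + (f y)\<^sup>2"
        using zero_le_power2[of "?e - \<bar>f y\<bar>"] unfolding power2_diff by simp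
      ultimately show ?thesis by linarith
    qed
    also have "?e\<^sup>2 = C\<^sup>2 * exp (- ((2 * c) * (norm y)\<^sup>2))"
      by (simp add: power_mult_distrib power2_eq_square[of "exp _"] exp_add[symmetric])
    finally show "\<bar>K t (x - y) * f y\<bar> \<le> C\<^sup>2 * exp (- ((2 * c) * (norm y)\<^sup>2)) + (f y)\<^sup>2" .
  qed
qed

lemma heat_type_slice:
  assumes "heat_type K" "t > 0"
  shows "continuous_on UNIV (K t)" "K t \<in> borel_measurable borel"
proof -
  have "continuous_on UNIV (\<lambda>z. case (t, z) of (t, z) \<Rightarrow> K t z)"
    by (rule continuous_on_compose2[of "{0<..} \<times> UNIV" "\<lambda>(t, z). K t z"])
      (use assms in \<open>auto simp: heat_type_def intro!: continuous_on_Pair\<close>)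
  then show "continuous_on UNIV (K t)" by simp
  then show "K t \<in> borel_measurable borel" by (rule borel_measurable_continuous_onI)
qed

lemma heat_type_measurable:
  assumes "heat_type K" "t > 0" "square_integrable f"
  shows "(\<lambda>y. K t (x - y) * f y) \<in> borel_measurable lborel"
proof -
  have [measurable]: "K t \<in> borel_measurable borel" "f \<in> borel_measurable borel"
    using heat_type_slice(2)[OF assms(1,2)] assms(3) by (auto simp: square_integrable_def)
  show ?thesis by measurable
qed

lemma heat_type_integrable:
  assumes "heat_type K" "t > 0" "square_integrable f"
  shows "integrable lborel (\<lambda>y. K t (x - y) * f y)"
proof -
  obtain W where W: "integrable lborel W"
    "\<And>t' x' y. t' \<in> {t / 2..2 * t} \<Longrightarrow> norm x' \<le> norm x \<Longrightarrow> \<bar>K t' (x' - y) * f y\<bar> \<le> W y"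
    using heat_type_dominated[OF assms, of "norm x"] by metis
  have "\<bar>K t (x - y) * f y\<bar> \<le> W y" for y using assms(2) by (intro W) auto
  then show ?thesis
    by (intro Bochner_Integration.integrable_bound[OF W(1)] heat_type_measurable assms)
      (auto intro!: AE_I2 order_trans[OF _ abs_ge_self])
qed

lemma heat_type_convolution_continuous:
  assumes K: "heat_type K" and f: "square_integrable f"
  shows "continuous_on ({0<..} \<times> UNIV) (\<lambda>(t, x). \<integral>y. K t (x - y) * f y \<partial>lborel)"
  unfolding case_prod_unfold
proof (rule continuous_on_integral_dominated)
  fix p :: "real \<times> (real^3)" assume "p \<in> {0<..} \<times> UNIV"
  then have p: "fst p > 0" by auto
  show "(\<lambda>y. K (fst p) (snd p - y) * f y) \<in> borel_measurable lborel"
    using K p f by (rule heat_type_measurable)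
  obtain W where W: "integrable lborel W"
    "\<And>t' x' y. t' \<in> {fst p / 2..2 * fst p} \<Longrightarrow> norm x' \<le> norm (snd p) + 1 \<Longrightarrow> \<bar>K t' (x' - y) * f y\<bar> \<le> W y"
    using heat_type_dominated[OF K p f, of "norm (snd p) + 1"] by metis
  show "\<exists>d>0. \<exists>W. integrable lborel W \<and> (\<forall>q\<in>{0<..} \<times> UNIV. dist q p < d \<longrightarrow>
      (\<forall>w\<in>space lborel. \<bar>K (fst q) (snd q - w) * f w\<bar> \<le> W w))"
  \<comment> \<open>The radius keeps the time of a neighbouring point within [t/2, 2t], where the
    bound \<open>W\<close> is valid, and its position within distance 1.\<close>
  proof (intro exI[of _ "min 1 (fst p / 2)"] exI[of _ W] conjI ballI impI W)
    fix q w assume q: "dist q p < min 1 (fst p / 2)"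
    have "dist (fst q) (fst p) < fst p / 2" "dist (snd q) (snd p) < 1"
      using q dist_fst_le[of q p] dist_snd_le[of q p] by auto
    then have "fst q - fst p < fst p / 2" "fst p - fst q < fst p / 2" "norm (snd q - snd p) < 1"
      unfolding dist_real_def dist_norm by linarith+
    then show "fst q \<in> {fst p / 2..2 * fst p}" "norm (snd q) \<le> norm (snd p) + 1"
      using norm_triangle_ineq2[of "snd q" "snd p"] p by auto
  qed (use p in auto)
next
  fix y :: "real^3"
  show "continuous_on ({0<..} \<times> UNIV) (\<lambda>p. K (fst p) (snd p - y) * f y)"
  proof (intro continuous_intros)
    have "continuous_on ({0<..} \<times> UNIV) (\<lambda>p. case (fst p, snd p - y) of (t, z) \<Rightarrow> K t z)"
      by (rule continuous_on_compose2[of "{0<..} \<times> UNIV" "\<lambda>(t, z). K t z"])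
        (use K in \<open>auto simp: heat_type_def intro!: continuous_on_Pair continuous_on_fst continuous_on_snd continuous_on_diff\<close>)
    then show "continuous_on ({0<..} \<times> UNIV) (\<lambda>p. K (fst p) (snd p - y))" by simp
  qed
qed

lemma heat_type_convolution_partial:
  assumes K: "heat_type K" and K': "heat_type K'" and f: "square_integrable f" and t: "t > 0"
    and der: "\<And>z. has_partial i (K t) (K' t z) z"
  shows "has_partial i (\<lambda>x. \<integral>y. K t (x - y) * f y \<partial>lborel) (\<integral>y. K' t (x - y) * f y \<partial>lborel) x"
proof -
  obtain W where W: "integrable lborel W"
    "\<And>t' x' y. t' \<in> {t / 2..2 * t} \<Longrightarrow> norm x' \<le> norm x + 1 \<Longrightarrow> \<bar>K' t' (x' - y) * f y\<bar> \<le> W y"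
    using heat_type_dominated[OF K' t f, of "norm x + 1"] by metis
  have "((\<lambda>h. \<integral>y. K t (x + h *\<^sub>R axis i 1 - y) * f y \<partial>lborel) has_real_derivative
    (\<integral>y. K' t (x + 0 *\<^sub>R axis i 1 - y) * f y \<partial>lborel)) (at 0)"
  proof (rule has_real_derivative_integral[where d = 1 and W = W and k' = "\<lambda>h y. K' t (x + h *\<^sub>R axis i 1 - y) * f y"])
    fix h :: real and y :: "real^3"
    show "((\<lambda>h. K t (x + h *\<^sub>R axis i 1 - y) * f y) has_real_derivative K' t (x + h *\<^sub>R axis i 1 - y) * f y) (at h)"
      using DERIV_cmult_right[OF has_partial_line[of i "K t" "K' t", OF der, of "x - y" h]] by (simp add: algebra_simps)
    assume "\<bar>h - 0\<bar> < 1"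
    then have "norm (x + h *\<^sub>R axis i 1) \<le> norm x + 1"
      using norm_triangle_ineq[of x "h *\<^sub>R axis i 1"] by (simp add: norm_axis_1)
    then show "\<bar>K' t (x + h *\<^sub>R axis i 1 - y) * f y\<bar> \<le> W y" using t by (intro W) auto
  qed (use W(1) heat_type_integrable[OF K t f] heat_type_measurable[OF K' t f] in auto)
  then show ?thesis by (simp add: has_partial_def)
qed

definition heat_flow :: "real \<Rightarrow> (real^3 \<Rightarrow> real) \<Rightarrow> real^3 \<Rightarrow> real" where
  "heat_flow t f x = (\<integral>y. heat_kernel (x - y) t * f y \<partial>lborel)"

text \<open>The derivative is given as a sum of second spatial derivatives of the flow, so that it
  cancels literally against the Laplacian from \<open>heat_flow_partial\<close>.\<close>

lemma heat_flow_time_derivative: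
  assumes f: "square_integrable f" and t: "t > 0"
  shows "((\<lambda>t. heat_flow t f x) has_real_derivative
    (\<Sum>i\<in>UNIV. \<integral>y. heat_partial2 i i t (x - y) * f y \<partial>lborel)) (at t)"
proof -
  have "\<exists>W. \<forall>i. integrable lborel (W i) \<and> (\<forall>t' x' y. t' \<in> {t / 2..2 * t} \<longrightarrow> norm x' \<le> norm x \<longrightarrow>
      \<bar>heat_partial2 i i t' (x' - y) * f y\<bar> \<le> W i y)"
    by (intro choice allI) (metis heat_type_dominated[OF heat_type_heat_partial2 t f, of "norm x"])
  then obtain W where W: "\<And>i. integrable lborel (W i)"
    "\<And>i t' x' y. t' \<in> {t / 2..2 * t} \<Longrightarrow> norm x' \<le> norm x \<Longrightarrow> \<bar>heat_partial2 i i t' (x' - y) * f y\<bar> \<le> W i y"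
    by blast
  have "((\<lambda>t. \<integral>y. heat_kernel (x - y) t * f y \<partial>lborel) has_real_derivative
    (\<integral>y. (\<Sum>i\<in>UNIV. heat_partial2 i i t (x - y)) * f y \<partial>lborel)) (at t)"
  proof (rule has_real_derivative_integral[where d = "t / 2" and W = "\<lambda>y. \<Sum>i\<in>UNIV. W i y"
        and k' = "\<lambda>t y. (\<Sum>i\<in>UNIV. heat_partial2 i i t (x - y)) * f y"])
    fix s :: real and y :: "real^3"
    assume s: "\<bar>s - t\<bar> < t / 2"
    then have s0: "s > 0" and si: "s \<in> {t / 2..2 * t}" by (simp_all, linarith+)
    show "integrable lborel (\<lambda>y. heat_kernel (x - y) s * f y)"
      using heat_type_integrable[OF heat_type_heat_kernel s0 f] by simp
    show "((\<lambda>t. heat_kernel (x - y) t * f y) has_real_derivative (\<Sum>i\<in>UNIV. heat_partial2 i i s (x - y)) * f y) (at s)"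
      by (intro DERIV_cmult_right heat_kernel_time_derivative s0)
    have "\<bar>(\<Sum>i\<in>UNIV. heat_partial2 i i s (x - y)) * f y\<bar> \<le> (\<Sum>i\<in>UNIV. \<bar>heat_partial2 i i s (x - y) * f y\<bar>)"
      unfolding sum_distrib_right by (rule sum_abs)
    also have "\<dots> \<le> (\<Sum>i\<in>UNIV. W i y)" using si by (intro sum_mono W) auto
    finally show "\<bar>(\<Sum>i\<in>UNIV. heat_partial2 i i s (x - y)) * f y\<bar> \<le> (\<Sum>i\<in>UNIV. W i y)" .
  next
    show "(\<lambda>y. (\<Sum>i\<in>UNIV. heat_partial2 i i t (x - y)) * f y) \<in> borel_measurable lborel"
      unfolding sum_distrib_right by (intro borel_measurable_sum heat_type_measurable heat_type_heat_partial2 t f)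
  qed (use t W(1) in auto)
  also have "(\<integral>y. (\<Sum>i\<in>UNIV. heat_partial2 i i t (x - y)) * f y \<partial>lborel) =
      (\<Sum>i\<in>UNIV. \<integral>y. heat_partial2 i i t (x - y) * f y \<partial>lborel)"
    unfolding sum_distrib_right by (intro Bochner_Integration.integral_sum heat_type_integrable heat_type_heat_partial2 t f)
  finally show ?thesis unfolding heat_flow_def .
qed

lemma heat_flow_partial:
  assumes "square_integrable f" "t > 0"
  shows "has_partial i (heat_flow t f) (\<integral>y. heat_partial i t (x - y) * f y \<partial>lborel) x"
    and "has_partial j (\<lambda>x. \<integral>y. heat_partial i t (x - y) * f y \<partial>lborel)
      (\<integral>y. heat_partial2 i j t (x - y) * f y \<partial>lborel) x"
  using heat_type_convolution_partial[OF heat_type_heat_kernel heat_type_heat_partial assms has_partial_heat_kernel]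
    heat_type_convolution_partial[OF heat_type_heat_partial heat_type_heat_partial2 assms has_partial_heat_partial]
  unfolding heat_flow_def[abs_def] by blast+

section \<open>Convolution with locally integrable kernels\<close>

text \<open>Admits the Newtonian kernel with its singularity as well as continuous kernels without
  decay; both can be convolved with bounded functions of compact support.\<close>

definition locally_integrable :: "(real^3 \<Rightarrow> real) \<Rightarrow> bool" where
  "locally_integrable K \<longleftrightarrow> K \<in> borel_measurable borel \<and>
     (\<forall>\<rho>. integrable lborel (\<lambda>z. indicator (cball 0 \<rho>) z * \<bar>K z\<bar>))"

text \<open>The integration variable sits in the kernel, so that derivatives in \<open>x\<close>
  fall on \<open>f\<close>; \<open>conv_commute\<close> gives the opposite form.\<close>

definition conv :: "(real^3 \<Rightarrow> real) \<Rightarrow> (real^3 \<Rightarrow> real) \<Rightarrow> real^3 \<Rightarrow> real" where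
  "conv K f x = (\<integral>z. K z * f (x - z) \<partial>lborel)"

lemma conv_dominated:
  fixes f K :: "real^3 \<Rightarrow> real"
  assumes "\<And>z. \<bar>f z\<bar> \<le> B" "\<And>z. R < norm z \<Longrightarrow> f z = 0" "norm x \<le> M"
  shows "\<bar>K z * f (x - z)\<bar> \<le> B * (indicator (cball 0 (R + M)) z * \<bar>K z\<bar>)"
proof (cases "norm z \<le> R + M")
  case True
  have "\<bar>f (x - z)\<bar> * \<bar>K z\<bar> \<le> B * \<bar>K z\<bar>" using mult_right_mono[OF assms(1), of "\<bar>K z\<bar>"] by simp
  then show ?thesis using True by (simp add: abs_mult mult.commute)
next
  case False
  have "norm z \<le> norm (x - z) + norm x" using norm_triangle_sub[of z x] by (simp add: norm_minus_commute)
  then have "R < norm (x - z)" using False assms(3) by linarith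
  then show ?thesis using False assms(2) by simp
qed

lemma conv_integrable:
  assumes "locally_integrable K" "f \<in> borel_measurable borel"
    and f: "\<And>z. \<bar>f z\<bar> \<le> B" "\<And>z. R < norm z \<Longrightarrow> f z = 0"
  shows "integrable lborel (\<lambda>z. K z * f (x - z))"
proof (rule Bochner_Integration.integrable_bound)
  show "integrable lborel (\<lambda>z. B * (indicator (cball 0 (R + norm x)) z * \<bar>K z\<bar>))"
    using assms(1) by (intro integrable_mult_right) (auto simp: locally_integrable_def)
  have [measurable]: "K \<in> borel_measurable borel" "f \<in> borel_measurable borel"
    using assms by (auto simp: locally_integrable_def)
  show "(\<lambda>z. K z * f (x - z)) \<in> borel_measurable lborel" by measurable
  show "AE z in lborel. norm (K z * f (x - z)) \<le> norm (B * (indicator (cball 0 (R + norm x)) z * \<bar>K z\<bar>))"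
    unfolding real_norm_def
    by (intro AE_I2 order_trans[OF conv_dominated[OF f order_refl] abs_ge_self])
qed

lemma locally_integrable_continuous:
  assumes "continuous_on UNIV K"
  shows "locally_integrable K"
  unfolding locally_integrable_def
proof (intro conjI allI)
  show "K \<in> borel_measurable borel" using assms by (rule borel_measurable_continuous_onI)
  fix \<rho>
  have "continuous_on (cball 0 \<rho>) (\<lambda>z. \<bar>K z\<bar>)"
    using assms by (intro continuous_on_rabs) (rule continuous_on_subset, auto)
  then show "integrable lborel (\<lambda>z. indicator (cball 0 \<rho>) z * \<bar>K z\<bar>)"
    using borel_integrable_compact[of "cball 0 \<rho>" "\<lambda>z. \<bar>K z\<bar>"] by simp
qed

lemma conv_commute:
  assumes [measurable]: "K \<in> borel_measurable borel" "f \<in> borel_measurable borel"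
  shows "conv K f x = (\<integral>y. K (x - y) * f y \<partial>lborel)"
  unfolding conv_def using lborel_integral_reflect[of "\<lambda>z. K z * f (x - z)" x] by simp

lemma continuous_source_conv:
  assumes K: "locally_integrable K" and f: "continuous_source T R f"
  shows "continuous_family T (\<lambda>t. conv K (f t))"
  unfolding continuous_family_def conv_def case_prod_unfold
proof (rule continuous_on_integral_dominated)
  have fam: "continuous_family T f" using f by (simp add: continuous_source_def)
  have [measurable]: "K \<in> borel_measurable borel" using K by (simp add: locally_integrable_def)
  fix p :: "real \<times> (real^3)" assume p: "p \<in> {0..<T} \<times> UNIV"
  then have pT: "fst p \<in> {0..<T}" by auto
  have [measurable]: "f (fst p) \<in> borel_measurable borel"
    using fam pT by (rule borel_measurable_continuous_family)
  show "(\<lambda>z. K z * f (fst p) (snd p - z)) \<in> borel_measurable lborel" by measurable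
  \<comment> \<open>A time strictly between the current one and \<open>T\<close>: the source is
    bounded up to \<open>T'\<close>, hence uniformly for all nearby times.\<close>
  define T' where "T' = (fst p + T) / 2"
  have T': "fst p < T'" "T' < T" using pT by (auto simp: T'_def field_simps)
  obtain B where B: "B \<ge> 0" "\<And>t x. t \<in> {0..T'} \<Longrightarrow> \<bar>f t x\<bar> \<le> B"
    using continuous_source_bounded[OF f T'(2)] by blast
  show "\<exists>d>0. \<exists>W. integrable lborel W \<and> (\<forall>q\<in>{0..<T} \<times> UNIV. dist q p < d \<longrightarrow>
      (\<forall>z\<in>space lborel. \<bar>K z * f (fst q) (snd q - z)\<bar> \<le> W z))"
  proof (intro exI[of _ "min 1 (T' - fst p)"] exI[of _ "\<lambda>z. B * (indicator (cball 0 (R + (norm (snd p) + 1))) z * \<bar>K z\<bar>)"] conjI ballI impI)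
    show "integrable lborel (\<lambda>z. B * (indicator (cball 0 (R + (norm (snd p) + 1))) z * \<bar>K z\<bar>))"
      using K by (intro integrable_mult_right) (auto simp: locally_integrable_def)
    fix q :: "real \<times> (real^3)" and z assume q: "q \<in> {0..<T} \<times> UNIV" "dist q p < min 1 (T' - fst p)"
    have d: "\<bar>fst q - fst p\<bar> < T' - fst p" "norm (snd q - snd p) < 1"
      using q dist_fst_le[of q p] dist_snd_le[of q p] by (auto simp: dist_real_def dist_norm)
    have "norm (snd q) \<le> norm (snd p) + 1"
      using d(2) norm_triangle_ineq2[of "snd q" "snd p"] by simp
    moreover have "\<And>z. \<bar>f (fst q) z\<bar> \<le> B" using d(1) q by (intro B) auto
    moreover have "\<And>z. R < norm z \<Longrightarrow> f (fst q) z = 0" using f q by (auto simp: continuous_source_def)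
    ultimately show "\<bar>K z * f (fst q) (snd q - z)\<bar> \<le> B * (indicator (cball 0 (R + (norm (snd p) + 1))) z * \<bar>K z\<bar>)"
      by (intro conv_dominated)
  qed (use T' in auto)
next
  fix z :: "real^3"
  show "continuous_on ({0..<T} \<times> UNIV) (\<lambda>p. K z * f (fst p) (snd p - z))"
    using f by (intro continuous_on_mult continuous_on_const continuous_family_compose[of T f])
      (auto simp: continuous_source_def intro!: continuous_on_diff continuous_on_fst continuous_on_snd)
qed

text \<open>All smoothness is taken from \<open>f\<close>, which lets the kernel be
  singular.\<close>

lemma conv_partial_right:
  assumes K: "locally_integrable K" and f: "f \<in> borel_measurable borel" "f' \<in> borel_measurable borel"
    and b: "\<And>z. \<bar>f z\<bar> \<le> B" "\<And>z. \<bar>f' z\<bar> \<le> B"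
    and s: "\<And>z. R < norm z \<Longrightarrow> f z = 0" "\<And>z. R < norm z \<Longrightarrow> f' z = 0"
    and der: "\<And>z. has_partial i f (f' z) z"
  shows "has_partial i (conv K f) (conv K f' x) x"
proof -
  have "((\<lambda>h. \<integral>z. K z * f (x + h *\<^sub>R axis i 1 - z) \<partial>lborel) has_real_derivative
    (\<integral>z. K z * f' (x + 0 *\<^sub>R axis i 1 - z) \<partial>lborel)) (at 0)"
  proof (rule has_real_derivative_integral[where d = 1 and k' = "\<lambda>h z. K z * f' (x + h *\<^sub>R axis i 1 - z)"
        and W = "\<lambda>z. B * (indicator (cball 0 (R + (norm x + 1))) z * \<bar>K z\<bar>)"])
    fix h :: real and z :: "real^3"
    show "integrable lborel (\<lambda>z. K z * f (x + h *\<^sub>R axis i 1 - z))"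
      using conv_integrable[OF K f(1) b(1) s(1)] .
    show "((\<lambda>h. K z * f (x + h *\<^sub>R axis i 1 - z)) has_real_derivative K z * f' (x + h *\<^sub>R axis i 1 - z)) (at h)"
      using DERIV_cmult[OF has_partial_line[of i f f' "x - z" h, OF der], of "K z"] by (simp add: algebra_simps)
    assume "\<bar>h - 0\<bar> < 1"
    then have "norm (x + h *\<^sub>R axis i 1) \<le> norm x + 1"
      using norm_triangle_ineq[of x "h *\<^sub>R axis i 1"] by (simp add: norm_axis_1)
    then show "\<bar>K z * f' (x + h *\<^sub>R axis i 1 - z)\<bar> \<le> B * (indicator (cball 0 (R + (norm x + 1))) z * \<bar>K z\<bar>)"
      using conv_dominated[of f' B R] b(2) s(2) by blast
  next
    show "integrable lborel (\<lambda>z. B * (indicator (cball 0 (R + (norm x + 1))) z * \<bar>K z\<bar>))"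
      using K by (intro integrable_mult_right) (auto simp: locally_integrable_def)
    show "(\<lambda>z. K z * f' (x + 0 *\<^sub>R axis i 1 - z)) \<in> borel_measurable lborel"
      using conv_integrable[OF K f(2) b(2) s(2)] by (rule borel_measurable_integrable)
  qed simp
  then show ?thesis by (simp add: has_partial_def conv_def)
qed

text \<open>The companion of \<open>conv_partial_right\<close> with the derivative on the kernel.
  Computing one derivative of a convolution in both ways takes the place of integration by
  parts.\<close>

lemma conv_partial_left:
  assumes K: "continuous_on UNIV K" "continuous_on UNIV K'" and f: "f \<in> borel_measurable borel"
    and b: "\<And>z. \<bar>f z\<bar> \<le> B" and s: "\<And>z. R < norm z \<Longrightarrow> f z = 0"
    and der: "\<And>z. has_partial i K (K' z) z"
  shows "has_partial i (conv K f) (conv K' f x) x"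
proof -
  have [measurable]: "f \<in> borel_measurable borel" "K \<in> borel_measurable borel" "K' \<in> borel_measurable borel"
    using f K by (auto intro: borel_measurable_continuous_onI)
  have B: "B \<ge> 0" using b[of 0] by linarith
  have int: "integrable lborel (\<lambda>y. k (x - y) * f y)" if k: "continuous_on UNIV k" for k x
  proof -
    have [measurable]: "k \<in> borel_measurable borel" using k by (rule borel_measurable_continuous_onI)
    have "integrable lborel (\<lambda>z. k z * f (x - z))"
      using conv_integrable[OF locally_integrable_continuous[OF k] f b s] .
    then show ?thesis
      using lborel_integrable_reflect[of "\<lambda>z. k z * f (x - z)" x] by simp
  qed
  have "compact (K' ` cball 0 (norm x + 1 + R))"
    by (intro compact_continuous_image continuous_on_subset[OF K(2)]) auto
  then have "bounded (K' ` cball 0 (norm x + 1 + R))" by (rule compact_imp_bounded)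
  then obtain D where "\<forall>y\<in>K' ` cball 0 (norm x + 1 + R). norm y \<le> D"
    unfolding bounded_iff by blast
  then have D: "\<bar>K' z\<bar> \<le> D" if "norm z \<le> norm x + 1 + R" for z using that by auto
  have "((\<lambda>h. \<integral>y. K (x + h *\<^sub>R axis i 1 - y) * f y \<partial>lborel) has_real_derivative
    (\<integral>y. K' (x + 0 *\<^sub>R axis i 1 - y) * f y \<partial>lborel)) (at 0)"
  proof (rule has_real_derivative_integral[where d = 1 and k' = "\<lambda>h y. K' (x + h *\<^sub>R axis i 1 - y) * f y"
        and W = "\<lambda>z. D * B * indicator (cball 0 R) z"])
    fix h :: real and y :: "real^3"
    show "integrable lborel (\<lambda>y. K (x + h *\<^sub>R axis i 1 - y) * f y)" using int K(1) by blast
    show "((\<lambda>h. K (x + h *\<^sub>R axis i 1 - y) * f y) has_real_derivative K' (x + h *\<^sub>R axis i 1 - y) * f y) (at h)"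
      using DERIV_cmult_right[OF has_partial_line[of i K K' "x - y" h, OF der], of "f y"] by (simp add: algebra_simps)
    assume "\<bar>h - 0\<bar> < 1"
    then have n: "norm (x + h *\<^sub>R axis i 1) \<le> norm x + 1"
      using norm_triangle_ineq[of x "h *\<^sub>R axis i 1"] by (simp add: norm_axis_1)
    show "\<bar>K' (x + h *\<^sub>R axis i 1 - y) * f y\<bar> \<le> D * B * indicator (cball 0 R) y"
    proof (cases "norm y \<le> R")
      case True
      then have "\<bar>K' (x + h *\<^sub>R axis i 1 - y)\<bar> \<le> D"
        using n norm_triangle_ineq4[of "x + h *\<^sub>R axis i 1" y] by (intro D) linarith
      then have "\<bar>K' (x + h *\<^sub>R axis i 1 - y)\<bar> * \<bar>f y\<bar> \<le> D * B"
        using b B by (intro mult_mono) auto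
      then show ?thesis using True by (simp add: abs_mult)
    next
      case False
      then show ?thesis using s by simp
    qed
  next
    show "integrable lborel (\<lambda>z. D * B * indicator (cball 0 R) z :: real)"
      using emeasure_bounded_finite[of "cball 0 R"] by (intro integrable_mult_right integrable_real_indicator) auto
    show "(\<lambda>y. K' (x + 0 *\<^sub>R axis i 1 - y) * f y) \<in> borel_measurable lborel" by measurable
  qed simp
  then show ?thesis by (simp add: has_partial_def conv_commute)
qed

lemma continuous_source_slice:
  assumes "continuous_source T R f" "t \<in> {0..<T}"
  obtains B where "f t \<in> borel_measurable borel" "\<And>x. \<bar>f t x\<bar> \<le> B" "\<And>x. R < norm x \<Longrightarrow> f t x = 0"
proof -
  have tT: "t < T" using assms(2) by simp
  obtain B where "B \<ge> 0" and B: "\<And>s x. s \<in> {0..t} \<Longrightarrow> \<bar>f s x\<bar> \<le> B"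
    by (rule continuous_source_bounded[OF assms(1) tT], rule that)
  show ?thesis
  proof
    show "f t \<in> borel_measurable borel"
      using assms borel_measurable_continuous_family by (auto simp: continuous_source_def)
    show "\<bar>f t x\<bar> \<le> B" for x using assms(2) by (intro B) auto
    show "f t x = 0" if "R < norm x" for x using assms that by (auto simp: continuous_source_def)
  qed
qed

lemma smooth_source_partial_slice:
  assumes f: "smooth_source T R f" and t: "t \<in> {0..<T}"
  obtains B where "f t \<in> borel_measurable borel" "partial i (f t) \<in> borel_measurable borel"
    "\<And>x. \<bar>f t x\<bar> \<le> B" "\<And>x. \<bar>partial i (f t) x\<bar> \<le> B"
    "\<And>x. R < norm x \<Longrightarrow> f t x = 0" "\<And>x. R < norm x \<Longrightarrow> partial i (f t) x = 0"
    "\<And>x. has_partial i (f t) (partial i (f t) x) x"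
proof -
  note s = smooth_source_partial[OF f, of i]
  obtain B1 where B1: "f t \<in> borel_measurable borel" "\<And>x. \<bar>f t x\<bar> \<le> B1" "\<And>x. R < norm x \<Longrightarrow> f t x = 0"
    by (rule continuous_source_slice[OF smooth_source_imp_continuous_source[OF f] t], rule that)
  obtain B2 where B2: "partial i (f t) \<in> borel_measurable borel" "\<And>x. \<bar>partial i (f t) x\<bar> \<le> B2"
    "\<And>x. R < norm x \<Longrightarrow> partial i (f t) x = 0"
    by (rule continuous_source_slice[OF smooth_source_imp_continuous_source[OF s(1)] t], rule that)
  show ?thesis
  proof
    show "\<bar>f t z\<bar> \<le> max B1 B2" "\<bar>partial i (f t) z\<bar> \<le> max B1 B2" for z
      using B1(2)[of z] B2(2)[of z] by linarith+
    show "has_partial i (f t) (partial i (f t) z) z" for z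
      using s(2) t by (auto simp: family_partial_def)
  qed (fact B1(1,3) B2(1,3))+
qed

lemma family_partial_conv:
  assumes K: "locally_integrable K" and f: "smooth_source T R f"
  shows "family_partial T i (\<lambda>t. conv K (f t)) (\<lambda>t. conv K (partial i (f t)))"
  unfolding family_partial_def
proof (intro conjI ballI allI)
  note s = smooth_source_partial[OF f, of i]
  show "continuous_family T (\<lambda>t. conv K (f t))" "continuous_family T (\<lambda>t. conv K (partial i (f t)))"
    using continuous_source_conv[OF K] f s(1) smooth_source_imp_continuous_source by blast+
  fix t x assume t: "t \<in> {0..<T}"
  obtain B where B: "f t \<in> borel_measurable borel" "partial i (f t) \<in> borel_measurable borel"
    "\<And>x. \<bar>f t x\<bar> \<le> B" "\<And>x. \<bar>partial i (f t) x\<bar> \<le> B"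
    "\<And>x. R < norm x \<Longrightarrow> f t x = 0" "\<And>x. R < norm x \<Longrightarrow> partial i (f t) x = 0"
    "\<And>x. has_partial i (f t) (partial i (f t) x) x"
    by (rule smooth_source_partial_slice[OF f t, of i], rule that)
  then show "has_partial i (conv K (f t)) (conv K (partial i (f t)) x) x"
    by (rule conv_partial_right[OF K])
qed

section \<open>Gaussian averages\<close>

text \<open>\<open>\<Phi>(r) * f\<close>, written so that it makes sense and is continuous up to \<open>r = 0\<close>.\<close>
definition gauss_avg :: "real \<Rightarrow> (real^3 \<Rightarrow> real) \<Rightarrow> real^3 \<Rightarrow> real" where
  "gauss_avg r f x = (\<integral>z. heat_kernel z 1 * f (x - sqrt r *\<^sub>R z) \<partial>lborel)"

lemma gauss_avg_0 [simp]: "gauss_avg 0 f x = f x"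
  by (simp add: gauss_avg_def integral_heat_kernel)

lemma gauss_avg_integrable:
  assumes [measurable]: "f \<in> borel_measurable borel" and b: "\<And>z. \<bar>f z\<bar> \<le> B"
  shows "integrable lborel (\<lambda>z. heat_kernel z 1 * f (x - sqrt r *\<^sub>R z))"
proof (rule Bochner_Integration.integrable_bound)
  show "integrable lborel (\<lambda>z. B * heat_kernel z 1)"
    by (intro integrable_mult_right integrable_heat_kernel) auto
  show "AE z in lborel. norm (heat_kernel z 1 * f (x - sqrt r *\<^sub>R z)) \<le> norm (B * heat_kernel z 1)"
  proof (rule AE_I2)
    fix z
    have "heat_kernel z 1 * \<bar>f (x - sqrt r *\<^sub>R z)\<bar> \<le> heat_kernel z 1 * \<bar>B\<bar>"
      using b[of "x - sqrt r *\<^sub>R z"] by (intro mult_left_mono) (auto simp: heat_kernel_nonneg)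
    then show "norm (heat_kernel z 1 * f (x - sqrt r *\<^sub>R z)) \<le> norm (B * heat_kernel z 1)"
      by (simp add: abs_mult heat_kernel_nonneg mult.commute)
  qed
qed measurable

text \<open>Parabolic scaling; \<open>sqrt r ^ 3\<close> is the Jacobian of the dilation by
  \<open>sqrt r\<close> in dimension three.\<close>

lemma heat_kernel_scale:
  assumes "r > 0"
  shows "sqrt r ^ 3 * heat_kernel (sqrt r *\<^sub>R z) r = heat_kernel z 1"
proof -
  have "sqrt r ^ 3 = r powr (3 / 2)"
    using assms by (simp add: powr_half_sqrt[symmetric] powr_power)
  moreover have "(4 * pi * r) powr (- 3 / 2) = (4 * pi) powr (- 3 / 2) * r powr (- 3 / 2)"
    using assms by (simp add: powr_mult)
  moreover have "r powr (3 / 2) * r powr (- 3 / 2) = 1"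
    using assms by (simp add: powr_add[symmetric])
  moreover have "- (norm (sqrt r *\<^sub>R z))\<^sup>2 / (4 * r) = - (norm z)\<^sup>2 / (4 * 1)"
    using assms by (simp add: power_mult_distrib)
  moreover have "p * (c * q * e) = c * e" if "p * q = 1" for p q c e :: real
    using that by (metis mult.assoc mult.commute mult_1)
  ultimately show ?thesis
    unfolding heat_kernel_def by (simp only: mult_1_right)
qed

lemma gauss_avg_eq_heat_flow:
  assumes "r > 0" and [measurable]: "f \<in> borel_measurable borel"
  shows "gauss_avg r f x = heat_flow r f x"
proof -
  have "heat_flow r f x = (sqrt r) ^ 3 * (\<integral>z. heat_kernel (x - (x + (- sqrt r) *\<^sub>R z)) r * f (x + (- sqrt r) *\<^sub>R z) \<partial>lborel)"
    unfolding heat_flow_def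
    using assms lborel_integral_affine[of "- sqrt r" "\<lambda>y. heat_kernel (x - y) r * f y" x] by simp
  also have "\<dots> = (\<integral>z. (sqrt r ^ 3 * heat_kernel (sqrt r *\<^sub>R z) r) * f (x - sqrt r *\<^sub>R z) \<partial>lborel)"
    by (simp add: mult.assoc flip: integral_mult_right_zero)
  finally show ?thesis by (simp add: heat_kernel_scale[OF assms(1)] gauss_avg_def)
qed

lemma gauss_avg_eq_conv:
  assumes "r > 0" "f \<in> borel_measurable borel"
  shows "gauss_avg r f x = conv (\<lambda>z. heat_kernel z r) f x"
  using assms by (simp add: gauss_avg_eq_heat_flow conv_commute heat_flow_def)

definition heat_second_moment :: real where
  "heat_second_moment = (\<integral>z. (norm z)\<^sup>2 * heat_kernel z 1 \<partial>lborel)"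

lemma heat_second_moment_nonneg: "heat_second_moment \<ge> 0"
  unfolding heat_second_moment_def by (intro integral_nonneg_AE AE_I2) (simp add: heat_kernel_nonneg)

lemma norm_sq_triangle: "(norm (a + b :: 'a::real_normed_vector))\<^sup>2 \<le> 2 * (norm a)\<^sup>2 + 2 * (norm b)\<^sup>2"
proof -
  have "(norm (a + b))\<^sup>2 \<le> (norm a + norm b)\<^sup>2" by (intro power_mono norm_triangle_ineq) auto
  also have "\<dots> \<le> 2 * (norm a)\<^sup>2 + 2 * (norm b)\<^sup>2"
    using zero_le_power2[of "norm a - norm b"] by (simp add: power2_eq_square algebra_simps)
  finally show ?thesis .
qed

text \<open>The integrand is nonzero only if |x - sqrt r z| \<le> R, and then |x|^2 \<le> 2 R^2 + 2
  r |z|^2. Averaging this against the Gaussian leaves its second moment.\<close>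

lemma gauss_avg_decay:
  assumes f: "f \<in> borel_measurable borel" and b: "\<And>z. \<bar>f z\<bar> \<le> B"
    and s: "\<And>z. R < norm z \<Longrightarrow> f z = 0" and r: "r \<ge> 0"
  shows "(1 + (norm x)\<^sup>2) * \<bar>gauss_avg r f x\<bar> \<le> B * (1 + 2 * R\<^sup>2 + 2 * r * heat_second_moment)"
proof -
  have B: "B \<ge> 0" using b[of 0] by linarith
  have "(1 + (norm x)\<^sup>2) * \<bar>gauss_avg r f x\<bar> \<le> (1 + (norm x)\<^sup>2) * (\<integral>z. \<bar>heat_kernel z 1 * f (x - sqrt r *\<^sub>R z)\<bar> \<partial>lborel)"
    unfolding gauss_avg_def by (intro mult_left_mono integral_abs_bound) auto
  also have "\<dots> = (\<integral>z. (1 + (norm x)\<^sup>2) * \<bar>heat_kernel z 1 * f (x - sqrt r *\<^sub>R z)\<bar> \<partial>lborel)" by simp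
  also have "\<dots> \<le> (\<integral>z. B * (1 + 2 * R\<^sup>2) * heat_kernel z 1 + B * (2 * r) * ((norm z)\<^sup>2 * heat_kernel z 1) \<partial>lborel)"
  proof (rule integral_mono)
    show "integrable lborel (\<lambda>z. (1 + (norm x)\<^sup>2) * \<bar>heat_kernel z 1 * f (x - sqrt r *\<^sub>R z)\<bar>)"
      using gauss_avg_integrable[OF f b] by (intro integrable_mult_right integrable_abs)
    show "integrable lborel (\<lambda>z. B * (1 + 2 * R\<^sup>2) * heat_kernel z 1 + B * (2 * r) * ((norm z)\<^sup>2 * heat_kernel z 1))"
      by (intro Bochner_Integration.integrable_add integrable_mult_right integrable_heat_kernel integrable_norm_sq_heat_kernel) auto
    fix z :: "real^3"
    have "(1 + (norm x)\<^sup>2) * \<bar>f (x - sqrt r *\<^sub>R z)\<bar> \<le> B * (1 + 2 * R\<^sup>2 + 2 * r * (norm z)\<^sup>2)"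
    proof (cases "norm (x - sqrt r *\<^sub>R z) \<le> R")
      case True
      have "(norm x)\<^sup>2 \<le> 2 * (norm (x - sqrt r *\<^sub>R z))\<^sup>2 + 2 * (norm (sqrt r *\<^sub>R z))\<^sup>2"
        using norm_sq_triangle[of "x - sqrt r *\<^sub>R z" "sqrt r *\<^sub>R z"] by simp
      also have "(norm (x - sqrt r *\<^sub>R z))\<^sup>2 \<le> R\<^sup>2" using True by (intro power_mono) auto
      also have "(norm (sqrt r *\<^sub>R z))\<^sup>2 = r * (norm z)\<^sup>2" using r by (simp add: power_mult_distrib)
      finally have "1 + (norm x)\<^sup>2 \<le> 1 + 2 * R\<^sup>2 + 2 * r * (norm z)\<^sup>2" by simp
      then have "(1 + (norm x)\<^sup>2) * \<bar>f (x - sqrt r *\<^sub>R z)\<bar> \<le> (1 + 2 * R\<^sup>2 + 2 * r * (norm z)\<^sup>2) * B"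
        using b r by (intro mult_mono) auto
      then show ?thesis by (simp add: mult.commute)
    next
      case False
      then show ?thesis using s B r by simp
    qed
    from mult_left_mono[OF this heat_kernel_nonneg[of z 1]]
    show "(1 + (norm x)\<^sup>2) * \<bar>heat_kernel z 1 * f (x - sqrt r *\<^sub>R z)\<bar>
        \<le> B * (1 + 2 * R\<^sup>2) * heat_kernel z 1 + B * (2 * r) * ((norm z)\<^sup>2 * heat_kernel z 1)"
      by (simp add: abs_mult heat_kernel_nonneg algebra_simps)
  qed
  also have "\<dots> = B * (1 + 2 * R\<^sup>2) * 1 + B * (2 * r) * heat_second_moment"
    unfolding heat_second_moment_def
    by (subst Bochner_Integration.integral_add)
      (auto simp: integral_heat_kernel integrable_norm_sq_heat_kernel integrable_heat_kernel)
  finally show ?thesis by (simp add: algebra_simps)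
qed

lemma gauss_avg_partial:
  assumes f: "f \<in> borel_measurable borel" "f' \<in> borel_measurable borel"
    and b: "\<And>z. \<bar>f z\<bar> \<le> B" "\<And>z. \<bar>f' z\<bar> \<le> B"
    and der: "\<And>z. has_partial i f (f' z) z"
  shows "has_partial i (gauss_avg r f) (gauss_avg r f' x) x"
proof -
  have "((\<lambda>h. \<integral>z. heat_kernel z 1 * f (x + h *\<^sub>R axis i 1 - sqrt r *\<^sub>R z) \<partial>lborel) has_real_derivative
    (\<integral>z. heat_kernel z 1 * f' (x + 0 *\<^sub>R axis i 1 - sqrt r *\<^sub>R z) \<partial>lborel)) (at 0)"
  proof (rule has_real_derivative_integral[where d = 1 and W = "\<lambda>z. heat_kernel z 1 * B"
        and k' = "\<lambda>h z. heat_kernel z 1 * f' (x + h *\<^sub>R axis i 1 - sqrt r *\<^sub>R z)"])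
    fix h :: real and z :: "real^3"
    show "integrable lborel (\<lambda>z. heat_kernel z 1 * f (x + h *\<^sub>R axis i 1 - sqrt r *\<^sub>R z))"
      using gauss_avg_integrable[OF f(1) b(1)] .
    show "((\<lambda>h. heat_kernel z 1 * f (x + h *\<^sub>R axis i 1 - sqrt r *\<^sub>R z)) has_real_derivative
        heat_kernel z 1 * f' (x + h *\<^sub>R axis i 1 - sqrt r *\<^sub>R z)) (at h)"
      using DERIV_cmult[OF has_partial_line[of i f f' "x - sqrt r *\<^sub>R z" h, OF der], of "heat_kernel z 1"]
      by (simp add: algebra_simps)
    show "\<bar>heat_kernel z 1 * f' (x + h *\<^sub>R axis i 1 - sqrt r *\<^sub>R z)\<bar> \<le> heat_kernel z 1 * B"
      using b(2) by (simp add: abs_mult heat_kernel_nonneg mult_left_mono)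
  next
    show "(\<lambda>z. heat_kernel z 1 * f' (x + 0 *\<^sub>R axis i 1 - sqrt r *\<^sub>R z)) \<in> borel_measurable lborel"
      using gauss_avg_integrable[OF f(2) b(2)] by (rule borel_measurable_integrable)
    show "integrable lborel (\<lambda>z. heat_kernel z 1 * B)" by (simp add: integrable_heat_kernel)
  qed simp
  then show ?thesis by (simp add: has_partial_def gauss_avg_def)
qed

text \<open>Continuity includes r = 0. The dominating function is a multiple of \<Phi>(z,1), since
  after the rescaling \<open>r\<close> and \<open>x\<close> occur only inside the bounded
  source.\<close>

lemma continuous_source_gauss_avg:
  assumes f: "continuous_source T R f"
  shows "continuous_on ({0..} \<times> {0..<T} \<times> UNIV) (\<lambda>(r, t, x). gauss_avg r (f t) x)"
  unfolding gauss_avg_def case_prod_unfold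
proof (rule continuous_on_integral_dominated)
  have fam: "continuous_family T f" using f by (simp add: continuous_source_def)
  fix p :: "real \<times> real \<times> (real^3)" assume p: "p \<in> {0..} \<times> {0..<T} \<times> UNIV"
  let ?t = "fst (snd p)"
  have pT: "?t \<in> {0..<T}" using p by auto
  have [measurable]: "f ?t \<in> borel_measurable borel"
    using fam pT by (rule borel_measurable_continuous_family)
  show "(\<lambda>z. heat_kernel z 1 * f ?t (snd (snd p) - sqrt (fst p) *\<^sub>R z)) \<in> borel_measurable lborel" by measurable
  define T' where "T' = (?t + T) / 2"
  have T': "?t < T'" "T' < T" using pT by (auto simp: T'_def field_simps)
  obtain B where B: "B \<ge> 0" "\<And>t x. t \<in> {0..T'} \<Longrightarrow> \<bar>f t x\<bar> \<le> B"
    using continuous_source_bounded[OF f T'(2)] by blast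
  show "\<exists>d>0. \<exists>W. integrable lborel W \<and> (\<forall>q\<in>{0..} \<times> {0..<T} \<times> UNIV. dist q p < d \<longrightarrow>
      (\<forall>z\<in>space lborel. \<bar>heat_kernel z 1 * f (fst (snd q)) (snd (snd q) - sqrt (fst q) *\<^sub>R z)\<bar> \<le> W z))"
  proof (intro exI[of _ "T' - ?t"] exI[of _ "\<lambda>z. heat_kernel z 1 * B"] conjI ballI impI)
    fix q :: "real \<times> real \<times> (real^3)" and z assume q: "q \<in> {0..} \<times> {0..<T} \<times> UNIV" "dist q p < T' - ?t"
    have "\<bar>fst (snd q) - ?t\<bar> < T' - ?t"
      using q dist_snd_le[of q p] dist_fst_le[of "snd q" "snd p"] by (auto simp: dist_real_def)
    then have "fst (snd q) \<in> {0..T'}" using q by auto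
    then show "\<bar>heat_kernel z 1 * f (fst (snd q)) (snd (snd q) - sqrt (fst q) *\<^sub>R z)\<bar> \<le> heat_kernel z 1 * B"
      using B(2) by (simp add: abs_mult heat_kernel_nonneg mult_left_mono)
  qed (use T' in \<open>auto simp: integrable_heat_kernel\<close>)
next
  fix z :: "real^3"
  show "continuous_on ({0..} \<times> {0..<T} \<times> UNIV) (\<lambda>p. heat_kernel z 1 * f (fst (snd p)) (snd (snd p) - sqrt (fst p) *\<^sub>R z))"
    using f by (intro continuous_on_mult continuous_on_const continuous_family_compose[of T f])
      (auto simp: continuous_source_def
        intro!: continuous_on_diff continuous_on_fst continuous_on_snd continuous_on_scaleR continuous_on_real_sqrt)
qed

lemma smooth_source_gauss_avg_partial:
  assumes f: "smooth_source T R f" and t: "t \<in> {0..<T}"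
  shows "has_partial i (gauss_avg r (f t)) (gauss_avg r (partial i (f t)) x) x"
proof -
  obtain B where B: "f t \<in> borel_measurable borel" "partial i (f t) \<in> borel_measurable borel"
    "\<And>x. \<bar>f t x\<bar> \<le> B" "\<And>x. \<bar>partial i (f t) x\<bar> \<le> B"
    "\<And>x. R < norm x \<Longrightarrow> f t x = 0" "\<And>x. R < norm x \<Longrightarrow> partial i (f t) x = 0"
    "\<And>x. has_partial i (f t) (partial i (f t) x) x"
    by (rule smooth_source_partial_slice[OF f t, of i], rule that)
  show ?thesis by (rule gauss_avg_partial[OF B(1-4,7)])
qed

section \<open>The heat equation for smooth sources\<close>

definition source_laplacian :: "(real \<Rightarrow> real^3 \<Rightarrow> real) \<Rightarrow> real \<Rightarrow> real^3 \<Rightarrow> real" where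
  "source_laplacian f t x = (\<Sum>i\<in>UNIV. partial i (partial i (f t)) x)"

lemma smooth_source_laplacian:
  "smooth_source T R f \<Longrightarrow> smooth_source T R (source_laplacian f)"
  unfolding source_laplacian_def[abs_def]
  by (intro smooth_source_sum3 smooth_source_partial(1))

lemma continuous_source_square_integrable:
  assumes "continuous_source T R f" "t \<in> {0..<T}"
  shows "square_integrable (f t)"
proof -
  obtain B where B: "f t \<in> borel_measurable borel" "\<And>x. \<bar>f t x\<bar> \<le> B" "\<And>x. R < norm x \<Longrightarrow> f t x = 0"
    by (rule continuous_source_slice[OF assms], rule that)
  have "continuous_on UNIV (f t)" using assms continuous_family_slice by (auto simp: continuous_source_def)
  \<comment> \<open>The square is read as the integrand of a convolution at the point 0: the kernel
    is \<open>f t\<close> itself, the other factor its reflection.\<close>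
  then have "integrable lborel (\<lambda>z. f t z * f t (0 - (- z)))"
    using conv_integrable[OF locally_integrable_continuous[of "\<lambda>z. f t z"], of "\<lambda>z. f t (- z)" B R 0] B
    by auto
  then show ?thesis using B(1) by (simp add: square_integrable_def power2_eq_square)
qed

text \<open>\<open>heat_flow\<close> gives the derivative with two derivatives on the kernel. By
  uniqueness of partial derivatives these convolutions are the Gaussian averages of the derivatives
  of the source.\<close>

lemma gauss_avg_time_derivative:
  assumes f: "smooth_source T R f" and t: "t \<in> {0..<T}" and r: "r > 0"
  shows "((\<lambda>r. gauss_avg r (f t) x) has_real_derivative gauss_avg r (source_laplacian f t) x) (at r)"
proof -
  note c = smooth_source_imp_continuous_source
  note s = smooth_source_partial(1)
  have sq: "square_integrable (f t)" using continuous_source_square_integrable[OF c[OF f] t] .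
  then have meas: "f t \<in> borel_measurable borel" by (simp add: square_integrable_def)
  have fl: "heat_flow r (f t) = gauss_avg r (f t)" if "r > 0" for r
    using gauss_avg_eq_heat_flow[OF that meas] by auto
  have 1: "(\<integral>y. heat_partial i r (x - y) * f t y \<partial>lborel) = gauss_avg r (partial i (f t)) x" for i x
    using heat_flow_partial(1)[OF sq r, where i = i and x = x] smooth_source_gauss_avg_partial[OF f t, where i = i and r = r and x = x]
    unfolding fl[OF r] by (metis has_partial_imp_partial)
  have 2: "(\<integral>y. heat_partial2 i i r (x - y) * f t y \<partial>lborel) = gauss_avg r (partial i (partial i (f t))) x" for i
    using heat_flow_partial(2)[OF sq r, where i = i and j = i and x = x] smooth_source_gauss_avg_partial[OF s[OF f, of i] t, where i = i and r = r and x = x]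
    unfolding 1 by (metis has_partial_imp_partial)
  have "((\<lambda>r. heat_flow r (f t) x) has_real_derivative (\<Sum>i\<in>UNIV. gauss_avg r (partial i (partial i (f t))) x)) (at r)"
    using heat_flow_time_derivative[OF sq r, of x] unfolding 2 .
  also have "(\<Sum>i\<in>UNIV. gauss_avg r (partial i (partial i (f t))) x) = gauss_avg r (source_laplacian f t) x"
  proof -
    have "\<exists>B. \<forall>x. \<bar>partial i (partial i (f t)) x\<bar> \<le> B" "partial i (partial i (f t)) \<in> borel_measurable borel" for i
      by (meson continuous_source_slice[OF c[OF s[OF s[OF f]]] t])+
    then obtain B where B: "\<And>i x. \<bar>partial i (partial i (f t)) x\<bar> \<le> B i"
      "\<And>i. partial i (partial i (f t)) \<in> borel_measurable borel" by metis
    show ?thesis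
      unfolding gauss_avg_def source_laplacian_def sum_distrib_left
      by (intro Bochner_Integration.integral_sum[symmetric] gauss_avg_integrable[OF B(2) B(1)])
  qed
  finally show ?thesis
  proof (rule has_field_derivative_transform_within)
    show "heat_flow r' (f t) x = gauss_avg r' (f t) x" if "dist r' r < r" for r'
      using that by (intro fun_cong[OF fl]) (auto simp: dist_real_def)
  qed (use r in auto)
qed

text \<open>The heat equation integrated down to \<rho> = 0. At that endpoint only continuity of the
  average is used, hence the interior form of the fundamental theorem.\<close>

lemma gauss_avg_heat_equation:
  assumes f: "smooth_source T R f" and t: "t \<in> {0..<T}" and r: "r \<ge> 0"
  shows "((\<lambda>\<rho>. gauss_avg \<rho> (source_laplacian f t) x) has_integral (gauss_avg r (f t) x - f t x)) {0..r}"
proof -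
  have "((\<lambda>\<rho>. gauss_avg \<rho> (source_laplacian f t) x) has_integral (gauss_avg r (f t) x - gauss_avg 0 (f t) x)) {0..r}"
  proof (rule fundamental_theorem_of_calculus_interior[OF r])
    have "continuous_on {0..r} (\<lambda>\<rho>. case (\<rho>, t, x) of (r, t, x) \<Rightarrow> gauss_avg r (f t) x)"
      by (rule continuous_on_compose2[OF continuous_source_gauss_avg[OF smooth_source_imp_continuous_source[OF f]]])
        (use t in \<open>auto intro!: continuous_on_Pair\<close>)
    then show "continuous_on {0..r} (\<lambda>\<rho>. gauss_avg \<rho> (f t) x)" by simp
    show "((\<lambda>\<rho>. gauss_avg \<rho> (f t) x) has_vector_derivative gauss_avg \<rho> (source_laplacian f t) x) (at \<rho>)"
      if "\<rho> \<in> {0<..<r}" for \<rho>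
      using gauss_avg_time_derivative[OF f t, of \<rho> x] that
      by (simp add: has_real_derivative_iff_has_vector_derivative)
  qed
  then show ?thesis by simp
qed

section \<open>The Newtonian potential and the kernel \<open>P\<close>\<close>

lemma has_partial_integral:
  fixes \<phi> \<phi>' :: "real^3 \<Rightarrow> real \<Rightarrow> real" and a b :: real
  assumes der: "\<And>\<theta> z. \<theta> \<in> {a..b} \<Longrightarrow> has_partial i (\<lambda>z. \<phi> z \<theta>) (\<phi>' z \<theta>) z"
    and cont: "continuous_on (UNIV \<times> {a..b}) (\<lambda>(z, \<theta>). \<phi> z \<theta>)" "continuous_on (UNIV \<times> {a..b}) (\<lambda>(z, \<theta>). \<phi>' z \<theta>)"
  shows "has_partial i (\<lambda>z. integral {a..b} (\<phi> z)) (integral {a..b} (\<phi>' x)) x"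
proof -
  have *: "continuous_on (A \<times> {a..b}) (\<lambda>(h, \<theta>). k (x + h *\<^sub>R axis i 1) \<theta>)"
    if "continuous_on (UNIV \<times> {a..b}) (\<lambda>(z, \<theta>). k z \<theta>)" for k :: "real^3 \<Rightarrow> real \<Rightarrow> real" and A
  proof -
    have "continuous_on (A \<times> {a..b}) (\<lambda>p. case (x + fst p *\<^sub>R axis i 1, snd p) of (z, \<theta>) \<Rightarrow> k z \<theta>)"
      by (rule continuous_on_compose2[OF that])
        (auto intro!: continuous_on_Pair continuous_on_add continuous_on_scaleR continuous_on_fst continuous_on_snd)
    then show ?thesis by (simp add: case_prod_unfold)
  qed
  have "((\<lambda>h. integral (cbox a b) (\<phi> (x + h *\<^sub>R axis i 1))) has_field_derivative
    integral (cbox a b) (\<phi>' (x + 0 *\<^sub>R axis i 1))) (at 0 within UNIV)"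
  proof (rule leibniz_rule_field_derivative[where fx = "\<lambda>h. \<phi>' (x + h *\<^sub>R axis i 1)"])
    show "((\<lambda>h. \<phi> (x + h *\<^sub>R axis i 1) \<theta>) has_field_derivative \<phi>' (x + h *\<^sub>R axis i 1) \<theta>) (at h within UNIV)"
      if "\<theta> \<in> cbox a b" for h \<theta>
      using has_partial_line[of i "\<lambda>z. \<phi> z \<theta>" "\<lambda>z. \<phi>' z \<theta>" x h] der that by simp
    show "\<phi> (x + h *\<^sub>R axis i 1) integrable_on cbox a b" for h
    proof (rule integrable_continuous)
      have "continuous_on (cbox a b) (\<lambda>\<theta>. case (h, \<theta>) of (h, \<theta>) \<Rightarrow> \<phi> (x + h *\<^sub>R axis i 1) \<theta>)"
        by (rule continuous_on_compose2[OF *[OF cont(1), of UNIV]]) (auto intro!: continuous_on_Pair)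
      then show "continuous_on (cbox a b) (\<phi> (x + h *\<^sub>R axis i 1))" by simp
    qed
    show "continuous_on (UNIV \<times> cbox a b) (\<lambda>(h, \<theta>). \<phi>' (x + h *\<^sub>R axis i 1) \<theta>)"
      using *[OF cont(2), of UNIV] by simp
  qed auto
  then show ?thesis by (simp add: has_partial_def)
qed

text \<open>The substitution \<xi> = |z| \<theta> removes the division by |z|. The integrand is now
  smooth in \<open>z\<close>, including z = 0, and the derivatives of P are read off under the
  integral.\<close>

lemma oseen_P_eq:
  assumes "t > 0"
  shows "oseen_P z t = 1 / (4 * pi powr (3/2) * sqrt t) * integral {0..1} (\<lambda>\<theta>. exp (- (\<theta>\<^sup>2 * (norm z)\<^sup>2 / (4 * t))))"
proof (cases "z = 0")
  case False
  have "((\<lambda>\<theta>. norm z *\<^sub>R exp (- (norm z * \<theta>)\<^sup>2 / (4 * t))) has_integral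
      (integral {norm z * 0..norm z * 1} (\<lambda>\<xi>. exp (- \<xi>\<^sup>2 / (4 * t))))) {0..1}"
    by (rule has_integral_substitution[where c = 0 and d = "norm z"])
      (use assms in \<open>auto intro!: derivative_eq_intros continuous_intros mult_left_le\<close>)
  from integral_unique[OF this]
  have "integral {0..norm z} (\<lambda>\<xi>. exp (- \<xi>\<^sup>2 / (4 * t))) = integral {0..1} (\<lambda>\<theta>. norm z * exp (- (norm z * \<theta>)\<^sup>2 / (4 * t)))"
    by simp
  also have "\<dots> = norm z * integral {0..1} (\<lambda>\<theta>. exp (- (\<theta>\<^sup>2 * (norm z)\<^sup>2 / (4 * t))))"
    by (simp add: power_mult_distrib mult.commute)
  finally show ?thesis using False by (simp add: oseen_P_def)
qed (simp add: oseen_P_def)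

text \<open>This and the next formula result from differentiating the integral of
  \<open>oseen_P_eq\<close> once and twice.\<close>

definition oseen_P_partial :: "3 \<Rightarrow> real \<Rightarrow> real^3 \<Rightarrow> real" where
  "oseen_P_partial j t z = 1 / (4 * pi powr (3/2) * sqrt t) *
     integral {0..1} (\<lambda>\<theta>. - (\<theta>\<^sup>2 * z $ j / (2 * t)) * exp (- (\<theta>\<^sup>2 * (norm z)\<^sup>2 / (4 * t))))"

definition oseen_P_partial2 :: "3 \<Rightarrow> 3 \<Rightarrow> real \<Rightarrow> real^3 \<Rightarrow> real" where
  "oseen_P_partial2 i j t z = 1 / (4 * pi powr (3/2) * sqrt t) *
     integral {0..1} (\<lambda>\<theta>. (\<theta>\<^sup>2 * \<theta>\<^sup>2 * z $ i * z $ j / (4 * t\<^sup>2) - (if i = j then \<theta>\<^sup>2 / (2 * t) else 0))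
       * exp (- (\<theta>\<^sup>2 * (norm z)\<^sup>2 / (4 * t))))"

lemma has_partial_exp_norm_sq:
  "has_partial j (\<lambda>z. exp (- (a * (norm z)\<^sup>2 / b))) (- (2 * a * z $ j / b) * exp (- (a * (norm z)\<^sup>2 / b))) z"
  unfolding has_partial_def norm_sq_add_axis by (cases "b = 0") (auto intro!: derivative_eq_intros)

lemma continuous_on_integral_param:
  assumes "continuous_on (UNIV \<times> {a..b::real}) (\<lambda>(z, \<theta>). \<phi> z \<theta>)"
  shows "continuous_on UNIV (\<lambda>z. integral {a..b} (\<phi> z :: real \<Rightarrow> real))"
  using integral_continuous_on_param[of UNIV a b \<phi>] assms by simp

lemma
  assumes t: "t > 0"
  shows continuous_on_oseen_P: "continuous_on UNIV (\<lambda>z. oseen_P z t)"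
    and continuous_on_oseen_P_partial: "continuous_on UNIV (oseen_P_partial j t)"
    and continuous_on_oseen_P_partial2: "continuous_on UNIV (oseen_P_partial2 i j t)"
    and has_partial_oseen_P: "has_partial j (\<lambda>z. oseen_P z t) (oseen_P_partial j t z) z"
    and has_partial_oseen_P_partial: "has_partial i (oseen_P_partial j t) (oseen_P_partial2 i j t z) z"
proof -
  let ?c = "1 / (4 * pi powr (3/2) * sqrt t)"
  let ?e = "\<lambda>z \<theta>. exp (- (\<theta>\<^sup>2 * (norm z)\<^sup>2 / (4 * t)))"
  let ?e1 = "\<lambda>j (z::real^3) \<theta>. - (\<theta>\<^sup>2 * z $ j / (2 * t)) * ?e z \<theta>"
  let ?e2 = "\<lambda>(z::real^3) \<theta>. (\<theta>\<^sup>2 * \<theta>\<^sup>2 * z $ i * z $ j / (4 * t\<^sup>2) - (if i = j then \<theta>\<^sup>2 / (2 * t) else 0)) * ?e z \<theta>"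
  have c: "continuous_on (UNIV \<times> {0..1}) (\<lambda>(z::real^3, \<theta>). ?e z \<theta>)"
    "continuous_on (UNIV \<times> {0..1}) (\<lambda>(z, \<theta>). ?e1 j z \<theta>)"
    "continuous_on (UNIV \<times> {0..1}) (\<lambda>(z, \<theta>). ?e2 z \<theta>)"
    unfolding case_prod_unfold using t by (cases "i = j"; auto intro!: continuous_intros)+
  have P: "(\<lambda>z. oseen_P z t) = (\<lambda>z. ?c * integral {0..1} (?e z))"
    using oseen_P_eq[OF t] by auto
  note d = oseen_P_partial_def[abs_def] oseen_P_partial2_def[abs_def] P
  show "continuous_on UNIV (\<lambda>z. oseen_P z t)" "continuous_on UNIV (oseen_P_partial j t)"
    "continuous_on UNIV (oseen_P_partial2 i j t)"
    unfolding d by (intro continuous_on_mult continuous_on_const continuous_on_integral_param c)+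
  show "has_partial j (\<lambda>z. oseen_P z t) (oseen_P_partial j t z) z"
    unfolding d
  proof (intro has_partial_cmult has_partial_integral c)
    show "has_partial j (\<lambda>z. ?e z \<theta>) (?e1 j z \<theta>) z" for \<theta> z
      using has_partial_exp_norm_sq[of j "\<theta>\<^sup>2" "4 * t" z] by (simp add: field_simps)
  qed
  show "has_partial i (oseen_P_partial j t) (oseen_P_partial2 i j t z) z"
    unfolding d
  proof (intro has_partial_cmult has_partial_integral c)
    show "has_partial i (\<lambda>z. ?e1 j z \<theta>) (?e2 z \<theta>) z" for \<theta> z
    proof -
      have "has_partial i (\<lambda>z. (- (\<theta>\<^sup>2 / (2 * t)) * z $ j) * ?e z \<theta>)
        ((- (\<theta>\<^sup>2 / (2 * t)) * (if j = i then 1 else 0)) * ?e z \<theta> + (- (\<theta>\<^sup>2 / (2 * t)) * z $ j) * ?e1 i z \<theta>) z"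
        using has_partial_exp_norm_sq[of i "\<theta>\<^sup>2" "4 * t" z]
        by (intro has_partial_mult has_partial_cmult has_partial_component) (simp add: field_simps)
      moreover have "(\<lambda>z::real^3. (- (\<theta>\<^sup>2 / (2 * t)) * z $ j) * ?e z \<theta>) = (\<lambda>z. ?e1 j z \<theta>)" by auto
      moreover have "(- (\<theta>\<^sup>2 / (2 * t)) * (if j = i then 1 else 0)) * ?e z \<theta> + (- (\<theta>\<^sup>2 / (2 * t)) * z $ j) * ?e1 i z \<theta> = ?e2 z \<theta>"
        by (auto simp: power2_eq_square algebra_simps)
      ultimately show ?thesis by simp
    qed
  qed
qed

lemma oseen_P_nonneg:
  assumes "t > 0"
  shows "oseen_P z t \<ge> 0"
  unfolding oseen_P_eq[OF assms] using assms
  by (intro mult_nonneg_nonneg integral_nonneg integrable_continuous_interval) (auto intro!: continuous_intros)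

lemma oseen_P_le:
  assumes "t > 0"
  shows "oseen_P z t \<le> 1 / (4 * pi powr (3/2) * sqrt t)"
proof -
  have "integral {0..1} (\<lambda>\<theta>. exp (- (\<theta>\<^sup>2 * (norm z)\<^sup>2 / (4 * t)))) \<le> integral {0..1} (\<lambda>\<theta>::real. 1::real)"
    using assms by (intro integral_le integrable_continuous_interval) (auto intro!: continuous_intros)
  then have "integral {0..1} (\<lambda>\<theta>. exp (- (\<theta>\<^sup>2 * (norm z)\<^sup>2 / (4 * t)))) \<le> 1" by simp
  then show ?thesis
    unfolding oseen_P_eq[OF assms] using assms by (intro mult_left_le) auto
qed

section \<open>The Newtonian kernel as a time integral of heat kernels\<close>

definition newton_kernel :: "real^3 \<Rightarrow> real" where
  "newton_kernel z = 1 / (4 * pi * norm z)"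

text \<open>The error function up to the factor 2 / sqrt pi. For z \<noteq> 0 it expresses P(z,t)
  with the time only in the argument |z| / (2 sqrt t), which makes both the time derivative and the
  limit t \<rightarrow> 0 accessible.\<close>

definition gauss_primitive :: "real \<Rightarrow> real" where
  "gauss_primitive a = integral {0..a} (\<lambda>u. exp (- u\<^sup>2))"

lemma gauss_primitive_derivative:
  assumes "a > 0"
  shows "(gauss_primitive has_real_derivative exp (- a\<^sup>2)) (at a)"
proof -
  have "((\<lambda>a. integral {0..a} (\<lambda>u. exp (- u\<^sup>2))) has_real_derivative exp (- a\<^sup>2)) (at a within {0..a + 1})"
    using assms by (intro integral_has_real_derivative) (auto intro!: continuous_intros)
  then have "((\<lambda>a. integral {0..a} (\<lambda>u. exp (- u\<^sup>2))) has_real_derivative exp (- a\<^sup>2)) (at a within {0<..<a + 1})"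
    by (rule DERIV_subset) auto
  moreover have "at a within {0<..<a + 1} = at a" using assms by (intro at_within_open) auto
  ultimately show ?thesis by (simp add: gauss_primitive_def[abs_def])
qed

lemma gauss_primitive_at_top: "(gauss_primitive \<longlongrightarrow> sqrt pi / 2) at_top"
proof -
  have "((\<lambda>y. \<integral>x. indicator {..y} x *\<^sub>R (indicator {0..} x *\<^sub>R exp (- x\<^sup>2)) \<partial>lborel) \<longlongrightarrow> sqrt pi / 2) at_top"
    using tendsto_integral_at_top[OF _ conjunct1[OF gaussian_moment_0[unfolded has_bochner_integral_iff]]]
    unfolding conjunct2[OF gaussian_moment_0[unfolded has_bochner_integral_iff]] by simp
  moreover have "(\<integral>x. indicator {..y} x *\<^sub>R (indicator {0..} x *\<^sub>R exp (- x\<^sup>2)) \<partial>lborel) = gauss_primitive y" for y :: real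
  proof -
    have "set_integrable lborel {0..y} (\<lambda>u. exp (- u\<^sup>2))"
      by (intro borel_integrable_compact[folded set_integrable_def]) (auto intro!: continuous_intros)
    from set_borel_integral_eq_integral(2)[OF this]
    have "gauss_primitive y = (\<integral>x. indicator {0..y} x *\<^sub>R exp (- x\<^sup>2) \<partial>lborel)"
      by (simp add: gauss_primitive_def set_lebesgue_integral_def)
    also have "\<dots> = (\<integral>x. indicator {..y} x *\<^sub>R (indicator {0..} x *\<^sub>R exp (- x\<^sup>2)) \<partial>lborel)"
      by (intro Bochner_Integration.integral_cong) (auto simp: indicator_def)
    finally show ?thesis by simp
  qed
  ultimately show ?thesis by simp
qed

lemma oseen_P_gauss_primitive:
  assumes "t > 0" "z \<noteq> 0"
  shows "oseen_P z t = gauss_primitive (norm z / 2 * t powr (- 1 / 2)) / (2 * pi powr (3/2) * norm z)"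
proof -
  define c where "c = 1 / (2 * sqrt t)"
  have c: "c > 0" using assms by (simp add: c_def)
  have "((\<lambda>\<xi>. c *\<^sub>R exp (- (c * \<xi>)\<^sup>2)) has_integral (integral {c * 0..c * norm z} (\<lambda>u. exp (- u\<^sup>2)))) {0..norm z}"
    by (rule has_integral_substitution[where c = 0 and d = "c * norm z"])
      (use c in \<open>auto intro!: DERIV_cmult_Id continuous_intros\<close>)
  from integral_unique[OF this]
  have "c * integral {0..norm z} (\<lambda>\<xi>. exp (- (c * \<xi>)\<^sup>2)) = gauss_primitive (c * norm z)"
    unfolding gauss_primitive_def by simp
  moreover have "- (c * \<xi>)\<^sup>2 = - \<xi>\<^sup>2 / (4 * t)" for \<xi>
    using assms by (simp add: c_def power_mult_distrib power_divide)
  ultimately have "(1 / (2 * sqrt t)) * integral {0..norm z} (\<lambda>\<xi>. exp (- \<xi>\<^sup>2 / (4 * t))) = gauss_primitive ((1 / (2 * sqrt t)) * norm z)"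
    by (simp only: c_def)
  moreover have "(1 / (2 * sqrt t)) * norm z = norm z / 2 * t powr (- 1 / 2)"
    using assms by (simp add: powr_minus powr_half_sqrt[symmetric] field_simps)
  ultimately have "gauss_primitive (norm z / 2 * t powr (- 1 / 2)) = (1 / (2 * sqrt t)) * integral {0..norm z} (\<lambda>\<xi>. exp (- \<xi>\<^sup>2 / (4 * t)))"
    by metis
  then show ?thesis using assms by (simp add: oseen_P_def)
qed

lemma powr_three_halves_pi: "(4 * pi) powr (- 3 / 2) = 1 / (8 * pi powr (3/2))"
proof -
  have "(4::real) powr (3 / 2) = (2 powr 2) powr (3 / 2)" by simp
  also have "\<dots> = 2 powr 3" by (subst powr_powr) simp
  finally have "(4::real) powr (3 / 2) = 8" by simp
  then show ?thesis by (simp add: powr_mult powr_minus_divide)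
qed

text \<open>The kernel \<open>P\<close> satisfies \<open>\<partial>\<^sub>t P = - \<Phi>\<close> and tends to the Newtonian kernel as \<open>t \<rightarrow> 0\<close>.\<close>
lemma heat_kernel_time_integral:
  assumes "z \<noteq> 0" "r > 0"
  shows "((\<lambda>\<rho>. heat_kernel z \<rho>) has_integral (newton_kernel z - oseen_P z r)) {0..r}"
proof -
  let ?c = "1 / (2 * pi powr (3/2) * norm z)"
  let ?a = "\<lambda>\<rho>. norm z / 2 * \<rho> powr (- 1 / 2)"
  \<comment> \<open>The negative of P as a function of time, extended to \<rho> = 0 by its limit, so
    that it is a primitive of the heat kernel that is continuous on [0,r].\<close>
  define Q where "Q \<rho> = (if \<rho> = 0 then - newton_kernel z else - oseen_P z \<rho>)" for \<rho>
  have Q: "Q \<rho> = - (?c * gauss_primitive (?a \<rho>))" if "\<rho> > 0" for \<rho>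
    using that assms by (simp add: Q_def oseen_P_gauss_primitive)
  have der: "(Q has_real_derivative heat_kernel z \<rho>) (at \<rho>)" if \<rho>: "\<rho> > 0" for \<rho>
  proof -
    have a0: "?a \<rho> > 0" using \<rho> assms by simp
    have "(?a has_real_derivative norm z / 2 * ((- 1 / 2) * \<rho> powr (- 1 / 2 - 1))) (at \<rho>)"
      using \<rho> by (intro DERIV_cmult has_real_derivative_powr)
    from DERIV_chain'[OF this gauss_primitive_derivative[OF a0]]
    have "((\<lambda>\<rho>. gauss_primitive (?a \<rho>)) has_real_derivative
        exp (- (?a \<rho>)\<^sup>2) * (norm z / 2 * ((- 1 / 2) * \<rho> powr (- 1 / 2 - 1)))) (at \<rho>)" by simp
    from DERIV_minus[OF DERIV_cmult[OF this, of ?c]]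
    have D: "((\<lambda>\<rho>. - (?c * gauss_primitive (?a \<rho>))) has_real_derivative
        - (?c * (exp (- (?a \<rho>)\<^sup>2) * (norm z / 2 * ((- 1 / 2) * \<rho> powr (- 1 / 2 - 1)))))) (at \<rho>)" .
    have "(?a \<rho>)\<^sup>2 = (norm z)\<^sup>2 / (4 * \<rho>)"
    proof -
      have "(\<rho> powr (- 1 / 2))\<^sup>2 = \<rho> powr (- 1)" using \<rho> by (simp add: powr_power)
      also have "\<dots> = 1 / \<rho>" using \<rho> by (simp add: powr_minus_divide)
      finally show ?thesis by (simp add: power_mult_distrib power_divide)
    qed
    moreover have "heat_kernel z \<rho> = 1 / (8 * pi powr (3/2)) * \<rho> powr (- 3 / 2) * exp (- ((norm z)\<^sup>2 / (4 * \<rho>)))"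
    proof -
      have "(4 * pi * \<rho>) powr (- 3 / 2) = (4 * pi) powr (- 3 / 2) * \<rho> powr (- 3 / 2)"
        using \<rho> by (simp add: powr_mult)
      then show ?thesis by (simp only: heat_kernel_def powr_three_halves_pi minus_divide_left)
    qed
    ultimately have "- (?c * (exp (- (?a \<rho>)\<^sup>2) * (norm z / 2 * ((- 1 / 2) * \<rho> powr (- 1 / 2 - 1))))) = heat_kernel z \<rho>"
      using assms by simp
    with D have D': "((\<lambda>\<rho>. - (?c * gauss_primitive (?a \<rho>))) has_real_derivative heat_kernel z \<rho>) (at \<rho>)" by simp
    show ?thesis
    proof (rule has_field_derivative_transform_within[OF D', of \<rho>])
      show "- (?c * gauss_primitive (?a y)) = Q y" if "dist y \<rho> < \<rho>" for y
        using that by (subst Q) (auto simp: dist_real_def)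
    qed (use \<rho> in auto)
  qed
  have lim: "(Q \<longlongrightarrow> Q 0) (at_right 0)"
  proof -
    have "filterlim ?a at_top (at_right 0)"
      using assms by (intro filterlim_tendsto_pos_mult_at_top[OF tendsto_const]) (simp, real_asymp)
    then have "((\<lambda>\<rho>. gauss_primitive (?a \<rho>)) \<longlongrightarrow> sqrt pi / 2) (at_right 0)"
      by (rule filterlim_compose[OF gauss_primitive_at_top])
    then have "((\<lambda>\<rho>. - (?c * gauss_primitive (?a \<rho>))) \<longlongrightarrow> - (?c * (sqrt pi / 2))) (at_right 0)"
      by (intro tendsto_intros)
    moreover have "- (?c * (sqrt pi / 2)) = Q 0"
    proof -
      have "pi powr (1 + 1 / 2) = pi powr 1 * pi powr (1 / 2)" by (rule powr_add)
      then have "pi powr (3 / 2) = pi * sqrt pi" by (simp add: powr_half_sqrt)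
      then show ?thesis by (simp add: Q_def newton_kernel_def)
    qed
    ultimately have "((\<lambda>\<rho>. - (?c * gauss_primitive (?a \<rho>))) \<longlongrightarrow> Q 0) (at_right 0)" by simp
    moreover have "\<forall>\<^sub>F \<rho> in at_right 0. - (?c * gauss_primitive (?a \<rho>)) = Q \<rho>"
      using Q eventually_at_right_less[of "0::real"] by (auto elim!: eventually_mono)
    ultimately show ?thesis by (rule Lim_transform_eventually)
  qed
  have "(heat_kernel z has_integral (Q r - Q 0)) {0..r}"
  proof (rule fundamental_theorem_of_calculus_interior)
    show "continuous_on {0..r} Q"
      unfolding continuous_on_eq_continuous_within
    proof
      fix \<rho> assume \<rho>: "\<rho> \<in> {0..r}"
      show "continuous (at \<rho> within {0..r}) Q"
      proof (cases "\<rho> = 0")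
        case True
        then show ?thesis using lim assms(2) by (simp add: continuous_within at_within_Icc_at_right)
      next
        case False
        then have "isCont Q \<rho>" using \<rho> by (intro DERIV_isCont[OF der]) auto
        then show ?thesis by (rule continuous_at_imp_continuous_at_within)
      qed
    qed
    show "(Q has_vector_derivative heat_kernel z \<rho>) (at \<rho>)" if "\<rho> \<in> {0<..<r}" for \<rho>
      using der[of \<rho>] that by (simp add: has_real_derivative_iff_has_vector_derivative)
  qed (use assms in auto)
  moreover have "Q r - Q 0 = newton_kernel z - oseen_P z r" using assms by (simp add: Q_def)
  ultimately show ?thesis by simp
qed

lemma newton_kernel_measurable [measurable]: "newton_kernel \<in> borel_measurable borel"
  unfolding newton_kernel_def[abs_def] by measurable

lemma oseen_P_le_newton_kernel:
  assumes "z \<noteq> 0" "r > 0"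
  shows "oseen_P z r \<le> newton_kernel z"
  using has_integral_nonneg[OF heat_kernel_time_integral[OF assms]] by (simp add: heat_kernel_nonneg)

lemma heat_kernel_time_lebesgue:
  assumes "z \<noteq> 0" "r > 0"
  shows "(\<integral>\<rho>. indicator {0..r} \<rho> * heat_kernel z \<rho> \<partial>lborel) = newton_kernel z - oseen_P z r"
proof -
  have "((\<lambda>\<rho>. indicator {0..r} \<rho> * heat_kernel z \<rho>) has_integral (newton_kernel z - oseen_P z r)) UNIV"
  proof -
    have "(\<lambda>\<rho>. indicator {0..r} \<rho> * heat_kernel z \<rho>) = (\<lambda>\<rho>. if \<rho> \<in> {0..r} then heat_kernel z \<rho> else 0)"
      by (auto simp: indicator_def)
    then show ?thesis
      using heat_kernel_time_integral[OF assms] by (simp only: has_integral_restrict_UNIV)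
  qed
  then have "(\<integral>\<^sup>+\<rho>. ennreal (indicator {0..r} \<rho> * heat_kernel z \<rho>) \<partial>lborel) = ennreal (newton_kernel z - oseen_P z r)"
    by (intro nn_integral_has_integral_lborel) (auto simp: heat_kernel_nonneg heat_kernel_def)
  then show ?thesis
    using oseen_P_le_newton_kernel[OF assms]
    by (subst integral_eq_nn_integral) (auto simp: heat_kernel_nonneg heat_kernel_def[abs_def])
qed

text \<open>For each \<rho> > 0 the kernel has mass one in space, so its mass over a bounded time
  interval is finite; a bounded factor preserves this. It justifies exchanging the time and space
  integrals.\<close>

lemma integrable_heat_kernel_time_space:
  assumes [measurable]: "f \<in> borel_measurable borel" and b: "\<And>z. \<bar>f z\<bar> \<le> B"
  shows "integrable (lborel \<Otimes>\<^sub>M lborel) (\<lambda>(\<rho>, z). indicator {0..r} \<rho> * (heat_kernel z \<rho> * f (x - z)))"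
proof -
  have m [measurable]: "(\<lambda>p. heat_kernel (snd p) (fst p)) \<in> borel_measurable (lborel \<Otimes>\<^sub>M lborel)"
    unfolding heat_kernel_def by measurable
  have k: "integrable (lborel \<Otimes>\<^sub>M lborel) (\<lambda>(\<rho>, z). indicator {0..r} \<rho> * heat_kernel z \<rho>)"
  proof (rule lborel_pair.Fubini_integrable)
    show "(\<lambda>(\<rho>, z). indicator {0..r} \<rho> * heat_kernel z \<rho>) \<in> borel_measurable (lborel \<Otimes>\<^sub>M lborel)"
      unfolding case_prod_unfold by measurable
    \<comment> \<open>The half-open interval appears because \<open>heat_kernel z 0\<close> is 0 by
      the convention for \<open>powr\<close>.\<close>
    have i: "(\<integral>z. norm (case (\<rho>, z) of (\<rho>, z) \<Rightarrow> indicator {0..r} \<rho> * heat_kernel z \<rho>) \<partial>lborel) = indicator {0<..r} \<rho>" for \<rho>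
    proof (cases "\<rho> > 0")
      case True
      then show ?thesis by (simp add: abs_mult heat_kernel_nonneg integral_heat_kernel indicator_def)
    next
      case False
      then show ?thesis by (cases "\<rho> = 0") (auto simp: indicator_def heat_kernel_def)
    qed
    have "emeasure lborel {0<..r} < \<infinity>" by (cases "0 \<le> r") auto
    then show "integrable lborel (\<lambda>\<rho>. \<integral>z. norm (case (\<rho>, z) of (\<rho>, z) \<Rightarrow> indicator {0..r} \<rho> * heat_kernel z \<rho>) \<partial>lborel)"
      unfolding i by (intro integrable_real_indicator) auto
    show "AE \<rho> in lborel. integrable lborel (\<lambda>z. case (\<rho>, z) of (\<rho>, z) \<Rightarrow> indicator {0..r} \<rho> * heat_kernel z \<rho>)"
    proof (rule AE_I2)
      fix \<rho> :: real
      consider "\<rho> > 0" | "\<rho> = 0" | "\<rho> < 0" by linarith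
      then show "integrable lborel (\<lambda>z. case (\<rho>, z) of (\<rho>, z) \<Rightarrow> indicator {0..r} \<rho> * heat_kernel z \<rho>)"
        by cases (auto simp: integrable_heat_kernel heat_kernel_def[of _ 0])
    qed
  qed
  show ?thesis
  proof (rule Bochner_Integration.integrable_bound[OF integrable_mult_right[OF k, of B]])
    show "(\<lambda>(\<rho>, z). indicator {0..r} \<rho> * (heat_kernel z \<rho> * f (x - z))) \<in> borel_measurable (lborel \<Otimes>\<^sub>M lborel)"
      unfolding case_prod_unfold by measurable
    show "AE p in lborel \<Otimes>\<^sub>M lborel. norm (case p of (\<rho>, z) \<Rightarrow> indicator {0..r} \<rho> * (heat_kernel z \<rho> * f (x - z)))
        \<le> norm (B * (case p of (\<rho>, z) \<Rightarrow> indicator {0..r} \<rho> * heat_kernel z \<rho>))"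
    proof (intro AE_I2, clarify)
      fix \<rho> :: real and z :: "real^3"
      have "\<bar>f (x - z)\<bar> * (indicator {0..r} \<rho> * heat_kernel z \<rho>) \<le> \<bar>B\<bar> * (indicator {0..r} \<rho> * heat_kernel z \<rho>)"
        using b[of "x - z"] by (intro mult_right_mono) (auto simp: heat_kernel_nonneg)
      then show "norm (indicator {0..r} \<rho> * (heat_kernel z \<rho> * f (x - z))) \<le> norm (B * (indicator {0..r} \<rho> * heat_kernel z \<rho>))"
        by (simp add: abs_mult heat_kernel_nonneg mult_ac)
    qed
  qed
qed

lemma AE_nonzero: "AE z in lborel. z \<noteq> (0::'a::euclidean_space)"
  by (rule AE_lborel_singleton)

text \<open>Off the origin the difference is the integral of the heat kernel over [0,r], so Fubini
  gives integrability on the whole space.\<close>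

lemma integrable_newton_minus_oseen_P:
  assumes "r > 0"
  shows "integrable lborel (\<lambda>z. newton_kernel z - oseen_P z r)"
proof -
  have [measurable]: "(\<lambda>z. oseen_P z r) \<in> borel_measurable borel"
    using continuous_on_oseen_P[OF assms] by (rule borel_measurable_continuous_onI)
  have "integrable lborel (\<lambda>z. \<integral>\<rho>. indicator {0..r} \<rho> * (heat_kernel z \<rho> * 1) \<partial>lborel)"
    using integrable_heat_kernel_time_space[of "\<lambda>_. 1" 1 r 0] by (intro lborel_pair.integrable_snd) auto
  then show ?thesis
    by (rule integrable_cong_AE_imp) (use AE_nonzero heat_kernel_time_lebesgue assms in \<open>auto\<close>)
qed

text \<open>The singularity is treated without polar coordinates: the kernel is the integrable
  function N - P(.,1) plus the continuous function P(.,1).\<close>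

lemma locally_integrable_newton_kernel: "locally_integrable newton_kernel"
  unfolding locally_integrable_def
proof (intro conjI allI)
  fix \<rho> :: real
  have "integrable lborel (\<lambda>z. \<bar>newton_kernel z - oseen_P z 1\<bar> + indicator (cball 0 \<rho>) z * \<bar>oseen_P z 1\<bar>)"
    using integrable_newton_minus_oseen_P[of 1] locally_integrable_continuous[OF continuous_on_oseen_P[of 1]]
    by (intro Bochner_Integration.integrable_add integrable_abs) (auto simp: locally_integrable_def)
  then show "integrable lborel (\<lambda>z. indicator (cball 0 \<rho>) z * \<bar>newton_kernel z\<bar>)"
    by (rule Bochner_Integration.integrable_bound) (auto intro!: AE_I2 simp: indicator_def)
qed measurable

lemma newton_potential_split:
  assumes f: "continuous_source T R f" and t: "t \<in> {0..<T}" and r: "r > 0"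
  shows "conv newton_kernel (f t) x = conv (\<lambda>z. oseen_P z r) (f t) x + integral {0..r} (\<lambda>\<rho>. gauss_avg \<rho> (f t) x)"
proof -
  obtain B where B: "f t \<in> borel_measurable borel" "\<And>x. \<bar>f t x\<bar> \<le> B" "\<And>x. R < norm x \<Longrightarrow> f t x = 0"
    by (rule continuous_source_slice[OF f t], rule that)
  note [measurable] = B(1)
  note I = integrable_heat_kernel_time_space[OF B(1,2), of r x]
  have "conv newton_kernel (f t) x - conv (\<lambda>z. oseen_P z r) (f t) x = (\<integral>z. (newton_kernel z - oseen_P z r) * f t (x - z) \<partial>lborel)"
    unfolding conv_def left_diff_distrib
    using conv_integrable[OF locally_integrable_newton_kernel B] conv_integrable[OF locally_integrable_continuous[OF continuous_on_oseen_P[OF r]] B]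
    by (intro Bochner_Integration.integral_diff[symmetric])
  also have "\<dots> = (\<integral>z. (\<integral>\<rho>. indicator {0..r} \<rho> * (heat_kernel z \<rho> * f t (x - z)) \<partial>lborel) \<partial>lborel)"
  proof (rule integral_cong_AE)
    have [measurable]: "(\<lambda>z. oseen_P z r) \<in> borel_measurable borel"
      using continuous_on_oseen_P[OF r] by (rule borel_measurable_continuous_onI)
    show "(\<lambda>z. (newton_kernel z - oseen_P z r) * f t (x - z)) \<in> borel_measurable lborel" by measurable
    show "(\<lambda>z. \<integral>\<rho>. indicator {0..r} \<rho> * (heat_kernel z \<rho> * f t (x - z)) \<partial>lborel) \<in> borel_measurable lborel"
      using lborel_pair.integrable_snd[OF I] by (intro borel_measurable_integrable) simp
    have "(\<integral>\<rho>. indicator {0..r} \<rho> * (heat_kernel z \<rho> * f t (x - z)) \<partial>lborel) = (newton_kernel z - oseen_P z r) * f t (x - z)"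
      if "z \<noteq> 0" for z
      unfolding mult.assoc[symmetric] by (simp add: heat_kernel_time_lebesgue[OF that r])
    then show "AE z in lborel. (newton_kernel z - oseen_P z r) * f t (x - z) = (\<integral>\<rho>. indicator {0..r} \<rho> * (heat_kernel z \<rho> * f t (x - z)) \<partial>lborel)"
      using AE_nonzero by auto
  qed
  also have "\<dots> = (\<integral>\<rho>. (\<integral>z. indicator {0..r} \<rho> * (heat_kernel z \<rho> * f t (x - z)) \<partial>lborel) \<partial>lborel)"
    using I by (rule lborel_pair.Fubini_integral)
  also have "\<dots> = (\<integral>\<rho>. indicator {0..r} \<rho> *\<^sub>R gauss_avg \<rho> (f t) x \<partial>lborel)"
  proof (rule integral_cong_AE)
    have c: "continuous_on {0..r} (\<lambda>\<rho>. gauss_avg \<rho> (f t) x)"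
    proof -
      have "continuous_on {0..r} (\<lambda>\<rho>. case (\<rho>, t, x) of (r, t, x) \<Rightarrow> gauss_avg r (f t) x)"
        by (rule continuous_on_compose2[OF continuous_source_gauss_avg[OF f]])
          (use t in \<open>auto intro!: continuous_on_Pair\<close>)
      then show ?thesis by simp
    qed
    then show "(\<lambda>\<rho>. indicator {0..r} \<rho> *\<^sub>R gauss_avg \<rho> (f t) x) \<in> borel_measurable lborel"
      using borel_integrable_compact[of "{0..r}" "\<lambda>\<rho>. gauss_avg \<rho> (f t) x"] by (intro borel_measurable_integrable) simp
    show "(\<lambda>\<rho>. \<integral>z. indicator {0..r} \<rho> * (heat_kernel z \<rho> * f t (x - z)) \<partial>lborel) \<in> borel_measurable lborel"
      using lborel_pair.integrable_fst[OF I] by (intro borel_measurable_integrable) simp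
    \<comment> \<open>At \<rho> = 0 the two sides need not agree: the kernel is 0 there by
      convention, while \<open>gauss_avg 0\<close> is the identity. One point of time is a null
      set.\<close>
    have "(\<integral>z. indicator {0..r} \<rho> * (heat_kernel z \<rho> * f t (x - z)) \<partial>lborel) = indicator {0..r} \<rho> *\<^sub>R gauss_avg \<rho> (f t) x"
      if "\<rho> \<noteq> 0" for \<rho>
      using that by (cases "\<rho> > 0") (auto simp: gauss_avg_eq_conv conv_def)
    then show "AE \<rho> in lborel. (\<integral>z. indicator {0..r} \<rho> * (heat_kernel z \<rho> * f t (x - z)) \<partial>lborel) = indicator {0..r} \<rho> *\<^sub>R gauss_avg \<rho> (f t) x"
      using AE_nonzero by auto
  qed
  also have "\<dots> = integral {0..r} (\<lambda>\<rho>. gauss_avg \<rho> (f t) x)"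
  proof -
    have "continuous_on {0..r} (\<lambda>\<rho>. case (\<rho>, t, x) of (r, t, x) \<Rightarrow> gauss_avg r (f t) x)"
      by (rule continuous_on_compose2[OF continuous_source_gauss_avg[OF f]])
        (use t in \<open>auto intro!: continuous_on_Pair\<close>)
    then have "set_integrable lborel {0..r} (\<lambda>\<rho>. gauss_avg \<rho> (f t) x)"
      by (intro borel_integrable_compact[folded set_integrable_def]) auto
    from set_borel_integral_eq_integral(2)[OF this] show ?thesis by (simp add: set_lebesgue_integral_def)
  qed
  finally show ?thesis by simp
qed

lemma continuous_source_integrable:
  assumes "continuous_source T R f" "t \<in> {0..<T}"
  shows "integrable lborel (f t)"
proof -
  obtain B where B: "f t \<in> borel_measurable borel" "\<And>x. \<bar>f t x\<bar> \<le> B" "\<And>x. R < norm x \<Longrightarrow> f t x = 0"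
    by (rule continuous_source_slice[OF assms], rule that)
  have "integrable lborel (\<lambda>z. 1 * f t (0 - z))"
    using B by (intro conv_integrable[OF locally_integrable_continuous]) auto
  then show ?thesis using lborel_integrable_reflect[OF B(1), of 0] by simp
qed

text \<open>The remainders vanish as r tends to infinity because the sup norms of P(.,r) and
  \<Phi>(.,r) are of order r^(-1/2) and r^(-3/2), while the sources are integrable.\<close>

lemma poisson_equation:
  assumes f: "smooth_source T R f" and t: "t \<in> {0..<T}"
  shows "conv newton_kernel (source_laplacian f t) x = - f t x"
proof -
  note c = smooth_source_imp_continuous_source
  note L = smooth_source_laplacian[OF f]
  \<comment> \<open>Bounds a convolution by the sup norm of the kernel times the L^1 norm of the
    source, for use with both P(.,r) and \<Phi>(.,r).\<close>
  have conv_le: "\<bar>conv k (g t) x\<bar> \<le> D * (\<integral>z. \<bar>g t z\<bar> \<partial>lborel)"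
    if g: "continuous_source T R g" and k: "continuous_on UNIV k" "\<And>z. \<bar>k z\<bar> \<le> D" for k g D
  proof -
    obtain B where B: "g t \<in> borel_measurable borel" "\<And>x. \<bar>g t x\<bar> \<le> B" "\<And>x. R < norm x \<Longrightarrow> g t x = 0"
      by (rule continuous_source_slice[OF g t], rule that)
    have int: "integrable lborel (\<lambda>z. g t (x - z))"
      using continuous_source_integrable[OF g t] lborel_integrable_reflect[OF B(1)] by simp
    have "\<bar>conv k (g t) x\<bar> \<le> (\<integral>z. \<bar>k z * g t (x - z)\<bar> \<partial>lborel)"
      unfolding conv_def by (rule integral_abs_bound)
    also have "\<dots> \<le> (\<integral>z. D * \<bar>g t (x - z)\<bar> \<partial>lborel)"
    proof (rule integral_mono)
      show "integrable lborel (\<lambda>z. \<bar>k z * g t (x - z)\<bar>)"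
        using conv_integrable[OF locally_integrable_continuous[OF k(1)] B] by (rule integrable_abs)
    qed (use int k(2) in \<open>auto simp: abs_mult intro!: mult_right_mono\<close>)
    also have "\<dots> = D * (\<integral>z. \<bar>g t z\<bar> \<partial>lborel)"
      using lborel_integral_reflect[of "\<lambda>z. \<bar>g t z\<bar>" x] B(1) by simp
    finally show ?thesis .
  qed
  have eq: "conv newton_kernel (source_laplacian f t) x = conv (\<lambda>z. oseen_P z r) (source_laplacian f t) x + (gauss_avg r (f t) x - f t x)"
    if "r > 0" for r
    using newton_potential_split[OF c[OF L] t that, of x] integral_unique[OF gauss_avg_heat_equation[OF f t, of r x]] that by simp
  have "((\<lambda>r. conv (\<lambda>z. oseen_P z r) (source_laplacian f t) x) \<longlongrightarrow> 0) at_top"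
  proof (rule tendsto_rabs_zero_cancel, rule tendsto_sandwich[OF _ _ tendsto_const])
    show "\<forall>\<^sub>F r in at_top. \<bar>conv (\<lambda>z. oseen_P z r) (source_laplacian f t) x\<bar> \<le>
        1 / (4 * pi powr (3/2) * sqrt r) * (\<integral>z. \<bar>source_laplacian f t z\<bar> \<partial>lborel)"
      using eventually_gt_at_top[of 0]
    proof eventually_elim
      case (elim r)
      show ?case
        using oseen_P_nonneg[OF elim] oseen_P_le[OF elim]
        by (intro conv_le[OF c[OF L]] continuous_on_oseen_P elim) auto
    qed
    have "((\<lambda>r. (\<integral>z. \<bar>source_laplacian f t z\<bar> \<partial>lborel) / (4 * pi powr (3/2)) * (1 / sqrt r)) \<longlongrightarrow>
        (\<integral>z. \<bar>source_laplacian f t z\<bar> \<partial>lborel) / (4 * pi powr (3/2)) * 0) at_top"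
      by (intro tendsto_mult tendsto_const) real_asymp
    then show "((\<lambda>r. 1 / (4 * pi powr (3/2) * sqrt r) * (\<integral>z. \<bar>source_laplacian f t z\<bar> \<partial>lborel)) \<longlongrightarrow> 0) at_top"
      by (simp add: mult.commute)
  qed auto
  moreover have "((\<lambda>r. gauss_avg r (f t) x) \<longlongrightarrow> 0) at_top"
  proof (rule tendsto_rabs_zero_cancel, rule tendsto_sandwich[OF _ _ tendsto_const])
    show "\<forall>\<^sub>F r in at_top. \<bar>gauss_avg r (f t) x\<bar> \<le> (4 * pi * r) powr (- 3 / 2) * (\<integral>z. \<bar>f t z\<bar> \<partial>lborel)"
      using eventually_gt_at_top[of 0]
    proof eventually_elim
      case (elim r)
      have "f t \<in> borel_measurable borel"
        using smooth_source_imp_continuous_family[OF f] t by (rule borel_measurable_continuous_family)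
      moreover have "continuous_on UNIV (\<lambda>z. heat_kernel z r)"
        using heat_type_slice(1)[OF heat_type_heat_kernel elim] .
      moreover have "\<bar>heat_kernel z r\<bar> \<le> (4 * pi * r) powr (- 3 / 2)" for z
        using elim by (simp add: heat_kernel_def mult_left_le)
      ultimately show ?case
        using elim by (subst gauss_avg_eq_conv) (auto intro!: conv_le[OF c[OF f]])
    qed
    have "((\<lambda>r. (4 * pi * r) powr (- 3 / 2)) \<longlongrightarrow> 0) at_top" by real_asymp
    then show "((\<lambda>r. (4 * pi * r) powr (- 3 / 2) * (\<integral>z. \<bar>f t z\<bar> \<partial>lborel)) \<longlongrightarrow> 0) at_top"
      by (rule tendsto_mult_left_zero)
  qed auto
  ultimately have "((\<lambda>r. conv (\<lambda>z. oseen_P z r) (source_laplacian f t) x + (gauss_avg r (f t) x - f t x)) \<longlongrightarrow> 0 + (0 - f t x)) at_top"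
    by (intro tendsto_intros)
  moreover have "((\<lambda>r. conv (\<lambda>z. oseen_P z r) (source_laplacian f t) x + (gauss_avg r (f t) x - f t x)) \<longlongrightarrow>
      conv newton_kernel (source_laplacian f t) x) at_top"
  proof (rule tendsto_eventually)
    show "\<forall>\<^sub>F r in at_top. conv (\<lambda>z. oseen_P z r) (source_laplacian f t) x + (gauss_avg r (f t) x - f t x)
        = conv newton_kernel (source_laplacian f t) x"
      using eventually_gt_at_top[of 0] by eventually_elim (simp add: eq)
  qed
  ultimately show ?thesis
    using tendsto_unique[OF trivial_limit_at_top_linorder] by fastforce
qed

section \<open>Time integrals and Duhamel's formula\<close>

text \<open>Moves the variable endpoint into the integrand, so that continuity in \<open>t\<close>
  becomes continuity of a parameter integral over the fixed interval [0,1].\<close>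

lemma integral_scale_interval:
  fixes g :: "real \<Rightarrow> real"
  assumes "t \<ge> 0" "continuous_on {0..t} g"
  shows "integral {0..t} g = t * integral {0..1} (\<lambda>\<theta>. g (t * \<theta>))"
proof -
  have "((\<lambda>\<theta>. t *\<^sub>R g (t * \<theta>)) has_integral (integral {t * 0..t * 1} g)) {0..1}"
    by (rule has_integral_substitution[where c = 0 and d = t])
      (use assms in \<open>auto intro!: DERIV_cmult_Id mult_left_le\<close>)
  from integral_unique[OF this] show ?thesis by simp
qed

lemma lborel_integral_interval:
  fixes g :: "real \<Rightarrow> real"
  assumes "continuous_on {a..b} g"
  shows "(\<integral>s. indicator {a..b} s * g s \<partial>lborel) = integral {a..b} g"
proof -
  have "set_integrable lborel {a..b} g"
    using assms by (intro borel_integrable_compact[folded set_integrable_def]) auto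
  from set_borel_integral_eq_integral(2)[OF this] show ?thesis by (simp add: set_lebesgue_integral_def)
qed

text \<open>The triangle is compact, so the integrand extended by zero is integrable on the plane
  and Fubini applies. Continuity is asked on the triangle only, because the later integrand contains
  a Gaussian average at time \<sigma> - s.\<close>

lemma integral_triangle_swap:
  fixes k :: "real \<Rightarrow> real \<Rightarrow> real"
  assumes cont: "continuous_on {(\<sigma>, s). 0 \<le> s \<and> s \<le> \<sigma> \<and> \<sigma> \<le> t} (\<lambda>(\<sigma>, s). k \<sigma> s)"
  shows "integral {0..t} (\<lambda>\<sigma>. integral {0..\<sigma>} (k \<sigma>)) = integral {0..t} (\<lambda>s. integral {s..t} (\<lambda>\<sigma>. k \<sigma> s))"
proof -
  let ?S = "{(\<sigma>, s). 0 \<le> s \<and> s \<le> \<sigma> \<and> \<sigma> \<le> t}"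
  have "?S = ({0..t} \<times> {0..t}) \<inter> {p. snd p \<le> fst p}" by auto
  moreover have "closed {p :: real \<times> real. snd p \<le> fst p}" by (intro closed_Collect_le continuous_intros)
  ultimately have "compact ?S" by (auto intro: compact_Int_closed compact_Times)
  then have "integrable lborel (\<lambda>p. indicator ?S p *\<^sub>R (case p of (\<sigma>, s) \<Rightarrow> k \<sigma> s))"
    using cont by (rule borel_integrable_compact)
  then have I: "integrable (lborel \<Otimes>\<^sub>M lborel) (\<lambda>(\<sigma>, s). indicator ?S (\<sigma>, s) * k \<sigma> s)"
    by (simp add: lborel_prod case_prod_unfold)
  have c1: "continuous_on {0..\<sigma>} (k \<sigma>)" if "\<sigma> \<in> {0..t}" for \<sigma>
  proof -
    have "continuous_on {0..\<sigma>} (\<lambda>s. case (\<sigma>, s) of (\<sigma>, s) \<Rightarrow> k \<sigma> s)"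
      by (rule continuous_on_compose2[OF cont]) (use that in \<open>auto intro!: continuous_on_Pair\<close>)
    then show ?thesis by simp
  qed
  have c2: "continuous_on {s..t} (\<lambda>\<sigma>. k \<sigma> s)" if "s \<in> {0..t}" for s
  proof -
    have "continuous_on {s..t} (\<lambda>\<sigma>. case (\<sigma>, s) of (\<sigma>, s) \<Rightarrow> k \<sigma> s)"
      by (rule continuous_on_compose2[OF cont]) (use that in \<open>auto intro!: continuous_on_Pair\<close>)
    then show ?thesis by simp
  qed
  have 1: "(\<integral>s. indicator ?S (\<sigma>, s) * k \<sigma> s \<partial>lborel) = indicator {0..t} \<sigma> *\<^sub>R integral {0..\<sigma>} (k \<sigma>)" for \<sigma>
  proof (cases "\<sigma> \<in> {0..t}")
    case True
    then have "(\<integral>s. indicator ?S (\<sigma>, s) * k \<sigma> s \<partial>lborel) = (\<integral>s. indicator {0..\<sigma>} s * k \<sigma> s \<partial>lborel)"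
      by (intro Bochner_Integration.integral_cong) (auto simp: indicator_def)
    then show ?thesis using True lborel_integral_interval[OF c1[OF True]] by simp
  next
    case False
    then have *: "(\<lambda>s. indicator ?S (\<sigma>, s) * k \<sigma> s) = (\<lambda>s. 0)" by (auto simp: indicator_def)
    show ?thesis unfolding * using False by simp
  qed
  have 2: "(\<integral>\<sigma>. indicator ?S (\<sigma>, s) * k \<sigma> s \<partial>lborel) = indicator {0..t} s *\<^sub>R integral {s..t} (\<lambda>\<sigma>. k \<sigma> s)" for s
  proof (cases "s \<in> {0..t}")
    case True
    then have "(\<integral>\<sigma>. indicator ?S (\<sigma>, s) * k \<sigma> s \<partial>lborel) = (\<integral>\<sigma>. indicator {s..t} \<sigma> * k \<sigma> s \<partial>lborel)"
      by (intro Bochner_Integration.integral_cong) (auto simp: indicator_def)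
    then show ?thesis using True lborel_integral_interval[OF c2[OF True]] by simp
  next
    case False
    then have *: "(\<lambda>\<sigma>. indicator ?S (\<sigma>, s) * k \<sigma> s) = (\<lambda>\<sigma>. 0)" by (auto simp: indicator_def)
    show ?thesis unfolding * using False by simp
  qed
  have "set_integrable lborel {0..t} (\<lambda>\<sigma>. integral {0..\<sigma>} (k \<sigma>))"
    using lborel_pair.integrable_fst[OF I] unfolding 1 set_integrable_def .
  note A = set_borel_integral_eq_integral(2)[OF this, unfolded set_lebesgue_integral_def]
  have "set_integrable lborel {0..t} (\<lambda>s. integral {s..t} (\<lambda>\<sigma>. k \<sigma> s))"
    using lborel_pair.integrable_snd[OF I] unfolding 2 set_integrable_def .
  note B = set_borel_integral_eq_integral(2)[OF this, unfolded set_lebesgue_integral_def]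
  have "(\<integral>s. (\<integral>\<sigma>. indicator ?S (\<sigma>, s) * k \<sigma> s \<partial>lborel) \<partial>lborel) = (\<integral>\<sigma>. (\<integral>s. indicator ?S (\<sigma>, s) * k \<sigma> s \<partial>lborel) \<partial>lborel)"
    using I by (rule lborel_pair.Fubini_integral)
  then show ?thesis
    unfolding 1 2 A[symmetric] B[symmetric] by (rule sym)
qed

definition time_int :: "(real \<Rightarrow> real^3 \<Rightarrow> real) \<Rightarrow> real \<Rightarrow> real^3 \<Rightarrow> real" where
  "time_int f t x = integral {0..t} (\<lambda>s. f s x)"

definition duhamel :: "(real \<Rightarrow> real^3 \<Rightarrow> real) \<Rightarrow> real \<Rightarrow> real^3 \<Rightarrow> real" where
  "duhamel f t x = integral {0..t} (\<lambda>s. gauss_avg (t - s) (f s) x)"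

lemma continuous_family_time:
  assumes "continuous_family T f" "t < T"
  shows "continuous_on {0..t} (\<lambda>s. f s x)"
  by (rule continuous_family_compose[OF assms(1)]) (use assms(2) in \<open>auto intro!: continuous_intros\<close>)

lemma continuous_family_integral:
  fixes \<phi> :: "real \<times> (real^3) \<Rightarrow> real \<Rightarrow> real"
  assumes c: "continuous_on (({0..<T} \<times> UNIV) \<times> {0..1}) (\<lambda>(p, \<theta>). \<phi> p \<theta>)"
    and eq: "\<And>t x. t \<in> {0..<T} \<Longrightarrow> h t x = t * integral {0..1} (\<phi> (t, x))"
  shows "continuous_family T h"
proof -
  have "continuous_on ({0..<T} \<times> UNIV) (\<lambda>p. integral (cbox 0 1) (\<phi> p))"
    by (rule integral_continuous_on_param) (use c in simp)
  then have "continuous_on ({0..<T} \<times> UNIV) (\<lambda>p. fst p * integral {0..1} (\<phi> p))"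
    by (intro continuous_on_mult continuous_on_fst continuous_on_id) simp
  then show ?thesis
    unfolding continuous_family_def by (rule continuous_on_eq) (auto simp: eq)
qed

lemma scale_mem: "t \<in> {0..<T} \<Longrightarrow> \<theta> \<in> {0..1} \<Longrightarrow> t * \<theta> \<in> {0..<T::real}"
  using mult_left_le[of \<theta> t] by auto

lemma continuous_family_time_int:
  assumes "continuous_family T f"
  shows "continuous_family T (time_int f)"
proof (rule continuous_family_integral[where \<phi> = "\<lambda>p \<theta>. f (fst p * \<theta>) (snd p)"])
  show "continuous_on (({0..<T} \<times> UNIV) \<times> {0..1}) (\<lambda>(p, \<theta>). f (fst p * \<theta>) (snd p))"
    unfolding case_prod_unfold
    by (rule continuous_family_compose[OF assms]) (auto intro!: continuous_intros scale_mem[simplified])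
  show "time_int f t x = t * integral {0..1} (\<lambda>\<theta>. f (fst (t, x) * \<theta>) (snd (t, x)))" if "t \<in> {0..<T}" for t x
    using integral_scale_interval[OF _ continuous_family_time[OF assms], of t x] that by (simp add: time_int_def)
qed

lemma family_partial_time_int:
  assumes "family_partial T i f f'"
  shows "family_partial T i (time_int f) (time_int f')"
  unfolding family_partial_def
proof (intro conjI ballI allI)
  have c: "continuous_family T f" "continuous_family T f'" using assms by (auto simp: family_partial_def)
  then show "continuous_family T (time_int f)" "continuous_family T (time_int f')"
    by (auto intro: continuous_family_time_int)
  fix t x assume t: "t \<in> {0..<T}"
  have k: "continuous_on (UNIV \<times> {0..t}) (\<lambda>(z, s). g s z)" if "continuous_family T g" for g
    unfolding case_prod_unfold
    by (rule continuous_family_compose[OF that]) (use t in \<open>auto intro!: continuous_intros\<close>)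
  show "has_partial i (time_int f t) (time_int f' t x) x"
    unfolding time_int_def[abs_def]
    by (rule has_partial_integral[OF _ k[OF c(1)] k[OF c(2)]])
      (use assms t in \<open>auto simp: family_partial_def\<close>)
qed

lemma time_int_derivative:
  assumes "continuous_family T f" "0 < t" "t < T"
  shows "((\<lambda>t. time_int f t x) has_real_derivative f t x) (at t)"
proof -
  \<comment> \<open>An endpoint beyond \<open>t\<close> makes \<open>t\<close> interior, which turns
    the derivative within the interval into a two-sided one.\<close>
  define b where "b = (t + T) / 2"
  have b: "t < b" "b < T" using assms by (auto simp: b_def)
  have "((\<lambda>t. integral {0..t} (\<lambda>s. f s x)) has_real_derivative f t x) (at t within {0..b})"
    using assms b by (intro integral_has_real_derivative continuous_family_time[OF assms(1)]) auto
  then have "((\<lambda>t. integral {0..t} (\<lambda>s. f s x)) has_real_derivative f t x) (at t within {0<..<b})"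
    by (rule DERIV_subset) auto
  moreover have "at t within {0<..<b} = at t" using assms b by (intro at_within_open) auto
  ultimately show ?thesis by (simp add: time_int_def)
qed

lemma continuous_on_gauss_avg_compose:
  assumes f: "continuous_source T R f" and "continuous_on A r" "continuous_on A s" "continuous_on A y"
    and "\<And>p. p \<in> A \<Longrightarrow> r p \<ge> 0" "\<And>p. p \<in> A \<Longrightarrow> s p \<in> {0..<T}"
  shows "continuous_on A (\<lambda>p. gauss_avg (r p) (f (s p)) (y p))"
proof -
  have "continuous_on A (\<lambda>p. case (r p, s p, y p) of (r, t, x) \<Rightarrow> gauss_avg r (f t) x)"
    by (rule continuous_on_compose2[OF continuous_source_gauss_avg[OF f]])
      (use assms in \<open>auto intro!: continuous_on_Pair\<close>)
  then show ?thesis by simp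
qed

lemma continuous_family_duhamel:
  assumes "continuous_source T R f"
  shows "continuous_family T (duhamel f)"
proof (rule continuous_family_integral[where \<phi> = "\<lambda>p \<theta>. gauss_avg (fst p * (1 - \<theta>)) (f (fst p * \<theta>)) (snd p)"])
  show "continuous_on (({0..<T} \<times> UNIV) \<times> {0..1}) (\<lambda>(p, \<theta>). gauss_avg (fst p * (1 - \<theta>)) (f (fst p * \<theta>)) (snd p))"
    unfolding case_prod_unfold
    by (rule continuous_on_gauss_avg_compose[OF assms]) (auto intro!: continuous_intros scale_mem[simplified])
  show "duhamel f t x = t * integral {0..1} (\<lambda>\<theta>. gauss_avg (fst (t, x) * (1 - \<theta>)) (f (fst (t, x) * \<theta>)) (snd (t, x)))"
    if t: "t \<in> {0..<T}" for t x
  proof -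
    have "continuous_on {0..t} (\<lambda>s. gauss_avg (t - s) (f s) x)"
      by (rule continuous_on_gauss_avg_compose[OF assms]) (use t in \<open>auto intro!: continuous_intros\<close>)
    from integral_scale_interval[OF _ this] show ?thesis
      using t by (simp add: duhamel_def right_diff_distrib)
  qed
qed

lemma family_partial_duhamel:
  assumes f: "smooth_source T R f"
  shows "family_partial T i (duhamel f) (duhamel (\<lambda>t. partial i (f t)))"
  unfolding family_partial_def
proof (intro conjI ballI allI)
  note s = smooth_source_partial(1)[OF f, of i]
  note c = smooth_source_imp_continuous_source[OF f] smooth_source_imp_continuous_source[OF s]
  show "continuous_family T (duhamel f)" "continuous_family T (duhamel (\<lambda>t. partial i (f t)))"
    using c by (auto intro: continuous_family_duhamel)
  fix t x assume t: "t \<in> {0..<T}"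
  have k: "continuous_on (UNIV \<times> {0..t}) (\<lambda>(z, s). gauss_avg (t - s) (g s) z)" if "continuous_source T R g" for g
    unfolding case_prod_unfold
    by (rule continuous_on_gauss_avg_compose[OF that]) (use t in \<open>auto intro!: continuous_intros\<close>)
  show "has_partial i (duhamel f t) (duhamel (\<lambda>t. partial i (f t)) t x) x"
    unfolding duhamel_def[abs_def]
    by (rule has_partial_integral[OF _ k[OF c(1)] k[OF c(2)]])
      (use t in \<open>auto intro!: smooth_source_gauss_avg_partial[OF f]\<close>)
qed

text \<open>The substitution \<sigma> = s + \<rho> makes the domain the triangle 0 \<le> s \<le>
  \<sigma> \<le> t; exchanging the order leaves a Duhamel integral for each \<sigma>.\<close>

lemma gauss_avg_double_integral:
  assumes f: "continuous_source T R f" and t: "t \<in> {0..<T}"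
  shows "integral {0..t} (\<lambda>s. integral {0..t - s} (\<lambda>\<rho>. gauss_avg \<rho> (f s) x)) = time_int (duhamel f) t x"
proof -
  have "continuous_on {(\<sigma>, s). 0 \<le> s \<and> s \<le> \<sigma> \<and> \<sigma> \<le> t} (\<lambda>(\<sigma>, s). gauss_avg (\<sigma> - s) (f s) x)"
    unfolding case_prod_unfold
    by (rule continuous_on_gauss_avg_compose[OF f]) (use t in \<open>auto intro!: continuous_intros\<close>)
  from integral_triangle_swap[OF this]
  have "time_int (duhamel f) t x = integral {0..t} (\<lambda>s. integral {s..t} (\<lambda>\<sigma>. gauss_avg (\<sigma> - s) (f s) x))"
    by (simp add: time_int_def duhamel_def)
  also have "\<dots> = integral {0..t} (\<lambda>s. integral {0..t - s} (\<lambda>\<rho>. gauss_avg \<rho> (f s) x))"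
  proof (rule integral_cong)
    fix s assume s: "s \<in> {0..t}"
    have "((\<lambda>\<sigma>. 1 *\<^sub>R gauss_avg (\<sigma> - s) (f s) x) has_integral (integral {s - s..t - s} (\<lambda>\<rho>. gauss_avg \<rho> (f s) x))) {s..t}"
    proof (rule has_integral_substitution[where c = 0 and d = "t - s"])
      show "continuous_on {0..t - s} (\<lambda>\<rho>. gauss_avg \<rho> (f s) x)"
        by (rule continuous_on_gauss_avg_compose[OF f]) (use s t in \<open>auto intro!: continuous_intros\<close>)
    qed (use s in \<open>auto intro!: derivative_eq_intros\<close>)
    from integral_unique[OF this]
    show "integral {s..t} (\<lambda>\<sigma>. gauss_avg (\<sigma> - s) (f s) x) = integral {0..t - s} (\<lambda>\<rho>. gauss_avg \<rho> (f s) x)" by simp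
  qed
  finally show ?thesis by simp
qed

text \<open>The time-integrated form of \<partial>_t E = f + \<Delta>E with E(0) = 0. It is obtained
  from the heat equation for each average, and the integrated form is the one that fits a velocity
  defined as a time integral.\<close>

lemma duhamel_identity:
  assumes f: "smooth_source T R f" and t: "t \<in> {0..<T}"
  shows "duhamel f t x = time_int f t x + time_int (duhamel (source_laplacian f)) t x"
proof -
  note c = smooth_source_imp_continuous_source[OF f]
  let ?I = "\<lambda>s. integral {0..t - s} (\<lambda>\<rho>. gauss_avg \<rho> (source_laplacian f s) x)"
  have eq: "gauss_avg (t - s) (f s) x = f s x + ?I s" if "s \<in> {0..t}" for s
    using integral_unique[OF gauss_avg_heat_equation[OF f, of s "t - s" x]] that t by auto
  have 1: "continuous_on {0..t} (\<lambda>s. f s x)"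
    using t by (intro continuous_family_time[OF smooth_source_imp_continuous_family[OF f]]) auto
  have 2: "continuous_on {0..t} (\<lambda>s. gauss_avg (t - s) (f s) x)"
    by (rule continuous_on_gauss_avg_compose[OF c]) (use t in \<open>auto intro!: continuous_intros\<close>)
  have "continuous_on {0..t} ?I"
    by (rule continuous_on_eq[OF continuous_on_diff[OF 2 1]]) (simp add: eq)
  then have "integral {0..t} (\<lambda>s. f s x + ?I s) = integral {0..t} (\<lambda>s. f s x) + integral {0..t} ?I"
    using 1 by (intro Henstock_Kurzweil_Integration.integral_add integrable_continuous_interval)
  moreover have "duhamel f t x = integral {0..t} (\<lambda>s. f s x + ?I s)"
    unfolding duhamel_def by (intro integral_cong eq)
  ultimately show ?thesis
    using gauss_avg_double_integral[OF smooth_source_imp_continuous_source[OF smooth_source_laplacian[OF f]] t, of x]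
    by (simp add: time_int_def)
qed

section \<open>Linearity over the three components\<close>

lemma conv_sum:
  assumes K: "locally_integrable K" and f: "\<And>j. smooth_source T R (f j)" and t: "t \<in> {0..<T}"
  shows "conv K (\<lambda>x. \<Sum>j\<in>A. f j t x) x = (\<Sum>j\<in>A. conv K (f j t) x)"
proof -
  have "integrable lborel (\<lambda>z. K z * f j t (x - z))" for j
  proof -
    obtain B where B: "f j t \<in> borel_measurable borel" "\<And>x. \<bar>f j t x\<bar> \<le> B" "\<And>x. R < norm x \<Longrightarrow> f j t x = 0"
      by (rule continuous_source_slice[OF smooth_source_imp_continuous_source[OF f[of j]] t], rule that)
    then show ?thesis by (rule conv_integrable[OF K])
  qed
  then show ?thesis
    unfolding conv_def sum_distrib_left by (intro Bochner_Integration.integral_sum)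
qed

lemma gauss_avg_sum:
  assumes f: "\<And>j. smooth_source T R (f j)" and t: "t \<in> {0..<T}"
  shows "gauss_avg r (\<lambda>x. \<Sum>j\<in>A. f j t x) x = (\<Sum>j\<in>A. gauss_avg r (f j t) x)"
proof -
  have "integrable lborel (\<lambda>z. heat_kernel z 1 * f j t (x - sqrt r *\<^sub>R z))" for j
  proof -
    obtain B where B: "f j t \<in> borel_measurable borel" "\<And>x. \<bar>f j t x\<bar> \<le> B" "\<And>x. R < norm x \<Longrightarrow> f j t x = 0"
      by (rule continuous_source_slice[OF smooth_source_imp_continuous_source[OF f[of j]] t], rule that)
    then show ?thesis by (intro gauss_avg_integrable)
  qed
  then show ?thesis
    unfolding gauss_avg_def sum_distrib_left by (intro Bochner_Integration.integral_sum)
qed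

lemma duhamel_sum:
  assumes f: "\<And>j::3. smooth_source T R (f j)" and t: "t \<in> {0..<T}"
  shows "duhamel (\<lambda>t x. \<Sum>j\<in>UNIV. f j t x) t x = (\<Sum>j\<in>UNIV. duhamel (f j) t x)"
proof -
  have "duhamel (\<lambda>t x. \<Sum>j\<in>UNIV. f j t x) t x = integral {0..t} (\<lambda>s. \<Sum>j\<in>UNIV. gauss_avg (t - s) (f j s) x)"
    unfolding duhamel_def using t by (intro integral_cong gauss_avg_sum[OF f]) auto
  also have "\<dots> = (\<Sum>j\<in>UNIV. duhamel (f j) t x)"
    unfolding duhamel_def
  proof (intro Henstock_Kurzweil_Integration.integral_sum integrable_continuous_interval)
    show "continuous_on {0..t} (\<lambda>s. gauss_avg (t - s) (f j s) x)" for j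
      by (rule continuous_on_gauss_avg_compose[OF smooth_source_imp_continuous_source[OF f[of j]]])
        (use t in \<open>auto intro!: continuous_intros\<close>)
  qed simp
  finally show ?thesis .
qed

lemma time_int_sum:
  assumes f: "\<And>j::3. continuous_family T (f j)" and t: "t \<in> {0..<T}"
  shows "time_int (\<lambda>t x. \<Sum>j\<in>UNIV. f j t x) t x = (\<Sum>j\<in>UNIV. time_int (f j) t x)"
  unfolding time_int_def
  using t by (intro Henstock_Kurzweil_Integration.integral_sum integrable_continuous_interval continuous_family_time[OF f]) auto

lemma time_int_cong:
  assumes "\<And>s. s \<in> {0..t} \<Longrightarrow> f s x = g s x"
  shows "time_int f t x = time_int g t x"
  unfolding time_int_def using assms by (intro integral_cong) auto

lemma partial_sum_source:
  assumes f: "\<And>j::3. smooth_source T R (f j)" and t: "t \<in> {0..<T}"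
  shows "partial i (\<lambda>x. \<Sum>j\<in>UNIV. f j t x) x = (\<Sum>j\<in>UNIV. partial i (f j t) x)"
proof -
  have "has_partial i (f j t) (partial i (f j t) x) x" for j
    using smooth_source_partial(2)[OF f[of j], of i] t by (auto simp: family_partial_def)
  then show ?thesis by (intro has_partial_imp_partial has_partial_sum)
qed

lemma source_laplacian_sum:
  assumes f: "\<And>j::3. smooth_source T R (f j)" and t: "t \<in> {0..<T}"
  shows "source_laplacian (\<lambda>t x. \<Sum>j\<in>UNIV. f j t x) t x = (\<Sum>j\<in>UNIV. source_laplacian (f j) t x)"
proof -
  have "partial i (\<lambda>x. \<Sum>j\<in>UNIV. f j t x) = (\<lambda>x. \<Sum>j\<in>UNIV. partial i (f j t) x)" for i
    using partial_sum_source[OF f t] by auto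
  then have "source_laplacian (\<lambda>t x. \<Sum>j\<in>UNIV. f j t x) t x = (\<Sum>i\<in>UNIV. \<Sum>j\<in>UNIV. partial i (partial i (f j t)) x)"
    unfolding source_laplacian_def
    using partial_sum_source[OF smooth_source_partial(1)[OF f] t] by simp
  also have "\<dots> = (\<Sum>j\<in>UNIV. source_laplacian (f j) t x)"
    unfolding source_laplacian_def by (rule sum.swap)
  finally show ?thesis .
qed

lemma source_laplacian_partial:
  assumes f: "smooth_source T R f" and t: "t \<in> {0..<T}"
  shows "source_laplacian (\<lambda>t. partial i (f t)) t x = partial i (source_laplacian f t) x"
proof -
  note s = smooth_source_partial(1)
  have "partial j (partial j (partial i (f t))) x = partial i (partial j (partial j (f t))) x" for j
  proof -
    have "partial j (partial i (f t)) = partial i (partial j (f t))"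
      using partial_partial_commute[OF f t] by auto
    then show ?thesis using partial_partial_commute[OF s[OF f, of j] t, of j i x] by simp
  qed
  then show ?thesis
    using partial_sum_source[OF s[OF s[OF f]] t, of i "\<lambda>j. j"] partial_sum_source[of T R "\<lambda>j t. partial j (partial j (f t))" t i x] s[OF s[OF f]] t
    by (simp add: source_laplacian_def[abs_def])
qed

section \<open>The velocity generated by the forcing\<close>

text \<open>The force enters through its scalar components, with \<open>T\<close> and
  \<open>R\<close> common to all three.\<close>

locale stokes_forcing =
  fixes T R :: real and f :: "3 \<Rightarrow> real \<Rightarrow> real^3 \<Rightarrow> real"
  assumes T_pos: "T > 0" and source: "\<And>j. smooth_source T R (f j)"
begin

definition source_div :: "real \<Rightarrow> real^3 \<Rightarrow> real" where
  "source_div t x = (\<Sum>j\<in>UNIV. partial j (f j t) x)"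

text \<open>The components of G, in other words of - curl curl F; this is why the field is
  divergence free.\<close>

definition heat_source :: "3 \<Rightarrow> real \<Rightarrow> real^3 \<Rightarrow> real" where
  "heat_source i t x = source_laplacian (f i) t x - partial i (source_div t) x"

text \<open>The three inputs are independent, so that derivatives and sums of rates are again rates,
  with the inputs differentiated or summed.\<close>

definition rate :: "(real \<Rightarrow> real^3 \<Rightarrow> real) \<Rightarrow> (real \<Rightarrow> real^3 \<Rightarrow> real) \<Rightarrow> (real \<Rightarrow> real^3 \<Rightarrow> real) \<Rightarrow> real \<Rightarrow> real^3 \<Rightarrow> real" where
  "rate a b c t x = a t x + conv newton_kernel (b t) x + duhamel c t x"

text \<open>\<open>\<T>(r) * F = F + N \<nabla>div F + \<integral>\<^sub>0\<^sup>r \<Phi>(\<rho>) * (\<Delta>F - \<nabla>div F) d\<rho>\<close>, where \<open>N\<close> is the Newtonian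
  potential. Interchanging the time integrals turns \<open>\<integral>\<^sub>0\<^sup>t \<T>(t-s) * F(s) ds\<close> into the time integral
  of \<open>velocity_rate\<close>.\<close>

definition velocity_rate :: "3 \<Rightarrow> real \<Rightarrow> real^3 \<Rightarrow> real" where
  "velocity_rate i = rate (f i) (\<lambda>t. partial i (source_div t)) (heat_source i)"

definition velocity :: "3 \<Rightarrow> real \<Rightarrow> real^3 \<Rightarrow> real" where
  "velocity i = time_int (velocity_rate i)"

lemma smooth_source_div: "smooth_source T R source_div"
  unfolding source_div_def[abs_def] by (intro smooth_source_sum3 smooth_source_partial(1) source)

lemma smooth_heat_source: "smooth_source T R (heat_source i)"
  unfolding heat_source_def[abs_def]
  by (intro smooth_source_diff smooth_source_laplacian smooth_source_partial(1) source smooth_source_div)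

lemma continuous_family_rate:
  assumes "smooth_source T R a" "smooth_source T R b" "smooth_source T R c"
  shows "continuous_family T (rate a b c)"
  unfolding rate_def[abs_def]
  using assms
  by (intro continuous_family_add smooth_source_imp_continuous_family continuous_source_conv
      continuous_family_duhamel locally_integrable_newton_kernel smooth_source_imp_continuous_source)

lemma family_partial_rate:
  assumes "smooth_source T R a" "smooth_source T R b" "smooth_source T R c"
  shows "family_partial T j (rate a b c) (rate (\<lambda>t. partial j (a t)) (\<lambda>t. partial j (b t)) (\<lambda>t. partial j (c t)))"
  unfolding rate_def[abs_def]
  using assms
  by (intro family_partial_add smooth_source_partial(2) family_partial_conv family_partial_duhamel locally_integrable_newton_kernel)

lemma rate_sum:
  assumes a: "\<And>j. smooth_source T R (a j)" and b: "\<And>j. smooth_source T R (b j)"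
    and c: "\<And>j::3. smooth_source T R (c j)" and t: "t \<in> {0..<T}"
  shows "(\<Sum>j\<in>UNIV. rate (a j) (b j) (c j) t x) =
    rate (\<lambda>t x. \<Sum>j\<in>UNIV. a j t x) (\<lambda>t x. \<Sum>j\<in>UNIV. b j t x) (\<lambda>t x. \<Sum>j\<in>UNIV. c j t x) t x"
  unfolding rate_def sum.distrib duhamel_sum[OF c t] conv_sum[OF locally_integrable_newton_kernel b t] ..

lemma continuous_family_velocity_rate: "continuous_family T (velocity_rate i)"
  unfolding velocity_rate_def
  by (intro continuous_family_rate source smooth_heat_source smooth_source_partial(1) smooth_source_div)

definition velocity_partial :: "3 \<Rightarrow> 3 \<Rightarrow> real \<Rightarrow> real^3 \<Rightarrow> real" where
  "velocity_partial i j = time_int (rate (\<lambda>t. partial j (f i t)) (\<lambda>t. partial j (partial i (source_div t)))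
     (\<lambda>t. partial j (heat_source i t)))"

definition velocity_partial2 :: "3 \<Rightarrow> 3 \<Rightarrow> 3 \<Rightarrow> real \<Rightarrow> real^3 \<Rightarrow> real" where
  "velocity_partial2 i j k = time_int (rate (\<lambda>t. partial k (partial j (f i t)))
     (\<lambda>t. partial k (partial j (partial i (source_div t)))) (\<lambda>t. partial k (partial j (heat_source i t))))"

lemma family_partial_velocity: "family_partial T j (velocity i) (velocity_partial i j)"
  unfolding velocity_def velocity_partial_def velocity_rate_def
  by (intro family_partial_time_int family_partial_rate source smooth_heat_source smooth_source_partial(1) smooth_source_div)

lemma family_partial_velocity_partial: "family_partial T k (velocity_partial i j) (velocity_partial2 i j k)"
  unfolding velocity_partial_def velocity_partial2_def
  by (intro family_partial_time_int family_partial_rate source smooth_heat_source smooth_source_partial(1) smooth_source_div)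

text \<open>Inside the time integral, Poisson's equation turns the Newtonian potential of \<Delta>
  \<partial>_i div F into - \<partial>_i div F, which together with \<Delta> F_i is
  \<open>heat_source\<close>. What remains is the right-hand side of
  \<open>duhamel_identity\<close>.\<close>

lemma velocity_laplacian:
  assumes t: "t \<in> {0..<T}"
  shows "(\<Sum>j\<in>UNIV. velocity_partial2 i j j t x) = duhamel (heat_source i) t x"
proof -
  note s = smooth_source_partial(1)
  let ?b = "\<lambda>t. partial i (source_div t)"
  let ?r = "\<lambda>j. rate (\<lambda>t. partial j (partial j (f i t))) (\<lambda>t. partial j (partial j (?b t))) (\<lambda>t. partial j (partial j (heat_source i t)))"
  note src = s[OF s[OF source]] s[OF s[OF s[OF smooth_source_div]]] s[OF s[OF smooth_heat_source]]
  have "(\<Sum>j\<in>UNIV. velocity_partial2 i j j t x) = time_int (\<lambda>t x. \<Sum>j\<in>UNIV. ?r j t x) t x"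
    unfolding velocity_partial2_def
    by (rule time_int_sum[OF continuous_family_rate[OF src] t, symmetric])
  also have "\<dots> = time_int (\<lambda>t x. heat_source i t x + duhamel (source_laplacian (heat_source i)) t x) t x"
  proof (rule time_int_cong)
    fix s' assume "s' \<in> {0..t}"
    then have s': "s' \<in> {0..<T}" using t by auto
    have "(\<Sum>j\<in>UNIV. ?r j s' x) = rate (source_laplacian (f i)) (source_laplacian ?b) (source_laplacian (heat_source i)) s' x"
      unfolding rate_sum[OF src s'] source_laplacian_def[abs_def] ..
    also have "\<dots> = heat_source i s' x + duhamel (source_laplacian (heat_source i)) s' x"
      unfolding rate_def using poisson_equation[OF s[OF smooth_source_div] s'] by (simp add: heat_source_def)
    finally show "(\<Sum>j\<in>UNIV. ?r j s' x) = heat_source i s' x + duhamel (source_laplacian (heat_source i)) s' x" .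
  qed
  also have "\<dots> = time_int (heat_source i) t x + time_int (duhamel (source_laplacian (heat_source i))) t x"
    unfolding time_int_def
  proof (intro Henstock_Kurzweil_Integration.integral_add integrable_continuous_interval)
    show "continuous_on {0..t} (\<lambda>s. heat_source i s x)"
      using t by (intro continuous_family_time[OF smooth_source_imp_continuous_family[OF smooth_heat_source]]) simp
    show "continuous_on {0..t} (\<lambda>s. duhamel (source_laplacian (heat_source i)) s x)"
      using t by (intro continuous_family_time[OF continuous_family_duhamel[OF
            smooth_source_imp_continuous_source[OF smooth_source_laplacian[OF smooth_heat_source]]]]) simp
  qed
  also have "\<dots> = duhamel (heat_source i) t x"
    using duhamel_identity[OF smooth_heat_source t] by simp
  finally show ?thesis .
qed

lemma heat_source_divergence:
  assumes t: "t \<in> {0..<T}"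
  shows "(\<Sum>i\<in>UNIV. partial i (heat_source i t) x) = 0"
proof -
  note s = smooth_source_partial(1)
  have "partial i (heat_source i t) x = partial i (source_laplacian (f i) t) x - partial i (partial i (source_div t)) x" for i
    unfolding heat_source_def[abs_def]
    using smooth_source_partial(2)[OF smooth_source_laplacian[OF source[of i]], of i]
      smooth_source_partial(2)[OF s[OF smooth_source_div, of i], of i] t
    by (intro has_partial_imp_partial has_partial_diff) (auto simp: family_partial_def)
  then have "(\<Sum>i\<in>UNIV. partial i (heat_source i t) x) = (\<Sum>i\<in>UNIV. partial i (source_laplacian (f i) t) x) - source_laplacian source_div t x"
    by (simp add: sum_subtractf source_laplacian_def)
  also have "source_laplacian source_div t x = (\<Sum>i\<in>UNIV. source_laplacian (\<lambda>t. partial i (f i t)) t x)"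
    unfolding source_div_def[abs_def] by (rule source_laplacian_sum[OF s[OF source] t])
  also have "\<dots> = (\<Sum>i\<in>UNIV. partial i (source_laplacian (f i) t) x)"
    using source_laplacian_partial[OF source t] by simp
  finally show ?thesis by simp
qed

lemma duhamel_zero:
  assumes "\<And>s x. s \<in> {0..t} \<Longrightarrow> g s x = 0"
  shows "duhamel g t x = 0"
proof -
  have "duhamel g t x = integral {0..t} (\<lambda>s. 0)"
    unfolding duhamel_def by (intro integral_cong) (simp add: gauss_avg_def assms)
  then show ?thesis by simp
qed

text \<open>The divergence of the rate is div F + N \<Delta> div F plus a Duhamel integral of div G.
  The first two terms cancel by Poisson's equation and the third vanishes.\<close>

lemma velocity_divergence:
  assumes t: "t \<in> {0..<T}"
  shows "(\<Sum>i\<in>UNIV. velocity_partial i i t x) = 0"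
proof -
  note s = smooth_source_partial(1)
  let ?r = "\<lambda>i. rate (\<lambda>t. partial i (f i t)) (\<lambda>t. partial i (partial i (source_div t))) (\<lambda>t. partial i (heat_source i t))"
  note src = s[OF source] s[OF s[OF smooth_source_div]] s[OF smooth_heat_source]
  have "(\<Sum>i\<in>UNIV. velocity_partial i i t x) = time_int (\<lambda>t x. \<Sum>i\<in>UNIV. ?r i t x) t x"
    unfolding velocity_partial_def
    by (rule time_int_sum[OF continuous_family_rate[OF src] t, symmetric])
  also have "\<dots> = time_int (\<lambda>t x. 0) t x"
  proof (rule time_int_cong)
    fix s' assume "s' \<in> {0..t}"
    then have s': "s' \<in> {0..<T}" using t by auto
    have "(\<Sum>i\<in>UNIV. ?r i s' x) = rate source_div (source_laplacian source_div) (\<lambda>t x. \<Sum>i\<in>UNIV. partial i (heat_source i t) x) s' x"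
    proof -
      have "(\<lambda>t x. \<Sum>i\<in>UNIV. partial i (f i t) x) = source_div"
        "(\<lambda>t x. \<Sum>i\<in>UNIV. partial i (partial i (source_div t)) x) = source_laplacian source_div"
        by (intro ext, simp add: source_div_def source_laplacian_def)+
      then show ?thesis by (simp only: rate_sum[OF src s'])
    qed
    moreover have "duhamel (\<lambda>t x. \<Sum>i\<in>UNIV. partial i (heat_source i t) x) s' x = 0"
      using s' by (intro duhamel_zero heat_source_divergence) auto
    ultimately show "(\<Sum>i\<in>UNIV. ?r i s' x) = 0"
      unfolding rate_def using poisson_equation[OF smooth_source_div s'] by simp
  qed
  also have "\<dots> = 0" by (simp add: time_int_def)
  finally show ?thesis .
qed

lemma velocity_time_derivative:
  assumes "t \<in> {0<..<T}"
  shows "((\<lambda>t. velocity i t x) has_real_derivative velocity_rate i t x) (at t)"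
  unfolding velocity_def using assms
  by (intro time_int_derivative[OF continuous_family_velocity_rate]) auto

text \<open>With its minus sign, the convolution is the i-th derivative of the pressure, so this is
  the momentum equation for the forcing part.\<close>

lemma velocity_equation:
  assumes t: "t \<in> {0..<T}"
  shows "velocity_rate i t x - (\<Sum>j\<in>UNIV. velocity_partial2 i j j t x) - conv newton_kernel (partial i (source_div t)) x = f i t x"
  unfolding velocity_laplacian[OF t] velocity_rate_def rate_def by simp

end

section \<open>The Oseen kernel\<close>

text \<open>Integration by parts through uniqueness of derivatives: the same partial derivative is
  computed once on the kernel and once on the source, for each order in turn.\<close>

lemma conv_oseen_P_partial2:
  assumes f: "smooth_source T R f" and t: "t \<in> {0..<T}" and r: "r > 0"
  shows "conv (oseen_P_partial2 i j r) (f t) x = conv (\<lambda>z. oseen_P z r) (partial i (partial j (f t))) x"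
    and "conv (oseen_P_partial j r) (f t) x = conv (\<lambda>z. oseen_P z r) (partial j (f t)) x"
proof -
  note s = smooth_source_partial(1)[OF f, of j]
  obtain B where B: "f t \<in> borel_measurable borel" "\<And>x. \<bar>f t x\<bar> \<le> B" "\<And>x. R < norm x \<Longrightarrow> f t x = 0"
    by (rule continuous_source_slice[OF smooth_source_imp_continuous_source[OF f] t], rule that)
  note loc = locally_integrable_continuous[OF continuous_on_oseen_P[OF r]]
  have 1: "conv (oseen_P_partial j r) (f t) = conv (\<lambda>z. oseen_P z r) (partial j (f t))"
  proof
    fix x
    have "has_partial j (conv (\<lambda>z. oseen_P z r) (f t)) (conv (oseen_P_partial j r) (f t) x) x"
      by (rule conv_partial_left[OF continuous_on_oseen_P[OF r] continuous_on_oseen_P_partial[OF r] B has_partial_oseen_P[OF r]])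
    moreover have "has_partial j (conv (\<lambda>z. oseen_P z r) (f t)) (conv (\<lambda>z. oseen_P z r) (partial j (f t)) x) x"
      using family_partial_conv[OF loc f, of j] t by (auto simp: family_partial_def)
    ultimately show "conv (oseen_P_partial j r) (f t) x = conv (\<lambda>z. oseen_P z r) (partial j (f t)) x"
      by (metis has_partial_imp_partial)
  qed
  then show "conv (oseen_P_partial j r) (f t) x = conv (\<lambda>z. oseen_P z r) (partial j (f t)) x" by simp
  have "has_partial i (conv (oseen_P_partial j r) (f t)) (conv (oseen_P_partial2 i j r) (f t) x) x"
    by (rule conv_partial_left[OF continuous_on_oseen_P_partial[OF r] continuous_on_oseen_P_partial2[OF r] B has_partial_oseen_P_partial[OF r]])
  moreover have "has_partial i (conv (oseen_P_partial j r) (f t)) (conv (\<lambda>z. oseen_P z r) (partial i (partial j (f t))) x) x"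
    unfolding 1 using family_partial_conv[OF loc s, of i] t by (auto simp: family_partial_def)
  ultimately show "conv (oseen_P_partial2 i j r) (f t) x = conv (\<lambda>z. oseen_P z r) (partial i (partial j (f t))) x"
    by (metis has_partial_imp_partial)
qed

lemma oseen_kernel_component:
  assumes "r > 0"
  shows "oseen_kernel z r $ i $ j = (if i = j then heat_kernel z r else 0) + oseen_P_partial2 i j r z"
proof -
  have "partial j (\<lambda>y. oseen_P y r) = oseen_P_partial j r"
    using has_partial_oseen_P[OF assms] has_partial_imp_partial by blast
  then show ?thesis
    using has_partial_oseen_P_partial[OF assms] has_partial_imp_partial by (simp add: oseen_kernel_def)
qed

text \<open>Passes from Lebesgue measure to \<open>lborel\<close> and to a component at once. All
  components are assumed integrable so that the vector integral is a genuine one, not the default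
  value 0.\<close>

lemma vec_lebesgue_integral_component:
  fixes g :: "'a::euclidean_space \<Rightarrow> real^3"
  assumes int: "\<And>i. integrable lborel (\<lambda>y. g y $ i)"
  shows "(LINT y|lebesgue. g y) $ i = (\<integral>y. g y $ i \<partial>lborel)"
proof -
  have g: "g = (\<lambda>y. \<Sum>i\<in>UNIV. (g y $ i) *\<^sub>R axis i 1)"
  proof
    fix y show "g y = (\<Sum>i\<in>UNIV. (g y $ i) *\<^sub>R axis i 1)"
      using basis_expansion[of "g y"] by (simp add: scalar_mult_eq_scaleR)
  qed
  have ig: "integrable lborel g"
    by (subst g) (intro Bochner_Integration.integrable_sum integrable_scaleR_left int)
  then have "(LINT y|lebesgue. g y) = (\<integral>y. g y \<partial>lborel)"
    by (intro integral_completion borel_measurable_integrable)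
  then show ?thesis
    using integral_bounded_linear[OF bounded_linear_vec_nth ig, of i] by simp
qed

context stokes_forcing
begin

text \<open>Here \<open>r\<close> is the time argument of the kernel and \<open>s\<close> the time
  of the force. The expression stays meaningful at r = 0, where the Oseen kernel does not.\<close>

definition oseen_rate :: "3 \<Rightarrow> real \<Rightarrow> real \<Rightarrow> real^3 \<Rightarrow> real" where
  "oseen_rate i r s x = f i s x + conv newton_kernel (partial i (source_div s)) x
     + integral {0..r} (\<lambda>\<rho>. gauss_avg \<rho> (heat_source i s) x)"

lemma gauss_avg_heat_source:
  assumes s: "s \<in> {0..<T}"
  shows "gauss_avg \<rho> (heat_source i s) x = gauss_avg \<rho> (source_laplacian (f i) s) x - gauss_avg \<rho> (partial i (source_div s)) x"
proof -
  note c = smooth_source_imp_continuous_source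
  obtain B1 where B1: "source_laplacian (f i) s \<in> borel_measurable borel" "\<And>x. \<bar>source_laplacian (f i) s x\<bar> \<le> B1"
    "\<And>x. R < norm x \<Longrightarrow> source_laplacian (f i) s x = 0"
    by (rule continuous_source_slice[OF c[OF smooth_source_laplacian[OF source]] s, of i], rule that)
  obtain B2 where B2: "partial i (source_div s) \<in> borel_measurable borel" "\<And>x. \<bar>partial i (source_div s) x\<bar> \<le> B2"
    "\<And>x. R < norm x \<Longrightarrow> partial i (source_div s) x = 0"
    by (rule continuous_source_slice[OF c[OF smooth_source_partial(1)[OF smooth_source_div]] s, of i], rule that)
  show ?thesis
    unfolding gauss_avg_def heat_source_def right_diff_distrib
    by (intro Bochner_Integration.integral_diff gauss_avg_integrable[OF B1(1,2)] gauss_avg_integrable[OF B2(1,2)])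
qed

lemma continuous_on_gauss_avg_time:
  assumes "continuous_source T R g" "s \<in> {0..<T}"
  shows "continuous_on {0..r} (\<lambda>\<rho>. gauss_avg \<rho> (g s) x)"
  by (rule continuous_on_gauss_avg_compose[OF assms(1)]) (use assms(2) in \<open>auto intro!: continuous_intros\<close>)

text \<open>The diagonal part of the kernel gives a Gaussian average of F_i; the second derivatives
  of P move to F and sum to the convolution of P with \<partial>_i div F. The heat equation rewrites
  the former and the Newtonian splitting the latter, and their time integrals combine into one with
  G.\<close>

lemma oseen_conv_component:
  assumes F: "\<And>y j. F y $ j = f j s y" and s: "s \<in> {0..<T}" and r: "r > 0"
  shows "oseen_conv r F x $ i = oseen_rate i r s x"
proof -
  note c = smooth_source_imp_continuous_source
  define K where "K i j z = (if i = j then heat_kernel z r else 0) + oseen_P_partial2 i j r z" for i j z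
  have hk: "continuous_on UNIV (\<lambda>z. heat_kernel z r)"
    using heat_type_slice(1)[OF heat_type_heat_kernel r] .
  have contK: "continuous_on UNIV (K i j)" for i j
    unfolding K_def[abs_def] using hk continuous_on_oseen_P_partial2[OF r]
    by (cases "i = j") (auto intro!: continuous_on_add)
  have fi: "integrable lborel (\<lambda>z. k z * f j s (x - z)) \<and> f j s \<in> borel_measurable borel" if "continuous_on UNIV k" for k j
  proof -
    obtain B where B: "f j s \<in> borel_measurable borel" "\<And>x. \<bar>f j s x\<bar> \<le> B" "\<And>x. R < norm x \<Longrightarrow> f j s x = 0"
      by (rule continuous_source_slice[OF c[OF source] s, of j], rule that)
    then show ?thesis using conv_integrable[OF locally_integrable_continuous[OF that] B] by blast
  qed
  have int: "integrable lborel (\<lambda>y. K i j (x - y) * f j s y)" for i j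
  proof -
    have [measurable]: "K i j \<in> borel_measurable borel" "f j s \<in> borel_measurable borel"
      using contK fi[OF contK] by (auto intro: borel_measurable_continuous_onI)
    show ?thesis
      using fi[OF contK, of i j j] lborel_integrable_reflect[of "\<lambda>z. K i j z * f j s (x - z)" x] by simp
  qed
  have comp: "(oseen_kernel (x - y) r *v F y) $ i = (\<Sum>j\<in>UNIV. K i j (x - y) * f j s y)" for y i
    by (simp add: matrix_vector_mult_def oseen_kernel_component[OF r] K_def F)
  have "oseen_conv r F x $ i = (\<integral>y. (\<Sum>j\<in>UNIV. K i j (x - y) * f j s y) \<partial>lborel)"
    unfolding oseen_conv_def
    using vec_lebesgue_integral_component[of "\<lambda>y. oseen_kernel (x - y) r *v F y" i]
    unfolding comp by (simp add: int)
  also have "\<dots> = (\<Sum>j\<in>UNIV. conv (K i j) (f j s) x)"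
  proof -
    have "conv (K i j) (f j s) x = (\<integral>y. K i j (x - y) * f j s y \<partial>lborel)" for j
      by (rule conv_commute[OF borel_measurable_continuous_onI[OF contK] fi[OF contK, THEN conjunct2]])
    then show ?thesis by (simp add: int)
  qed
  also have "\<dots> = (\<Sum>j\<in>UNIV. (if i = j then gauss_avg r (f j s) x else 0) + conv (\<lambda>z. oseen_P z r) (partial i (partial j (f j s))) x)"
  proof (rule sum.cong[OF refl])
    fix j
    have "conv (K i j) (f j s) x = conv (\<lambda>z. if i = j then heat_kernel z r else 0) (f j s) x + conv (oseen_P_partial2 i j r) (f j s) x"
      unfolding conv_def K_def distrib_right
    proof (intro Bochner_Integration.integral_add)
      show "integrable lborel (\<lambda>z. (if i = j then heat_kernel z r else 0) * f j s (x - z))"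
        using fi[OF hk] by (cases "i = j") auto
    qed (use fi[OF continuous_on_oseen_P_partial2[OF r]] in blast)
    also have "conv (\<lambda>z. if i = j then heat_kernel z r else 0) (f j s) x = (if i = j then gauss_avg r (f j s) x else 0)"
      using fi[OF hk] by (cases "i = j") (auto simp: gauss_avg_eq_conv[OF r], simp add: conv_def)
    finally show "conv (K i j) (f j s) x = (if i = j then gauss_avg r (f j s) x else 0) + conv (\<lambda>z. oseen_P z r) (partial i (partial j (f j s))) x"
      unfolding conv_oseen_P_partial2(1)[OF source s r] .
  qed
  also have "\<dots> = gauss_avg r (f i s) x + (\<Sum>j\<in>UNIV. conv (\<lambda>z. oseen_P z r) (partial i (partial j (f j s))) x)"
    by (simp add: sum.distrib)
  also have "(\<Sum>j\<in>UNIV. conv (\<lambda>z. oseen_P z r) (partial i (partial j (f j s))) x) = conv (\<lambda>z. oseen_P z r) (partial i (source_div s)) x"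
  proof -
    note p = smooth_source_partial(1)
    have "partial i (source_div s) = (\<lambda>x. \<Sum>j\<in>UNIV. partial i (partial j (f j s)) x)"
      unfolding source_div_def[abs_def] using partial_sum_source[OF p[OF source] s] by auto
    then show ?thesis
      using conv_sum[OF locally_integrable_continuous[OF continuous_on_oseen_P[OF r]] p[OF p[OF source]] s,
          of "\<lambda>_. i" "\<lambda>j. j" "\<lambda>j. j" UNIV x] by simp
  qed
  also have "\<dots> = conv newton_kernel (partial i (source_div s)) x - integral {0..r} (\<lambda>\<rho>. gauss_avg \<rho> (partial i (source_div s)) x)"
    using newton_potential_split[OF c[OF smooth_source_partial(1)[OF smooth_source_div]] s r] by simp
  also have "gauss_avg r (f i s) x = f i s x + integral {0..r} (\<lambda>\<rho>. gauss_avg \<rho> (source_laplacian (f i) s) x)"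
    using integral_unique[OF gauss_avg_heat_equation[OF source s, of r i x]] r by simp
  also have "f i s x + integral {0..r} (\<lambda>\<rho>. gauss_avg \<rho> (source_laplacian (f i) s) x) +
      (conv newton_kernel (partial i (source_div s)) x - integral {0..r} (\<lambda>\<rho>. gauss_avg \<rho> (partial i (source_div s)) x))
      = oseen_rate i r s x"
  proof -
    have "integral {0..r} (\<lambda>\<rho>. gauss_avg \<rho> (heat_source i s) x) =
      integral {0..r} (\<lambda>\<rho>. gauss_avg \<rho> (source_laplacian (f i) s) x) - integral {0..r} (\<lambda>\<rho>. gauss_avg \<rho> (partial i (source_div s)) x)"
      unfolding gauss_avg_heat_source[OF s]
      using c[OF smooth_source_laplacian[OF source]] c[OF smooth_source_partial(1)[OF smooth_source_div]] s
      by (intro Henstock_Kurzweil_Integration.integral_diff integrable_continuous_interval continuous_on_gauss_avg_time)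
    then show ?thesis by (simp add: oseen_rate_def)
  qed
  finally show ?thesis .
qed

lemma oseen_rate_integral:
  assumes t: "t \<in> {0..<T}"
  shows "continuous_on {0..t} (\<lambda>s. oseen_rate i (t - s) s x)"
    and "integral {0..t} (\<lambda>s. oseen_rate i (t - s) s x) = velocity i t x"
proof -
  note c = smooth_source_imp_continuous_source
  let ?a = "\<lambda>s. f i s x" and ?b = "\<lambda>s. conv newton_kernel (partial i (source_div s)) x"
    and ?c = "\<lambda>s. integral {0..t - s} (\<lambda>\<rho>. gauss_avg \<rho> (heat_source i s) x)"
  have a: "continuous_on {0..t} ?a"
    using t by (intro continuous_family_time[OF smooth_source_imp_continuous_family[OF source]]) auto
  have b: "continuous_on {0..t} ?b"
    using t by (intro continuous_family_time[OF continuous_source_conv[OF locally_integrable_newton_kernel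
          c[OF smooth_source_partial(1)[OF smooth_source_div]]]]) auto
  have d: "continuous_on {0..t} (\<lambda>s. duhamel (heat_source i) s x)"
    using t by (intro continuous_family_time[OF continuous_family_duhamel[OF c[OF smooth_heat_source]]]) auto
  have e: "continuous_on {0..t} ?c"
  proof -
    \<comment> \<open>The endpoint t - s is scaled to 1 so that continuity in \<open>s\<close>
      follows from that of a parameter integral.\<close>
    have "continuous_on {0..t} (\<lambda>s. integral (cbox 0 1) (\<lambda>\<theta>. gauss_avg ((t - s) * \<theta>) (heat_source i s) x))"
    proof (rule integral_continuous_on_param)
      show "continuous_on ({0..t} \<times> cbox 0 1) (\<lambda>(s, \<theta>). gauss_avg ((t - s) * \<theta>) (heat_source i s) x)"
        unfolding case_prod_unfold
        by (rule continuous_on_gauss_avg_compose[OF c[OF smooth_heat_source]]) (use t in \<open>auto intro!: continuous_intros\<close>)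
    qed
    then have "continuous_on {0..t} (\<lambda>s. (t - s) * integral {0..1} (\<lambda>\<theta>. gauss_avg ((t - s) * \<theta>) (heat_source i s) x))"
      by (intro continuous_on_mult continuous_on_diff continuous_on_const continuous_on_id) simp
    then show ?thesis
    proof (rule continuous_on_eq)
      show "(t - s) * integral {0..1} (\<lambda>\<theta>. gauss_avg ((t - s) * \<theta>) (heat_source i s) x) = ?c s" if "s \<in> {0..t}" for s
        using that t by (intro integral_scale_interval[symmetric] continuous_on_gauss_avg_time[OF c[OF smooth_heat_source]]) auto
    qed
  qed
  show "continuous_on {0..t} (\<lambda>s. oseen_rate i (t - s) s x)"
    unfolding oseen_rate_def by (intro continuous_on_add a b e)
  have "integral {0..t} (\<lambda>s. oseen_rate i (t - s) s x) = integral {0..t} (\<lambda>s. ?a s + ?b s) + integral {0..t} ?c"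
    unfolding oseen_rate_def
    by (intro Henstock_Kurzweil_Integration.integral_add integrable_continuous_interval continuous_on_add a b e)
  also have "integral {0..t} ?c = integral {0..t} (\<lambda>s. duhamel (heat_source i) s x)"
    using gauss_avg_double_integral[OF c[OF smooth_heat_source] t] by (simp add: time_int_def)
  also have "integral {0..t} (\<lambda>s. ?a s + ?b s) + \<dots> = velocity i t x"
    unfolding velocity_def velocity_rate_def rate_def[abs_def] time_int_def
    by (intro Henstock_Kurzweil_Integration.integral_add[symmetric] integrable_continuous_interval continuous_on_add a b d)
  finally show "integral {0..t} (\<lambda>s. oseen_rate i (t - s) s x) = velocity i t x" .
qed

text \<open>The pointwise identity needs t - s > 0; the excluded value s = t is one point and does
  not affect the integral.\<close>

lemma oseen_conv_time_integral:
  assumes F: "\<And>s y j. F s y $ j = f j s y" and t: "t \<in> {0..<T}"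
  shows "(LINT s:{0..t}|lebesgue. oseen_conv (t - s) (F s) x) $ i = velocity i t x"
proof -
  define W where "W s = (\<chi> i. oseen_rate i (t - s) s x)" for s
  have VW: "oseen_conv (t - s) (F s) x = W s" if "s \<in> {0..t}" "s \<noteq> t" for s
    using that t by (auto simp: vec_eq_iff W_def intro!: oseen_conv_component[OF F])
  have int: "integrable lborel (\<lambda>s. (indicator {0..t} s *\<^sub>R W s) $ i)" for i
    using borel_integrable_compact[OF _ oseen_rate_integral(1)[OF t, of i x]] by (simp add: W_def)
  have "integrable lborel (\<lambda>s. indicator {0..t} s *\<^sub>R W s)"
    unfolding W_def by (intro borel_integrable_compact continuous_on_vec_lambda oseen_rate_integral(1)[OF t]) simp
  then have m: "(\<lambda>s. indicator {0..t} s *\<^sub>R W s) \<in> borel_measurable borel"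
    using borel_measurable_integrable by fastforce
  \<comment> \<open>Writing the original integrand as a one-point modification of \<open>W\<close>
    also supplies its measurability.\<close>
  have eq: "(\<lambda>s. indicator {0..t} s *\<^sub>R oseen_conv (t - s) (F s) x) =
      (\<lambda>s. if s = t then indicator {0..t} t *\<^sub>R oseen_conv 0 (F t) x else indicator {0..t} s *\<^sub>R W s)"
  proof (rule ext)
    fix s
    show "indicator {0..t} s *\<^sub>R oseen_conv (t - s) (F s) x =
      (if s = t then indicator {0..t} t *\<^sub>R oseen_conv 0 (F t) x else indicator {0..t} s *\<^sub>R W s)"
      using VW[of s] by (cases "s \<in> {0..t}") auto
  qed
  have "(LINT s:{0..t}|lebesgue. oseen_conv (t - s) (F s) x) = (LINT s|lebesgue. indicator {0..t} s *\<^sub>R W s)"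
    unfolding set_lebesgue_integral_def eq
  proof (rule integral_cong_AE)
    show "(\<lambda>s. indicator {0..t} s *\<^sub>R W s) \<in> borel_measurable lebesgue"
      using m by (intro measurable_completion) simp
    have "(\<lambda>s. if s = t then indicator {0..t} t *\<^sub>R oseen_conv 0 (F t) x else indicator {0..t} s *\<^sub>R W s) \<in> borel_measurable borel"
      using m by measurable
    then show "(\<lambda>s. if s = t then indicator {0..t} t *\<^sub>R oseen_conv 0 (F t) x else indicator {0..t} s *\<^sub>R W s) \<in> borel_measurable lebesgue"
      by (intro measurable_completion) simp
    have "AE s in lebesgue. s \<noteq> t"
      using AE_lborel_singleton[of t] by (rule AE_completion)
    then show "AE s in lebesgue. (if s = t then indicator {0..t} t *\<^sub>R oseen_conv 0 (F t) x else indicator {0..t} s *\<^sub>R W s)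
        = indicator {0..t} s *\<^sub>R W s"
      by eventually_elim simp
  qed
  then have "(LINT s:{0..t}|lebesgue. oseen_conv (t - s) (F s) x) $ i = (\<integral>s. (indicator {0..t} s *\<^sub>R W s) $ i \<partial>lborel)"
    by (simp only: vec_lebesgue_integral_component[OF int])
  also have "\<dots> = velocity i t x"
    using lborel_integral_interval[OF oseen_rate_integral(1)[OF t, of i x]] oseen_rate_integral(2)[OF t, of i x]
    by (simp add: W_def)
  finally show ?thesis .
qed

end

section \<open>Spatial decay of the forcing velocity\<close>

text \<open>Since \<open>u e\<^bsup>-u/4\<^esup> \<le> 8 e\<^bsup>-u/8\<^esup>\<close>, the derivative of \<open>P(\<cdot>, 1)\<close> is controlled by
  \<open>P(z, 2) / |z| \<le> 1 / (4 \<pi> |z|\<^sup>2)\<close>.\<close>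
lemma oseen_P_partial_decay:
  obtains C where "C \<ge> 0" "\<And>z. (1 + (norm z)\<^sup>2) * \<bar>oseen_P_partial j 1 z\<bar> \<le> C"
proof -
  define c where "c = 1 / (4 * pi powr (3/2) * sqrt 1)"
  have c: "c \<ge> 0" by (simp add: c_def)
  have P1: "oseen_P_partial j 1 z = c * integral {0..1} (\<lambda>\<theta>. - (\<theta>\<^sup>2 * z $ j / 2) * exp (- (\<theta>\<^sup>2 * (norm z)\<^sup>2 / 4)))" for z
    by (simp add: oseen_P_partial_def c_def)
  have cont: "continuous_on {0..1} (\<lambda>\<theta>. - (\<theta>\<^sup>2 * z $ j / 2) * exp (- (\<theta>\<^sup>2 * (norm z)\<^sup>2 / 4)))" for z :: "real^3"
    by (intro continuous_intros) auto
  have small: "\<bar>oseen_P_partial j 1 z\<bar> \<le> c * norm z" for z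
  proof -
    have "norm (integral {0..1} (\<lambda>\<theta>. - (\<theta>\<^sup>2 * z $ j / 2) * exp (- (\<theta>\<^sup>2 * (norm z)\<^sup>2 / 4)))) \<le> integral {0..1} (\<lambda>\<theta>::real. norm z)"
    proof (rule integral_norm_bound_integral)
      fix \<theta> :: real assume \<theta>: "\<theta> \<in> {0..1}"
      have "\<bar>\<theta>\<^sup>2 * z $ j / 2\<bar> * exp (- (\<theta>\<^sup>2 * (norm z)\<^sup>2 / 4)) \<le> norm z * 1"
      proof (rule mult_mono)
        have "\<theta>\<^sup>2 \<le> 1" using \<theta> by (simp add: power_le_one)
        then have "\<theta>\<^sup>2 * \<bar>z $ j\<bar> \<le> 1 * norm z" by (intro mult_mono component_le_norm_cart) auto
        moreover have "\<bar>\<theta>\<^sup>2 * z $ j / 2\<bar> = \<theta>\<^sup>2 * \<bar>z $ j\<bar> / 2" by (simp add: abs_mult)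
        ultimately show "\<bar>\<theta>\<^sup>2 * z $ j / 2\<bar> \<le> norm z" using norm_ge_zero[of z] by linarith
      qed auto
      then show "norm (- (\<theta>\<^sup>2 * z $ j / 2) * exp (- (\<theta>\<^sup>2 * (norm z)\<^sup>2 / 4))) \<le> norm z" by (simp add: abs_mult)
    qed (use cont in \<open>auto intro: integrable_continuous_interval\<close>)
    from mult_left_mono[OF this c] show ?thesis unfolding P1 using c by (simp add: abs_mult)
  qed
  have large: "(norm z)\<^sup>2 * \<bar>oseen_P_partial j 1 z\<bar> \<le> 4 * sqrt 2" if z: "z \<noteq> 0" for z
  proof -
    have "norm (integral {0..1} (\<lambda>\<theta>. - (\<theta>\<^sup>2 * z $ j / 2) * exp (- (\<theta>\<^sup>2 * (norm z)\<^sup>2 / 4))))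
        \<le> integral {0..1} (\<lambda>\<theta>. 4 / norm z * exp (- (\<theta>\<^sup>2 * (norm z)\<^sup>2 / (4 * 2))))"
    proof (rule integral_norm_bound_integral)
      show "(\<lambda>\<theta>. 4 / norm z * exp (- (\<theta>\<^sup>2 * (norm z)\<^sup>2 / (4 * 2)))) integrable_on {0..1}"
        by (intro integrable_continuous_interval continuous_intros) auto
      fix \<theta> :: real assume \<theta>: "\<theta> \<in> {0..1}"
      let ?u = "\<theta>\<^sup>2 * (norm z)\<^sup>2"
      have "?u / 8 \<le> exp (?u / 8)" by (intro le_exp_of_ge_0) auto
      then have "?u * exp (- (?u / 4)) \<le> 8 * exp (?u / 8) * exp (- (?u / 4))" by (intro mult_right_mono) auto
      also have "\<dots> = 8 * exp (- (?u / 8))" by (simp add: exp_add[symmetric])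
      finally have u: "?u * exp (- (?u / 4)) \<le> 8 * exp (- (?u / 8))" .
      have "\<theta>\<^sup>2 * \<bar>z $ j\<bar> / 2 * exp (- (?u / 4)) \<le> \<theta>\<^sup>2 * norm z / 2 * exp (- (?u / 4))"
        by (intro mult_right_mono divide_right_mono mult_left_mono component_le_norm_cart) auto
      also have "\<dots> = (1 / (2 * norm z)) * (?u * exp (- (?u / 4)))"
        using z by (simp add: power2_eq_square field_simps)
      also have "\<dots> \<le> (1 / (2 * norm z)) * (8 * exp (- (?u / 8)))"
        using u by (intro mult_left_mono) auto
      also have "\<dots> = 4 / norm z * exp (- (?u / (4 * 2)))" using z by simp
      finally show "norm (- (\<theta>\<^sup>2 * z $ j / 2) * exp (- (?u / 4))) \<le> 4 / norm z * exp (- (?u / (4 * 2)))"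
        by (simp add: abs_mult)
    qed (use cont in \<open>auto intro: integrable_continuous_interval\<close>)
    from mult_left_mono[OF this c] have "\<bar>oseen_P_partial j 1 z\<bar> \<le> c * (4 / norm z * integral {0..1} (\<lambda>\<theta>. exp (- (\<theta>\<^sup>2 * (norm z)\<^sup>2 / (4 * 2)))))"
      unfolding P1 abs_mult abs_of_nonneg[OF c] by simp
    \<comment> \<open>The exponent was written over 4 * 2 in order to recognise P at time 2; the
      factor sqrt 2 undoes the prefactor 1 / sqrt t of P.\<close>
    also have "\<dots> = 4 / norm z * (sqrt 2 * oseen_P z 2)"
      by (simp add: oseen_P_eq c_def)
    also have "\<dots> \<le> 4 / norm z * (sqrt 2 * newton_kernel z)"
      using oseen_P_le_newton_kernel[OF z, of 2] by (intro mult_left_mono) auto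
    finally have "(norm z)\<^sup>2 * \<bar>oseen_P_partial j 1 z\<bar> \<le> (norm z)\<^sup>2 * (4 / norm z * (sqrt 2 * newton_kernel z))"
      by (intro mult_left_mono) auto
    also have "\<dots> = sqrt 2 / pi" using z by (simp add: newton_kernel_def power2_eq_square)
    also have "\<dots> \<le> 4 * sqrt 2" using pi_gt3 by (simp add: field_simps)
    finally show ?thesis .
  qed
  show ?thesis
  proof
    show "0 \<le> c + 2 * (4 * sqrt 2)" using c by simp
    fix z :: "real^3"
    show "(1 + (norm z)\<^sup>2) * \<bar>oseen_P_partial j 1 z\<bar> \<le> c + 2 * (4 * sqrt 2)"
    proof (cases "z = 0")
      case True
      then show ?thesis using small[of z] c by simp
    next
      case False
      have "\<bar>oseen_P_partial j 1 z\<bar> \<le> c + 4 * sqrt 2"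
      proof (cases "norm z \<le> 1")
        case True
        then have "c * norm z \<le> c" using c by (simp add: mult_left_le)
        then show ?thesis using small[of z] by (smt (verit) real_sqrt_ge_zero)
      next
        case nz: False
        then have "1 * \<bar>oseen_P_partial j 1 z\<bar> \<le> (norm z)\<^sup>2 * \<bar>oseen_P_partial j 1 z\<bar>"
          by (intro mult_right_mono) auto
        then show ?thesis using large[OF False] c by simp
      qed
      then show ?thesis using large[OF False] by (simp add: distrib_right)
    qed
  qed
qed

text \<open>The weight moves from \<open>x\<close> to the kernel: if |x - z| \<le> R, then 1 + |x|^2
  \<le> 2 (1 + R^2) (1 + |z|^2), an inequality of Peetre type.\<close>

lemma conv_decay:
  assumes K: "continuous_on UNIV K" "\<And>z. (1 + (norm z)\<^sup>2) * \<bar>K z\<bar> \<le> C"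
    and h: "h \<in> borel_measurable borel" "\<And>z. \<bar>h z\<bar> \<le> B" "\<And>z. R < norm z \<Longrightarrow> h z = 0"
  shows "(1 + (norm x)\<^sup>2) * \<bar>conv K h x\<bar> \<le> 2 * (1 + R\<^sup>2) * C * B * measure lborel (cball (0::real^3) R)"
proof -
  have B: "B \<ge> 0" using h(2)[of 0] by linarith
  have C: "C \<ge> 0" using order_trans[OF _ K(2)[of 0]] by simp
  note int = conv_integrable[OF locally_integrable_continuous[OF K(1)] h, where x = x]
  have fin: "integrable lborel (indicator (cball 0 R) :: real^3 \<Rightarrow> real)"
    using emeasure_bounded_finite[of "cball (0::real^3) R"] by (intro integrable_real_indicator) auto
  have fin': "integrable lborel (\<lambda>z. indicator (cball 0 R) (x - z) :: real)"
    using lborel_integrable_reflect[of "indicator (cball (0::real^3) R) :: _ \<Rightarrow> real" x] fin by simp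
  have "(1 + (norm x)\<^sup>2) * \<bar>conv K h x\<bar> \<le> (1 + (norm x)\<^sup>2) * (\<integral>z. \<bar>K z * h (x - z)\<bar> \<partial>lborel)"
    unfolding conv_def by (intro mult_left_mono integral_abs_bound) auto
  also have "\<dots> = (\<integral>z. (1 + (norm x)\<^sup>2) * \<bar>K z * h (x - z)\<bar> \<partial>lborel)" by simp
  also have "\<dots> \<le> (\<integral>z. 2 * (1 + R\<^sup>2) * C * B * indicator (cball 0 R) (x - z) \<partial>lborel)"
  proof (rule integral_mono)
    show "integrable lborel (\<lambda>z. (1 + (norm x)\<^sup>2) * \<bar>K z * h (x - z)\<bar>)"
      using int by (intro integrable_mult_right integrable_abs)
    show "integrable lborel (\<lambda>z. 2 * (1 + R\<^sup>2) * C * B * indicator (cball 0 R) (x - z) :: real)"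
      using fin' by (intro integrable_mult_right)
    fix z :: "real^3"
    show "(1 + (norm x)\<^sup>2) * \<bar>K z * h (x - z)\<bar> \<le> 2 * (1 + R\<^sup>2) * C * B * indicator (cball 0 R) (x - z)"
    proof (cases "norm (x - z) \<le> R")
      case True
      have "(norm x)\<^sup>2 \<le> 2 * (norm (x - z))\<^sup>2 + 2 * (norm z)\<^sup>2"
        using norm_sq_triangle[of "x - z" z] by simp
      also have "(norm (x - z))\<^sup>2 \<le> R\<^sup>2" using True by (intro power_mono) auto
      finally have nx: "(norm x)\<^sup>2 \<le> 2 * R\<^sup>2 + 2 * (norm z)\<^sup>2" by simp
      have x: "1 + (norm x)\<^sup>2 \<le> 2 * (1 + R\<^sup>2) * (1 + (norm z)\<^sup>2)"
      proof -
        have "2 * (1 + R\<^sup>2) * (1 + (norm z)\<^sup>2) = 2 + 2 * R\<^sup>2 + 2 * (norm z)\<^sup>2 + 2 * (R\<^sup>2 * (norm z)\<^sup>2)"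
          by (simp add: algebra_simps)
        moreover have "0 \<le> R\<^sup>2 * (norm z)\<^sup>2" by simp
        ultimately show ?thesis using nx by linarith
      qed
      have "(1 + (norm x)\<^sup>2) * \<bar>K z * h (x - z)\<bar> = ((1 + (norm x)\<^sup>2) * \<bar>K z\<bar>) * \<bar>h (x - z)\<bar>"
        by (simp add: abs_mult)
      also have "\<dots> \<le> ((2 * (1 + R\<^sup>2) * (1 + (norm z)\<^sup>2)) * \<bar>K z\<bar>) * B"
        using x h(2) by (intro mult_mono) auto
      also have "\<dots> = 2 * (1 + R\<^sup>2) * B * ((1 + (norm z)\<^sup>2) * \<bar>K z\<bar>)" by (simp add: mult_ac)
      also have "\<dots> \<le> 2 * (1 + R\<^sup>2) * B * C"
        using B by (intro mult_left_mono K) auto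
      finally show ?thesis using True by (simp add: mult_ac)
    next
      case False
      then show ?thesis using h(3) B C by simp
    qed
  qed
  also have "\<dots> = 2 * (1 + R\<^sup>2) * C * B * (\<integral>z. indicator (cball 0 R) (x - z) \<partial>lborel)" by simp
  also have "(\<integral>z. indicator (cball 0 R) (x - z) \<partial>lborel) = measure lborel (cball (0::real^3) R)"
    by (subst lborel_integral_reflect) (simp_all add: borel_measurable_indicator)
  finally show ?thesis .
qed

context stokes_forcing
begin

lemma gauss_avg_decay_uniform:
  assumes g: "continuous_source T R g" and T': "T' < T"
  obtains C where "C \<ge> 0" "\<And>r s x. r \<in> {0..b} \<Longrightarrow> s \<in> {0..T'} \<Longrightarrow> (1 + (norm x)\<^sup>2) * \<bar>gauss_avg r (g s) x\<bar> \<le> C"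
proof -
  obtain B where B: "B \<ge> 0" "\<And>t x. t \<in> {0..T'} \<Longrightarrow> \<bar>g t x\<bar> \<le> B"
    by (rule continuous_source_bounded[OF g T'], rule that)
  show ?thesis
  proof
    show "B * (1 + 2 * R\<^sup>2 + 2 * \<bar>b\<bar> * heat_second_moment) \<ge> 0"
      using B(1) heat_second_moment_nonneg by simp
    fix r s and x :: "real^3" assume r: "r \<in> {0..b}" and s: "s \<in> {0..T'}"
    then have sT: "s \<in> {0..<T}" using T' by auto
    have "(1 + (norm x)\<^sup>2) * \<bar>gauss_avg r (g s) x\<bar> \<le> B * (1 + 2 * R\<^sup>2 + 2 * r * heat_second_moment)"
    proof (rule gauss_avg_decay)
      show "g s \<in> borel_measurable borel"
        using g sT borel_measurable_continuous_family by (auto simp: continuous_source_def)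
      show "g s z = 0" if "R < norm z" for z using g sT that by (auto simp: continuous_source_def)
    qed (use B s r in auto)
    also have "\<dots> \<le> B * (1 + 2 * R\<^sup>2 + 2 * \<bar>b\<bar> * heat_second_moment)"
      using B(1) r heat_second_moment_nonneg by (intro mult_left_mono add_left_mono mult_right_mono) auto
    finally show "(1 + (norm x)\<^sup>2) * \<bar>gauss_avg r (g s) x\<bar> \<le> B * (1 + 2 * R\<^sup>2 + 2 * \<bar>b\<bar> * heat_second_moment)" .
  qed
qed

lemma integral_decay:
  assumes "continuous_on {0..a} \<phi>" "a \<ge> 0" "\<And>r. r \<in> {0..a} \<Longrightarrow> w * \<bar>\<phi> r\<bar> \<le> C" "w \<ge> 0"
  shows "w * \<bar>integral {0..a} \<phi>\<bar> \<le> a * (C::real)"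
proof -
  have "norm (integral {0..a} (\<lambda>r. w * \<phi> r)) \<le> integral {0..a} (\<lambda>r. C)"
    by (rule integral_norm_bound_integral)
      (use assms in \<open>auto simp: abs_mult intro!: integrable_continuous_interval continuous_intros\<close>)
  then show ?thesis using assms by (simp add: abs_mult)
qed

text \<open>The Newtonian term is the critical one. It is split at time 1, and one derivative is
  moved from the source to P(.,1), whose derivative decays like |x|^-2 although P(.,1) itself decays
  only like |x|^-1. The other terms are Gaussian averages of compactly supported functions.\<close>

lemma velocity_rate_decay:
  assumes T': "T' < T"
  obtains C where "C \<ge> 0" "\<And>t x. t \<in> {0..T'} \<Longrightarrow> (1 + (norm x)\<^sup>2) * \<bar>velocity_rate i t x\<bar> \<le> C"
proof -
  note c = smooth_source_imp_continuous_source
  note dv = smooth_source_div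
  \<comment> \<open>For b = 0 the average is the source itself.\<close>
  obtain C1 where C1: "C1 \<ge> 0" "\<And>r s x. r \<in> {0..0} \<Longrightarrow> s \<in> {0..T'} \<Longrightarrow> (1 + (norm x)\<^sup>2) * \<bar>gauss_avg r (f i s) x\<bar> \<le> C1"
    by (rule gauss_avg_decay_uniform[OF c[OF source[of i]] T', where b = 0], rule that)
  obtain C2 where C2: "C2 \<ge> 0" "\<And>r s x. r \<in> {0..T'} \<Longrightarrow> s \<in> {0..T'} \<Longrightarrow> (1 + (norm x)\<^sup>2) * \<bar>gauss_avg r (heat_source i s) x\<bar> \<le> C2"
    by (rule gauss_avg_decay_uniform[OF c[OF smooth_heat_source[of i]] T', where b = T'], rule that)
  obtain C3 where C3: "C3 \<ge> 0" "\<And>r s x. r \<in> {0..1} \<Longrightarrow> s \<in> {0..T'} \<Longrightarrow> (1 + (norm x)\<^sup>2) * \<bar>gauss_avg r (partial i (source_div s)) x\<bar> \<le> C3"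
    by (rule gauss_avg_decay_uniform[OF c[OF smooth_source_partial(1)[OF dv, of i]] T', where b = 1], rule that)
  obtain C4 where C4: "C4 \<ge> 0" "\<And>z. (1 + (norm z)\<^sup>2) * \<bar>oseen_P_partial i 1 z\<bar> \<le> C4"
    by (rule oseen_P_partial_decay[of i], rule that)
  obtain B where B: "B \<ge> 0" "\<And>t x. t \<in> {0..T'} \<Longrightarrow> \<bar>source_div t x\<bar> \<le> B"
    by (rule continuous_source_bounded[OF c[OF dv] T'], rule that)
  define C5 where "C5 = 2 * (1 + R\<^sup>2) * C4 * B * measure lborel (cball (0::real^3) R)"
  have C5: "C5 \<ge> 0" using C4(1) B(1) by (simp add: C5_def)
  show ?thesis
  proof
    show "C1 + (C5 + C3) + \<bar>T'\<bar> * C2 \<ge> 0" using C1 C2 C3 C5 by simp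
    fix t and x :: "real^3" assume t: "t \<in> {0..T'}"
    then have tT: "t \<in> {0..<T}" using T' by auto
    let ?w = "1 + (norm x)\<^sup>2"
    have w: "?w \<ge> 0" by simp
    have a: "?w * \<bar>f i t x\<bar> \<le> C1" using C1(2)[of 0 t x] t by simp
    have "conv newton_kernel (partial i (source_div t)) x = conv (oseen_P_partial i 1) (source_div t) x
        + integral {0..1} (\<lambda>\<rho>. gauss_avg \<rho> (partial i (source_div t)) x)"
      using newton_potential_split[OF c[OF smooth_source_partial(1)[OF dv, of i]] tT, of 1 x]
        conv_oseen_P_partial2(2)[OF dv tT, of 1 i x] by simp
    moreover have "?w * \<bar>conv (oseen_P_partial i 1) (source_div t) x\<bar> \<le> C5"
      unfolding C5_def
    proof (rule conv_decay[OF continuous_on_oseen_P_partial C4(2)])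
      show "source_div t \<in> borel_measurable borel"
        using smooth_source_imp_continuous_family[OF dv] tT by (rule borel_measurable_continuous_family)
      show "source_div t z = 0" if "R < norm z" for z using dv tT that by (auto simp: smooth_source_def)
    qed (use B t in auto)
    moreover have "?w * \<bar>integral {0..1} (\<lambda>\<rho>. gauss_avg \<rho> (partial i (source_div t)) x)\<bar> \<le> 1 * C3"
      using C3(2) t tT by (intro integral_decay continuous_on_gauss_avg_time[OF c[OF smooth_source_partial(1)[OF dv, of i]]] w) auto
    moreover have "?w * \<bar>p + q\<bar> \<le> ?w * \<bar>p\<bar> + ?w * \<bar>q\<bar>" for p q
      unfolding distrib_left[symmetric] using w by (intro mult_left_mono abs_triangle_ineq)
    ultimately have b: "?w * \<bar>conv newton_kernel (partial i (source_div t)) x\<bar> \<le> C5 + C3"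
      by (smt (verit))
    have "?w * \<bar>duhamel (heat_source i) t x\<bar> \<le> t * C2"
      unfolding duhamel_def
    proof (rule integral_decay)
      show "continuous_on {0..t} (\<lambda>s. gauss_avg (t - s) (heat_source i s) x)"
        by (rule continuous_on_gauss_avg_compose[OF c[OF smooth_heat_source]]) (use tT in \<open>auto intro!: continuous_intros\<close>)
    qed (use C2(2) t w in auto)
    also have "\<dots> \<le> \<bar>T'\<bar> * C2" using t C2(1) by (intro mult_right_mono) auto
    finally have d: "?w * \<bar>duhamel (heat_source i) t x\<bar> \<le> \<bar>T'\<bar> * C2" .
    have "?w * \<bar>p + q + r\<bar> \<le> ?w * \<bar>p\<bar> + ?w * \<bar>q\<bar> + ?w * \<bar>r\<bar>" for p q r
      unfolding distrib_left[symmetric] using w by (intro mult_left_mono) auto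
    from order_trans[OF this add_mono[OF add_mono[OF a b] d]]
    show "?w * \<bar>velocity_rate i t x\<bar> \<le> C1 + (C5 + C3) + \<bar>T'\<bar> * C2"
      unfolding velocity_rate_def rate_def .
  qed
qed

end

section \<open>Compactly supported test functions\<close>

text \<open>For m = 0 the classical smooth function exp (-1/z) on z > 0, continued by 0. The powers
  of 1/z make the family closed under differentiation up to linear combinations.\<close>

definition bump :: "nat \<Rightarrow> real \<Rightarrow> real" where
  "bump m z = (if z > 0 then (1 / z) ^ m * exp (- (1 / z)) else 0)"

lemma bump_derivative: "(bump m has_real_derivative bump (m + 2) z - of_nat m * bump (m + 1) z) (at z)"
proof -
  consider "z > 0" | "z = 0" | "z < 0" by linarith
  then show ?thesis
  proof cases
    case 1
    have e: "((\<lambda>z. exp (- (1 / z))) has_real_derivative exp (- (1 / z)) * (1 / z)\<^sup>2) (at z)"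
      using 1 by (auto intro!: derivative_eq_intros simp: power2_eq_square)
    have p: "((\<lambda>z. (1 / z) ^ m) has_real_derivative - (of_nat m * (1 / z) ^ (m + 1))) (at z)"
    proof (cases m)
      case (Suc k)
      have "((\<lambda>z. (1 / z) ^ m) has_real_derivative of_nat m * (- (1 / z)\<^sup>2 * (1 / z) ^ (m - Suc 0))) (at z)"
        by (rule DERIV_power) (use 1 in \<open>auto intro!: derivative_eq_intros simp: power2_eq_square\<close>)
      then show ?thesis by (simp add: Suc power2_eq_square mult_ac)
    qed simp
    have "((\<lambda>z. (1 / z) ^ m * exp (- (1 / z))) has_real_derivative bump (m + 2) z - of_nat m * bump (m + 1) z) (at z)"
      using DERIV_mult[OF p e] 1 by (simp add: bump_def algebra_simps power_add power2_eq_square)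
    then show ?thesis
      by (rule has_field_derivative_transform_within[of _ _ _ _ z]) (use 1 in \<open>auto simp: bump_def dist_real_def\<close>)
  next
    case 2
    \<comment> \<open>The difference quotient at 0 costs one more power of 1/h, hence m + 1; the
      exponential absorbs every power.\<close>
    have "((\<lambda>h. (inverse h) ^ (m + 1) / exp (inverse h)) \<longlongrightarrow> 0) (at_right (0::real))"
      by (rule filterlim_compose[OF tendsto_power_div_exp_0 filterlim_inverse_at_top_right])
    then have "((\<lambda>h. bump m h / h) \<longlongrightarrow> 0) (at_right 0)"
    proof (rule Lim_transform_eventually)
      show "\<forall>\<^sub>F h in at_right 0. inverse h ^ (m + 1) / exp (inverse h) = bump m h / h"
        using eventually_at_right_less[of "0::real"]
        by eventually_elim (simp add: bump_def exp_minus divide_inverse power_inverse)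
    qed
    moreover have "((\<lambda>h. bump m h / h) \<longlongrightarrow> 0) (at_left 0)"
    proof (rule tendsto_eventually)
      show "\<forall>\<^sub>F h in at_left 0. bump m h / h = 0"
        unfolding eventually_at_left_field by (intro exI[of _ "-1"]) (auto simp: bump_def)
    qed
    ultimately have "((\<lambda>h. bump m h / h) \<longlongrightarrow> 0) (at 0)" by (simp add: filterlim_split_at)
    then show ?thesis unfolding 2 has_field_derivative_iff by (simp add: bump_def)
  next
    case 3
    have "((\<lambda>z. 0) has_real_derivative bump (m + 2) z - of_nat m * bump (m + 1) z) (at z)"
      using 3 by (simp add: bump_def)
    then show ?thesis
      by (rule has_field_derivative_transform_within[of _ _ _ _ "- z"]) (use 3 in \<open>auto simp: bump_def dist_real_def\<close>)
  qed
qed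

lemma bump_0_bounds: "0 \<le> bump 0 z" "bump 0 z \<le> 1"
  by (auto simp: bump_def)

lemma bump_2_bounds: "0 \<le> bump 2 z" "bump 2 z \<le> 2"
proof -
  show "0 \<le> bump 2 z" by (simp add: bump_def)
  show "bump 2 z \<le> 2"
  proof (cases "z > 0")
    case True
    then have "(1 / z)\<^sup>2 * exp (- (1 / z)) \<le> 2 * exp (1 / z) * exp (- (1 / z))"
      by (intro mult_right_mono power2_le_exp) auto
    also have "\<dots> = 2" by (simp add: exp_minus)
    finally show ?thesis using True by (simp add: bump_def)
  qed (simp add: bump_def)
qed

text \<open>A class containing Gaussian times cut-off whose directional derivatives lie in the class
  again, so that smoothness follows by induction on the order. The centre \<open>x\<close> and the
  coefficients \<open>a\<close>, \<open>b\<close> stay fixed under differentiation.\<close>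

inductive bump_class :: "'a::euclidean_space \<Rightarrow> real \<Rightarrow> real \<Rightarrow> ('a \<Rightarrow> real) \<Rightarrow> bool" for x a b where
  const: "bump_class x a b (\<lambda>y. c)"
| inner: "bump_class x a b (\<lambda>y. y \<bullet> w)"
| exp: "bump_class x a b (\<lambda>y. exp (a * (norm (x - y))\<^sup>2))"
| bump: "bump_class x a b (\<lambda>y. bump m (1 - b * (norm (x - y))\<^sup>2))"
| add: "bump_class x a b f \<Longrightarrow> bump_class x a b g \<Longrightarrow> bump_class x a b (\<lambda>y. f y + g y)"
| mult: "bump_class x a b f \<Longrightarrow> bump_class x a b g \<Longrightarrow> bump_class x a b (\<lambda>y. f y * g y)"

lemma norm_sq_has_derivative:
  "((\<lambda>y. (norm (x - y))\<^sup>2) has_derivative (\<lambda>v. 2 * (y \<bullet> v) + (- 2) * (x \<bullet> v))) (at (y::'a::euclidean_space))"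
proof -
  have "((\<lambda>y. (x - y) \<bullet> (x - y)) has_derivative (\<lambda>v. (x - y) \<bullet> (- v) + (- v) \<bullet> (x - y))) (at y)"
    by (auto intro!: derivative_eq_intros)
  moreover have "(\<lambda>v. (x - y) \<bullet> (- v) + (- v) \<bullet> (x - y)) = (\<lambda>v. 2 * (y \<bullet> v) + (- 2) * (x \<bullet> v))"
    by (auto simp: inner_diff_left inner_diff_right inner_commute algebra_simps)
  ultimately show ?thesis by (simp add: power2_norm_eq_inner)
qed

lemma bump_class_derivative:
  assumes "bump_class x a b f"
  shows "\<exists>f'. (\<forall>y. (f has_derivative f' y) (at y)) \<and> (\<forall>v. bump_class x a b (\<lambda>y. f' y v))"
  using assms
proof induction
  case (const c)
  show ?case by (rule exI[of _ "\<lambda>y v. 0"]) (auto intro: bump_class.const)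
next
  case (inner w)
  have "((\<lambda>y. y \<bullet> w) has_derivative (\<lambda>v. v \<bullet> w)) (at y)" for y :: 'a
    by (intro bounded_linear_imp_has_derivative bounded_linear_inner_left)
  then show ?case by (intro exI[of _ "\<lambda>y v. v \<bullet> w"]) (auto intro: bump_class.const)
next
  case exp
  let ?q = "\<lambda>y v. 2 * (y \<bullet> v) + (- 2) * (x \<bullet> v)"
  have "((\<lambda>y. exp (a * (norm (x - y))\<^sup>2)) has_derivative (\<lambda>v. exp (a * (norm (x - y))\<^sup>2) * (a * ?q y v))) (at y)" for y
    using has_derivative_exp[OF has_derivative_mult_right[OF norm_sq_has_derivative, of a x y]] by (simp add: mult.commute)
  moreover have "bump_class x a b (\<lambda>y. exp (a * (norm (x - y))\<^sup>2) * (a * ?q y v))" for v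
    by (intro bump_class.mult bump_class.add bump_class.const bump_class.inner bump_class.exp)
  ultimately show ?case by (intro exI[of _ "\<lambda>y v. exp (a * (norm (x - y))\<^sup>2) * (a * ?q y v)"] conjI allI)
next
  case (bump m)
  let ?q = "\<lambda>y v. 2 * (y \<bullet> v) + (- 2) * (x \<bullet> v)"
  let ?z = "\<lambda>y. 1 - b * (norm (x - y))\<^sup>2"
  have "((\<lambda>y. bump m (?z y)) has_derivative (\<lambda>v. (bump (m + 2) (?z y) + - of_nat m * bump (m + 1) (?z y)) * (- b * ?q y v))) (at y)" for y
  proof -
    have "(?z has_derivative (\<lambda>v. - b * ?q y v)) (at y)"
      using has_derivative_diff[OF has_derivative_const has_derivative_mult_right[OF norm_sq_has_derivative, of b x y], of 1] by simp
    from has_derivative_compose[OF this bump_derivative[unfolded has_field_derivative_def]]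
    show ?thesis by simp
  qed
  moreover have "bump_class x a b (\<lambda>y. (bump (m + 2) (?z y) + - of_nat m * bump (m + 1) (?z y)) * (- b * ?q y v))" for v
    by (intro bump_class.mult bump_class.add bump_class.const bump_class.inner bump_class.bump)
  ultimately show ?case
    by (intro exI[of _ "\<lambda>y v. (bump (m + 2) (?z y) + - of_nat m * bump (m + 1) (?z y)) * (- b * ?q y v)"] conjI allI)
next
  case (add f g)
  then obtain f' g' where "\<And>y. (f has_derivative f' y) (at y)" "\<And>v. bump_class x a b (\<lambda>y. f' y v)"
    "\<And>y. (g has_derivative g' y) (at y)" "\<And>v. bump_class x a b (\<lambda>y. g' y v)" by metis
  then show ?case
    by (intro exI[of _ "\<lambda>y v. f' y v + g' y v"] conjI allI has_derivative_add bump_class.add)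
next
  case (mult f g)
  then obtain f' g' where "\<And>y. (f has_derivative f' y) (at y)" "\<And>v. bump_class x a b (\<lambda>y. f' y v)"
    "\<And>y. (g has_derivative g' y) (at y)" "\<And>v. bump_class x a b (\<lambda>y. g' y v)" by metis
  with mult.hyps show ?case
    by (intro exI[of _ "\<lambda>y v. f y * g' y v + f' y v * g y"] conjI allI has_derivative_mult bump_class.add bump_class.mult)
qed

lemma bump_class_smooth:
  assumes "bump_class x a b f"
  shows "smooth_on UNIV f"
proof -
  have "C_on k UNIV f" if "bump_class x a b f" for k f
    using that
  proof (induction k arbitrary: f)
    case 0
    then obtain f' where "\<And>y. (f has_derivative f' y) (at y)" using bump_class_derivative by metis
    then show ?case by (auto intro!: continuous_at_imp_continuous_on has_derivative_continuous)
  next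
    case (Suc k)
    then obtain f' where "\<And>y. (f has_derivative f' y) (at y)" "\<And>v. bump_class x a b (\<lambda>y. f' y v)"
      using bump_class_derivative by metis
    then show ?case using Suc.IH unfolding C_on.simps by (intro exI[of _ f']) auto
  qed
  then show ?thesis using assms by (simp add: smooth_on_def)
qed

section \<open>The heat flow of a divergence free field\<close>

lemma borel_measurable_component:
  fixes u :: "'a \<Rightarrow> real^3"
  assumes "u \<in> borel_measurable M"
  shows "(\<lambda>y. u y $ i) \<in> borel_measurable M"
proof -
  have "(\<lambda>z::real^3. z $ i) \<in> borel_measurable borel"
    by (intro borel_measurable_continuous_onI continuous_on_component continuous_on_id)
  from measurable_compose[OF assms this] show ?thesis .
qed

lemma borel_measurable_vec3:
  fixes w :: "3 \<Rightarrow> 'a \<Rightarrow> real"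
  assumes [measurable]: "\<And>i. w i \<in> borel_measurable M"
  shows "(\<lambda>y. \<chi> i. w i y) \<in> borel_measurable M"
proof -
  have "(\<lambda>y. \<chi> i. w i y) = (\<lambda>y. \<Sum>i\<in>UNIV. w i y *\<^sub>R axis i 1)"
  proof
    fix y show "(\<chi> i. w i y) = (\<Sum>i\<in>UNIV. w i y *\<^sub>R axis i 1)"
      using basis_expansion[of "\<chi> i. w i y"] by (simp add: scalar_mult_eq_scaleR)
  qed
  then show ?thesis by simp
qed

text \<open>Each component is measurable for the completed measure and therefore equals a Borel
  function almost everywhere; there are finitely many components, so one null set suffices.\<close>

lemma L2_borel_version:
  assumes "u \<in> L2"
  obtains v :: "3 \<Rightarrow> real^3 \<Rightarrow> real" where "\<And>i. square_integrable (v i)" "AE y in lebesgue. \<forall>i. u y $ i = v i y"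
proof -
  have m: "u \<in> borel_measurable lebesgue" and sq: "integrable lebesgue (\<lambda>x. (norm (u x))\<^sup>2)"
    using assms by (auto simp: L2_def)
  have mi: "(\<lambda>y. u y $ i) \<in> borel_measurable lebesgue" for i using m by (rule borel_measurable_component)
  then have "\<exists>w\<in>borel_measurable lborel. AE y in lborel. u y $ i = w y" for i
    by (intro completion_ex_borel_measurable_real)
  then obtain v where v: "\<And>i. v i \<in> borel_measurable lborel" "\<And>i. AE y in lborel. u y $ i = v i y" by metis
  have ae: "AE y in lebesgue. u y $ i = v i y" for i using v(2) by (rule AE_completion)
  have "square_integrable (v i)" for i
  proof -
    have "integrable lebesgue (\<lambda>y. (v i y)\<^sup>2)"
    proof (rule Bochner_Integration.integrable_bound[OF sq])
      show "(\<lambda>y. (v i y)\<^sup>2) \<in> borel_measurable lebesgue"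
        using v(1) by (intro borel_measurable_power measurable_completion)
      show "AE y in lebesgue. norm ((v i y)\<^sup>2) \<le> norm ((norm (u y))\<^sup>2)"
        using ae[of i]
      proof eventually_elim
        case (elim y)
        have "\<bar>v i y\<bar> \<le> norm (u y)" using component_le_norm_cart[of "u y" i] elim by simp
        then show ?case by (simp add: abs_le_square_iff[symmetric])
      qed
    qed
    then have "integrable lborel (\<lambda>y. (v i y)\<^sup>2)" using v(1) by (simp add: integrable_completion)
    then show ?thesis using v(1) by (simp add: square_integrable_def)
  qed
  moreover have "AE y in lebesgue. \<forall>i. u y $ i = v i y"
    using ae by (simp add: AE_all_countable)
  ultimately show ?thesis by (rule that)
qed

lemma heat_conv_component:
  assumes u: "u \<in> borel_measurable lebesgue" and v: "\<And>i. square_integrable (v i)"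
    and ae: "AE y in lebesgue. \<forall>i. u y $ i = v i y" and t: "t > 0"
  shows "heat_conv t u x $ i = heat_flow t (v i) x"
proof -
  have [measurable]: "v i \<in> borel_measurable borel" for i using v by (simp add: square_integrable_def)
  have [measurable]: "(\<lambda>y. \<chi> i. heat_kernel (x - y) t * v i y) \<in> borel_measurable borel"
    by (intro borel_measurable_vec3) measurable
  have "heat_conv t u x = (LINT y|lebesgue. (\<chi> i. heat_kernel (x - y) t * v i y))"
    unfolding heat_conv_def using t
  proof (simp, intro integral_cong_AE)
    have "(\<lambda>y. heat_kernel (x - y) t) \<in> borel_measurable lebesgue"
      by (intro measurable_completion) simp
    then show "(\<lambda>y. heat_kernel (x - y) t *\<^sub>R u y) \<in> borel_measurable lebesgue" using u by measurable
    show "(\<lambda>y. \<chi> i. heat_kernel (x - y) t * v i y) \<in> borel_measurable lebesgue"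
      by (intro measurable_completion) simp
    show "AE y in lebesgue. heat_kernel (x - y) t *\<^sub>R u y = (\<chi> i. heat_kernel (x - y) t * v i y)"
      using ae by eventually_elim (simp add: vec_eq_iff)
  qed
  then show ?thesis
    using vec_lebesgue_integral_component[of "\<lambda>y. \<chi> i. heat_kernel (x - y) t * v i y" i]
      heat_type_integrable[OF heat_type_heat_kernel t v] by (simp add: heat_flow_def)
qed

lemma has_partial_reflect:
  assumes "has_partial i k k' (x - y)"
  shows "has_partial i (\<lambda>y. k (x - y)) (- k') y"
proof -
  have "((\<lambda>h. k (x - y + h *\<^sub>R axis i 1)) has_real_derivative k') (at (- 0))"
    using assms by (simp add: has_partial_def)
  from DERIV_chain'[OF DERIV_minus[OF DERIV_ident] this]
  show ?thesis by (simp add: has_partial_def algebra_simps)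
qed

text \<open>Test the weak divergence condition with the Gaussian times a cut-off at scale \<open>n\<close>.\<close>
lemma heat_flow_divergence_free:
  assumes u: "u \<in> H_space" and v: "\<And>i. square_integrable (v i)"
    and ae: "AE y in lebesgue. \<forall>i. u y $ i = v i y" and t: "t > 0"
  shows "(\<Sum>i\<in>UNIV. \<integral>y. heat_partial i t (x - y) * v i y \<partial>lborel) = 0"
proof -
  let ?b = "\<lambda>n::nat. 1 / (real (Suc n))\<^sup>2"
  let ?z = "\<lambda>n y. 1 - ?b n * (norm (x - y))\<^sup>2"
  define g where "g n y = heat_kernel (x - y) t * bump 0 (?z n y)" for n y
  \<comment> \<open>The derivative of \<open>bump 0\<close> is \<open>bump 2\<close> alone, since
    the other term carries the factor m = 0. The reflection y \<mapsto> x - y changes the sign of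
    the inner derivatives.\<close>
  define g' where "g' n i y = - heat_partial i t (x - y) * bump 0 (?z n y)
      + heat_kernel (x - y) t * (bump 2 (?z n y) * (2 * ?b n * (x - y) $ i))" for n i y
  have [measurable]: "v i \<in> borel_measurable borel" for i using v by (simp add: square_integrable_def)
  have pg: "has_partial i (g n) (g' n i y) y" for n i y
    unfolding g_def[abs_def] g'_def
  proof (rule has_partial_mult)
    show "has_partial i (\<lambda>y. heat_kernel (x - y) t) (- heat_partial i t (x - y)) y"
      by (rule has_partial_reflect[OF has_partial_heat_kernel])
    have "has_partial i (\<lambda>w. bump 0 (1 - ?b n * (norm w)\<^sup>2)) (bump 2 (?z n y) * (- (?b n * (2 * (x - y) $ i)))) (x - y)"
      unfolding has_partial_def
    proof (rule DERIV_chain'[where f = "\<lambda>h. 1 - ?b n * (norm (x - y + h *\<^sub>R axis i 1))\<^sup>2" and g = "bump 0"])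
      show "((\<lambda>h. 1 - ?b n * (norm (x - y + h *\<^sub>R axis i 1))\<^sup>2) has_real_derivative - (?b n * (2 * (x - y) $ i))) (at 0)"
      proof -
        have "((\<lambda>h. 1 - b * (norm (x - y + h *\<^sub>R axis i 1))\<^sup>2) has_real_derivative - (b * (2 * (x - y) $ i))) (at 0)" for b
          unfolding norm_sq_add_axis by (auto intro!: derivative_eq_intros)
        then show ?thesis .
      qed
      show "(bump 0 has_real_derivative bump 2 (?z n y)) (at (1 - ?b n * (norm (x - y + 0 *\<^sub>R axis i 1))\<^sup>2))"
        using bump_derivative[of 0 "?z n y"] by (simp add: numeral_2_eq_2)
    qed
    from has_partial_reflect[OF this]
    show "has_partial i (\<lambda>y. bump 0 (?z n y)) (bump 2 (?z n y) * (2 * ?b n * (x - y) $ i)) y"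
      by (simp add: mult_ac)
  qed
  have smooth: "smooth_on UNIV (g n)" for n
  proof -
    have "bump_class x (- 1 / (4 * t)) (?b n) (\<lambda>y. (4 * pi * t) powr (- 3 / 2) * exp (- 1 / (4 * t) * (norm (x - y))\<^sup>2) * bump 0 (?z n y))"
      by (intro bump_class.mult bump_class.const bump_class.exp bump_class.bump)
    moreover have "(\<lambda>y. (4 * pi * t) powr (- 3 / 2) * exp (- 1 / (4 * t) * (norm (x - y))\<^sup>2) * bump 0 (?z n y)) = g n"
      by (simp add: g_def[abs_def] heat_kernel_def)
    ultimately show ?thesis using bump_class_smooth by metis
  qed
  have supp: "compact (supp (g n))" for n
  proof -
    have "{y. g n y \<noteq> 0} \<subseteq> cball x (Suc n)"
    proof (clarsimp)
      fix y assume "g n y \<noteq> 0"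
      then have "?z n y > 0" by (auto simp: g_def bump_def split: if_splits)
      then have "(norm (x - y))\<^sup>2 < (real (Suc n))\<^sup>2" by (simp add: divide_simps split: if_splits)
      then have "norm (x - y) < real (Suc n)" by (rule power2_less_imp_less) simp
      then show "dist x y \<le> 1 + real n" by (simp add: dist_norm)
    qed
    then have "bounded {y. g n y \<noteq> 0}" by (rule bounded_subset[OF bounded_cball])
    then show ?thesis by (simp add: supp_def compact_closure)
  qed
  have mg: "(\<lambda>y. g' n i y) \<in> borel_measurable borel" for n i
  proof -
    have [measurable]: "heat_partial i t \<in> borel_measurable borel"
      by (rule heat_type_slice(2)[OF heat_type_heat_partial t])
    have [measurable]: "(\<lambda>y. (x - y) $ i) \<in> borel_measurable borel"
      by (intro borel_measurable_component) measurable
    have [measurable]: "bump m \<in> borel_measurable borel" for m unfolding bump_def[abs_def] by measurable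
    show ?thesis unfolding g'_def by measurable
  qed
  define H where "H z = (1 + (norm z)\<^sup>2) * heat_kernel z t" for z
  have hH: "heat_type (\<lambda>t z. (1 + (norm z)\<^sup>2) * heat_kernel z t)"
    by (rule heat_type_multiple) (auto simp: case_prod_unfold intro!: continuous_intros exI[of _ 1])
  \<comment> \<open>The 4 bounds the derivative of the cut-off uniformly in \<open>n\<close>:
    \<open>bump 2\<close> is at most 2, the scale \<open>2 * ?b n\<close> at most 2, and |z_i| at
    most 1 + |z|^2, which is absorbed in \<open>H\<close>.\<close>
  define W where "W y = (\<Sum>i\<in>UNIV. \<bar>heat_partial i t (x - y) * v i y\<bar> + 4 * \<bar>H (x - y) * v i y\<bar>)" for y
  have intW: "integrable lborel W"
    unfolding W_def H_def
    by (intro Bochner_Integration.integrable_sum Bochner_Integration.integrable_add integrable_mult_right integrable_abs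
        heat_type_integrable[OF heat_type_heat_partial t v] heat_type_integrable[OF hH t v])
  have zero: "(\<integral>y. (\<Sum>i\<in>UNIV. v i y * g' n i y) \<partial>lborel) = 0" for n
  proof -
    have "(LINT y|lebesgue. u y \<bullet> grad (g n) y) = 0"
      using u smooth supp by (auto simp: H_space_def)
    moreover have "(LINT y|lebesgue. u y \<bullet> grad (g n) y) = (LINT y|lebesgue. (\<Sum>i\<in>UNIV. v i y * g' n i y))"
    proof (rule integral_cong_AE)
      have eq: "u y \<bullet> grad (g n) y = (\<Sum>i\<in>UNIV. u y $ i * g' n i y)" for y
        by (simp add: inner_vec_def grad_def has_partial_imp_partial[OF pg])
      have [measurable]: "u \<in> borel_measurable lebesgue" using u by (auto simp: H_space_def L2_def)
      have mg': "(\<lambda>y. g' n i y) \<in> borel_measurable lebesgue" for i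
        using mg by (intro measurable_completion) simp
      show "(\<lambda>y. u y \<bullet> grad (g n) y) \<in> borel_measurable lebesgue"
        unfolding eq using mg' borel_measurable_component[OF \<open>u \<in> borel_measurable lebesgue\<close>] by measurable
      have mv: "v i \<in> borel_measurable lebesgue" for i by (intro measurable_completion) simp
      show "(\<lambda>y. \<Sum>i\<in>UNIV. v i y * g' n i y) \<in> borel_measurable lebesgue"
        using mg' mv by measurable
      show "AE y in lebesgue. u y \<bullet> grad (g n) y = (\<Sum>i\<in>UNIV. v i y * g' n i y)"
        using ae by eventually_elim (simp add: eq)
    qed
    moreover have "(LINT y|lebesgue. (\<Sum>i\<in>UNIV. v i y * g' n i y)) = (\<integral>y. (\<Sum>i\<in>UNIV. v i y * g' n i y) \<partial>lborel)"
      using mg by (intro integral_completion) measurable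
    ultimately show ?thesis by simp
  qed
  \<comment> \<open>The cut-off tends to \<open>bump 0 1 = exp (- 1)\<close> rather than to 1, and
    the term with its derivative vanishes. The nonzero constant can be divided out at the
    end.\<close>
  have "(\<lambda>n. \<integral>y. (\<Sum>i\<in>UNIV. v i y * g' n i y) \<partial>lborel) \<longlonglongrightarrow> (\<integral>y. (\<Sum>i\<in>UNIV. v i y * (- heat_partial i t (x - y) * exp (- 1))) \<partial>lborel)"
  proof (rule integral_dominated_convergence[where w = W])
    show "(\<lambda>y. \<Sum>i\<in>UNIV. v i y * (- heat_partial i t (x - y) * exp (- 1))) \<in> borel_measurable lborel"
      using heat_type_slice(2)[OF heat_type_heat_partial t] by measurable
    show "(\<lambda>y. \<Sum>i\<in>UNIV. v i y * g' n i y) \<in> borel_measurable lborel" for n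
      using mg by measurable
    show "AE y in lborel. (\<lambda>n. \<Sum>i\<in>UNIV. v i y * g' n i y) \<longlonglongrightarrow> (\<Sum>i\<in>UNIV. v i y * (- heat_partial i t (x - y) * exp (- 1)))"
    proof (rule AE_I2)
      fix y :: "real^3"
      have b: "?b \<longlonglongrightarrow> 0" by real_asymp
      then have "(\<lambda>n. ?z n y) \<longlonglongrightarrow> 1 - 0 * (norm (x - y))\<^sup>2" by (intro tendsto_intros)
      then have z: "(\<lambda>n. ?z n y) \<longlonglongrightarrow> 1" by simp
      have lb: "(\<lambda>n. bump m (?z n y)) \<longlonglongrightarrow> exp (- 1)" for m
        using isCont_tendsto_compose[OF DERIV_isCont[OF bump_derivative] z, of m] by (simp add: bump_def)
      have "(\<lambda>n. v i y * g' n i y) \<longlonglongrightarrow> v i y * (- heat_partial i t (x - y) * exp (- 1)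
          + heat_kernel (x - y) t * (exp (- 1) * (2 * 0 * (x - y) $ i)))" for i
        unfolding g'_def by (intro tendsto_intros lb b)
      then have "(\<lambda>n. v i y * g' n i y) \<longlonglongrightarrow> v i y * (- heat_partial i t (x - y) * exp (- 1))" for i by simp
      then show "(\<lambda>n. \<Sum>i\<in>UNIV. v i y * g' n i y) \<longlonglongrightarrow> (\<Sum>i\<in>UNIV. v i y * (- heat_partial i t (x - y) * exp (- 1)))"
        by (rule tendsto_sum)
    qed
    show "AE y in lborel. norm (\<Sum>i\<in>UNIV. v i y * g' n i y) \<le> W y" for n
    proof (rule AE_I2)
      fix y :: "real^3"
      have "\<bar>v i y * g' n i y\<bar> \<le> \<bar>heat_partial i t (x - y) * v i y\<bar> + 4 * \<bar>H (x - y) * v i y\<bar>" for i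
      proof -
        have "\<bar>- heat_partial i t (x - y) * bump 0 (?z n y)\<bar> \<le> \<bar>heat_partial i t (x - y)\<bar>"
          using bump_0_bounds[of "?z n y"] by (simp add: abs_mult mult_left_le)
        moreover have "\<bar>heat_kernel (x - y) t * (bump 2 (?z n y) * (2 * ?b n * (x - y) $ i))\<bar> \<le> 4 * H (x - y)"
        proof -
          have "\<bar>bump 2 (?z n y) * (2 * ?b n * (x - y) $ i)\<bar> \<le> 2 * (2 * 1 * (1 + (norm (x - y))\<^sup>2))"
            unfolding abs_mult using bump_2_bounds[of "?z n y"]
            by (intro mult_mono component_le_norm_sq) (auto simp: divide_simps)
          note m = mult_left_mono[OF this heat_kernel_nonneg[of "x - y" t]]
          have "4 * H (x - y) = heat_kernel (x - y) t * (2 * (2 * 1 * (1 + (norm (x - y))\<^sup>2)))"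
            by (simp add: H_def)
          with m show ?thesis
            unfolding abs_mult[of "heat_kernel (x - y) t"] abs_of_nonneg[OF heat_kernel_nonneg] by simp
        qed
        ultimately have "\<bar>g' n i y\<bar> \<le> \<bar>heat_partial i t (x - y)\<bar> + 4 * H (x - y)"
          unfolding g'_def by linarith
        from mult_right_mono[OF this abs_ge_zero[of "v i y"]]
        have "\<bar>g' n i y\<bar> * \<bar>v i y\<bar> \<le> \<bar>heat_partial i t (x - y)\<bar> * \<bar>v i y\<bar> + 4 * (H (x - y) * \<bar>v i y\<bar>)"
          by (simp add: distrib_right)
        moreover have "\<bar>H (x - y) * v i y\<bar> = H (x - y) * \<bar>v i y\<bar>"
          by (simp add: abs_mult H_def heat_kernel_nonneg)
        ultimately show ?thesis by (simp only: abs_mult mult.commute)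
      qed
      then show "norm (\<Sum>i\<in>UNIV. v i y * g' n i y) \<le> W y"
        unfolding W_def real_norm_def by (intro order_trans[OF sum_abs] sum_mono)
    qed
  qed (rule intW)
  then have "(\<integral>y. (\<Sum>i\<in>UNIV. v i y * (- heat_partial i t (x - y) * exp (- 1))) \<partial>lborel) = 0"
    unfolding zero using LIMSEQ_unique tendsto_const by blast
  moreover have "(\<integral>y. (\<Sum>i\<in>UNIV. v i y * (- heat_partial i t (x - y) * exp (- 1))) \<partial>lborel)
      = (\<integral>y. - exp (- 1) * (\<Sum>i\<in>UNIV. heat_partial i t (x - y) * v i y) \<partial>lborel)"
    by (intro Bochner_Integration.integral_cong) (auto simp: sum_distrib_left mult_ac intro!: sum.cong)
  moreover have "\<dots> = - exp (- 1) * (\<Sum>i\<in>UNIV. \<integral>y. heat_partial i t (x - y) * v i y \<partial>lborel)"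
    by (simp add: heat_type_integrable[OF heat_type_heat_partial t v])
  ultimately show ?thesis by simp
qed

section \<open>Continuity in the mean square\<close>

text \<open>The squared norm of a scalar component. It is handled through (a + b)^2 \<le> 2 a^2 + 2
  b^2 in place of the triangle inequality of the norm.\<close>

definition mean_square :: "(real^3 \<Rightarrow> real) \<Rightarrow> real" where
  "mean_square f = (\<integral>x. (f x)\<^sup>2 \<partial>lborel)"

lemma mean_square_nonneg: "mean_square f \<ge> 0"
  by (simp add: mean_square_def)

lemma sum_sq_le: "(a + b)\<^sup>2 \<le> 2 * a\<^sup>2 + 2 * (b::real)\<^sup>2"
  using zero_le_power2[of "a - b"] by (simp add: power2_eq_square algebra_simps)

lemma square_integrable_bound:
  assumes "f \<in> borel_measurable borel" "integrable lborel w" "\<And>x. (f x)\<^sup>2 \<le> w x"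
  shows "square_integrable f"
  unfolding square_integrable_def
proof
  have [measurable]: "f \<in> borel_measurable borel" by fact
  show "integrable lborel (\<lambda>x. (f x)\<^sup>2)"
    by (rule Bochner_Integration.integrable_bound[OF assms(2)])
      (use assms(3) in \<open>auto intro!: AE_I2 order_trans[OF _ abs_ge_self]\<close>)
qed (rule assms(1))

lemma
  assumes f: "square_integrable f" and g: "square_integrable g"
  shows square_integrable_add: "square_integrable (\<lambda>x. f x + g x)"
    and mean_square_add: "mean_square (\<lambda>x. f x + g x) \<le> 2 * mean_square f + 2 * mean_square g"
proof -
  have [measurable]: "f \<in> borel_measurable borel" "g \<in> borel_measurable borel"
    using f g by (auto simp: square_integrable_def)
  have i: "integrable lborel (\<lambda>x. 2 * (f x)\<^sup>2 + 2 * (g x)\<^sup>2)"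
    using f g by (auto simp: square_integrable_def)
  show fg: "square_integrable (\<lambda>x. f x + g x)"
    by (rule square_integrable_bound[OF _ i]) (auto intro: sum_sq_le)
  have "mean_square (\<lambda>x. f x + g x) \<le> (\<integral>x. 2 * (f x)\<^sup>2 + 2 * (g x)\<^sup>2 \<partial>lborel)"
    unfolding mean_square_def using fg i by (intro integral_mono) (auto simp: square_integrable_def intro: sum_sq_le)
  then show "mean_square (\<lambda>x. f x + g x) \<le> 2 * mean_square f + 2 * mean_square g"
    using f g by (simp add: mean_square_def square_integrable_def)
qed

lemma square_integrable_uminus: "square_integrable f \<Longrightarrow> square_integrable (\<lambda>x. - f x)"
  by (auto simp: square_integrable_def)

lemma mean_square_uminus [simp]: "mean_square (\<lambda>x. - f x) = mean_square f"
  by (simp add: mean_square_def)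

lemma square_integrable_diff: "square_integrable f \<Longrightarrow> square_integrable g \<Longrightarrow> square_integrable (\<lambda>x. f x - g x)"
  using square_integrable_add[OF _ square_integrable_uminus, of f g] by simp

section \<open>Gaussian averages as contractions of L^2\<close>

lemma gauss_avg_L2_integrable:
  assumes v: "square_integrable v" and r: "r \<ge> 0"
  shows "integrable lborel (\<lambda>z. heat_kernel z 1 * v (x - sqrt r *\<^sub>R z))"
proof (cases "r = 0")
  case True
  then show ?thesis by (simp add: integrable_heat_kernel)
next
  case False
  then have r: "r > 0" using r by simp
  have [measurable]: "v \<in> borel_measurable borel" using v by (simp add: square_integrable_def)
  have "integrable lborel (\<lambda>z. heat_kernel (x - (x + (- sqrt r) *\<^sub>R z)) r * v (x + (- sqrt r) *\<^sub>R z))"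
    using heat_type_integrable[OF heat_type_heat_kernel r v, of x] r
    by (subst lborel_integrable_affine[where f = "\<lambda>y. heat_kernel (x - y) r * v y"]) auto
  then have "integrable lborel (\<lambda>z. sqrt r ^ 3 * (heat_kernel (sqrt r *\<^sub>R z) r * v (x - sqrt r *\<^sub>R z)))"
    by (intro integrable_mult_right) simp
  then show ?thesis by (simp add: mult.assoc[symmetric] heat_kernel_scale[OF r])
qed

lemma gauss_avg_L2_add:
  assumes "square_integrable v" "square_integrable w" "r \<ge> 0"
  shows "gauss_avg r (\<lambda>x. v x + w x) x = gauss_avg r v x + gauss_avg r w x"
  unfolding gauss_avg_def distrib_left using assms by (intro Bochner_Integration.integral_add gauss_avg_L2_integrable)

text \<open>Jensen's inequality for the probability density \<Phi>(.,1), proved by expanding a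
  nonnegative variance. The right-hand side is an extended real because it may be infinite at
  individual points.\<close>

lemma gauss_avg_sq_le:
  assumes v: "square_integrable v" and r: "r \<ge> 0"
  shows "ennreal ((gauss_avg r v x)\<^sup>2) \<le> (\<integral>\<^sup>+z. ennreal (heat_kernel z 1 * (v (x - sqrt r *\<^sub>R z))\<^sup>2) \<partial>lborel)"
proof -
  have [measurable]: "v \<in> borel_measurable borel" using v by (simp add: square_integrable_def)
  let ?w = "\<lambda>z. v (x - sqrt r *\<^sub>R z)"
  show ?thesis
  proof (cases "integrable lborel (\<lambda>z. heat_kernel z 1 * (?w z)\<^sup>2)")
    case True
    define m where "m = gauss_avg r v x"
    note i = gauss_avg_L2_integrable[OF v r, of x]
    have "0 \<le> (\<integral>z. heat_kernel z 1 * (?w z - m)\<^sup>2 \<partial>lborel)"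
      by (intro integral_nonneg_AE AE_I2) (simp add: heat_kernel_nonneg)
    also have "\<dots> = (\<integral>z. heat_kernel z 1 * (?w z)\<^sup>2 - 2 * m * (heat_kernel z 1 * ?w z) + m\<^sup>2 * heat_kernel z 1 \<partial>lborel)"
      by (intro Bochner_Integration.integral_cong) (auto simp: power2_diff algebra_simps)
    also have "\<dots> = (\<integral>z. heat_kernel z 1 * (?w z)\<^sup>2 \<partial>lborel) - 2 * m * m + m\<^sup>2 * 1"
      using True i by (simp add: integrable_heat_kernel integral_heat_kernel m_def gauss_avg_def)
    finally have "m\<^sup>2 \<le> (\<integral>z. heat_kernel z 1 * (?w z)\<^sup>2 \<partial>lborel)" by (simp add: power2_eq_square)
    then show ?thesis
      using True by (subst nn_integral_eq_integral) (auto simp: m_def heat_kernel_nonneg intro: ennreal_leI)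
  next
    case False
    then have "\<not> (\<integral>\<^sup>+z. ennreal (heat_kernel z 1 * (?w z)\<^sup>2) \<partial>lborel) < \<infinity>"
      by (simp add: integrable_iff_bounded heat_kernel_nonneg abs_mult)
    then have "(\<integral>\<^sup>+z. ennreal (heat_kernel z 1 * (?w z)\<^sup>2) \<partial>lborel) = \<infinity>"
      by (metis infinity_ennreal_def less_top)
    then show ?thesis by simp
  qed
qed

lemma gauss_avg_measurable:
  assumes [measurable]: "v \<in> borel_measurable borel"
  shows "gauss_avg r v \<in> borel_measurable borel"
  unfolding gauss_avg_def[abs_def] by measurable

text \<open>Jensen's inequality is integrated in \<open>x\<close>; Tonelli, translation invariance
  and the unit mass of the Gaussian give the contraction.\<close>

lemma
  assumes v: "square_integrable v" and r: "r \<ge> 0"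
  shows square_integrable_gauss_avg: "square_integrable (gauss_avg r v)"
    and mean_square_gauss_avg: "mean_square (gauss_avg r v) \<le> mean_square v"
proof -
  have [measurable]: "v \<in> borel_measurable borel" using v by (simp add: square_integrable_def)
  have [measurable]: "gauss_avg r v \<in> borel_measurable borel" by (rule gauss_avg_measurable) fact
  have fin: "(\<integral>\<^sup>+x. ennreal ((v x)\<^sup>2) \<partial>lborel) = ennreal (mean_square v)"
    using v unfolding mean_square_def by (intro nn_integral_eq_integral) (auto simp: square_integrable_def)
  have "(\<integral>\<^sup>+x. ennreal ((gauss_avg r v x)\<^sup>2) \<partial>lborel)
      \<le> (\<integral>\<^sup>+x. (\<integral>\<^sup>+z. ennreal (heat_kernel z 1 * (v (x - sqrt r *\<^sub>R z))\<^sup>2) \<partial>lborel) \<partial>lborel)"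
    by (intro nn_integral_mono gauss_avg_sq_le v r)
  also have "\<dots> = (\<integral>\<^sup>+z. (\<integral>\<^sup>+x. ennreal (heat_kernel z 1 * (v (x - sqrt r *\<^sub>R z))\<^sup>2) \<partial>lborel) \<partial>lborel)"
    by (rule lborel_pair.Fubini') measurable
  also have "\<dots> = (\<integral>\<^sup>+z. ennreal (heat_kernel z 1) * ennreal (mean_square v) \<partial>lborel)"
  proof (rule nn_integral_cong)
    fix z :: "real^3"
    have "(\<integral>\<^sup>+x. ennreal (heat_kernel z 1 * (v (x - sqrt r *\<^sub>R z))\<^sup>2) \<partial>lborel)
        = ennreal (heat_kernel z 1) * (\<integral>\<^sup>+x. ennreal ((v (x - sqrt r *\<^sub>R z))\<^sup>2) \<partial>lborel)"
      by (simp add: ennreal_mult heat_kernel_nonneg nn_integral_cmult)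
    also have "(\<integral>\<^sup>+x. ennreal ((v (x - sqrt r *\<^sub>R z))\<^sup>2) \<partial>lborel) = (\<integral>\<^sup>+x. ennreal ((v x)\<^sup>2) \<partial>lborel)"
      using nn_integral_lborel_affine[of 1 "\<lambda>x. ennreal ((v x)\<^sup>2)" "- sqrt r *\<^sub>R z"] by simp
    finally show "(\<integral>\<^sup>+x. ennreal (heat_kernel z 1 * (v (x - sqrt r *\<^sub>R z))\<^sup>2) \<partial>lborel) = ennreal (heat_kernel z 1) * ennreal (mean_square v)"
      by (simp add: fin)
  qed
  also have "\<dots> = (\<integral>\<^sup>+z. ennreal (heat_kernel z 1) \<partial>lborel) * ennreal (mean_square v)"
    by (rule nn_integral_multc) measurable
  also have "(\<integral>\<^sup>+z. ennreal (heat_kernel z 1) \<partial>lborel) = 1"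
    by (subst nn_integral_eq_integral) (auto simp: integrable_heat_kernel integral_heat_kernel heat_kernel_nonneg)
  finally have le: "(\<integral>\<^sup>+x. ennreal ((gauss_avg r v x)\<^sup>2) \<partial>lborel) \<le> ennreal (mean_square v)" by simp
  then have i: "integrable lborel (\<lambda>x. (gauss_avg r v x)\<^sup>2)"
    by (intro integrableI_bounded) (auto intro: le_less_trans)
  then show "square_integrable (gauss_avg r v)" by (simp add: square_integrable_def)
  have "ennreal (mean_square (gauss_avg r v)) \<le> ennreal (mean_square v)"
    using le i by (simp add: mean_square_def nn_integral_eq_integral)
  then show "mean_square (gauss_avg r v) \<le> mean_square v" by (simp add: mean_square_nonneg)
qed

section \<open>Square integrable decay and density of compactly supported functions\<close>

definition quadratic_weight :: "real^3 \<Rightarrow> real" where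
  "quadratic_weight x = 1 / (1 + (norm x)\<^sup>2)"

text \<open>If \<open>4\<^sup>n \<le> 1 + |x|\<^sup>2 < 4\<^bsup>n+1\<^esup>\<close>, then \<open>(1 + |x|\<^sup>2)\<^sup>-\<^sup>2 \<le> 16\<^sup>-\<^sup>n\<close>, which is bounded by a
  multiple of \<open>2\<^sup>-\<^sup>n \<Phi>(x, 4\<^sup>n)\<close>.\<close>
lemma square_integrable_quadratic_weight: "square_integrable quadratic_weight"
proof -
  \<comment> \<open>The terms have integral 2^-n, so the series is integrable; comparison with it
    replaces integration in the radius.\<close>
  define f where "f n x = (1 / 2) ^ n * heat_kernel x (4 ^ n)" for n :: nat and x :: "real^3"
  have f0: "f n x \<ge> 0" for n x by (simp add: f_def heat_kernel_nonneg)
  have k: "(4 * pi * 4 ^ n) powr (- 3 / 2) = (4 * pi) powr (- 3 / 2) * (1 / 8) ^ n" for n :: nat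
  proof -
    have "(4::real) powr (- 3 / 2) = (2 powr 2) powr (- 3 / 2)" by simp
    also have "\<dots> = 2 powr (- 3)" by (subst powr_powr) simp
    also have "\<dots> = 1 / 8" by (simp add: powr_minus_divide)
    finally have e: "(4::real) powr (- 3 / 2) = 1 / 8" .
    have "((4::real) ^ n) powr (- 3 / 2) = (4 powr real n) powr (- 3 / 2)" by (simp add: powr_realpow)
    also have "\<dots> = (4 powr (- 3 / 2)) powr real n" by (rule powr_powr_swap)
    also have "\<dots> = (1 / 8) ^ n" unfolding e by (simp add: powr_realpow)
    finally have "((4::real) ^ n) powr (- 3 / 2) = (1 / 8) ^ n" .
    then show ?thesis by (simp add: powr_mult)
  qed
  have le1: "(4 * pi) powr (- 3 / 2) \<le> 1"
  proof -
    have "(4 * pi) powr (- 3 / 2) \<le> (4 * pi) powr 0" using pi_gt3 by (intro powr_mono) auto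
    then show ?thesis by simp
  qed
  have f1: "f n x \<le> (1 / 2) ^ n" for n x
  proof -
    have "heat_kernel x (4 ^ n) \<le> 1 * 1 * 1"
      unfolding heat_kernel_def k using le1 by (intro mult_mono) (auto simp: power_le_one)
    then show ?thesis unfolding f_def by (intro mult_left_le) auto
  qed
  have sm: "summable (\<lambda>n. f n x)" for x
    by (rule summable_comparison_test'[of "\<lambda>n. (1 / 2) ^ n" 0]) (auto simp: f0 f1 summable_geometric)
  have int: "integrable lborel (\<lambda>x. \<Sum>n. f n x)"
  proof (rule integrable_suminf)
    show "integrable lborel (f n)" for n
      unfolding f_def[abs_def] by (intro integrable_mult_right integrable_heat_kernel) simp
    show "AE x in lborel. summable (\<lambda>n. norm (f n x))" using sm by (simp add: f0)
    have "(\<integral>x. norm (f n x) \<partial>lborel) = (1 / 2) ^ n" for n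
      unfolding real_norm_def abs_of_nonneg[OF f0] unfolding f_def by (simp add: integral_heat_kernel)
    then show "summable (\<lambda>n. \<integral>x. norm (f n x) \<partial>lborel)" by (simp add: summable_geometric)
  qed
  \<comment> \<open>A lower bound for the Gaussian on the shell without the power of 1/8: there
    |x|^2 \<le> 4 * 4^n, so the exponent at time 4^n is at least -1. With 1/2 * 1/8 = 1/16 the
    powers match the squared weight.\<close>
  define c where "c = (4 * pi) powr (- 3 / 2) * exp (- 1)"
  have c: "c > 0" by (simp add: c_def)
  have "(quadratic_weight x)\<^sup>2 \<le> 1 / c * (\<Sum>n. f n x)" for x
  proof -
    let ?s = "1 + (norm x)\<^sup>2"
    have "\<exists>n::nat. ?s < 4 ^ (n + 1)"
    proof -
      obtain n where "?s < 4 ^ n" using real_arch_pow[of 4 ?s] by auto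
      also have "(4::real) ^ n \<le> 4 ^ (n + 1)" by simp
      finally show ?thesis by blast
    qed
    define n where "n = (LEAST n::nat. ?s < 4 ^ (n + 1))"
    have u: "?s < 4 ^ (n + 1)"
      unfolding n_def using \<open>\<exists>n::nat. ?s < 4 ^ (n + 1)\<close> by (rule LeastI_ex)
    have l: "4 ^ n \<le> ?s"
    proof (cases n)
      case (Suc m)
      then have "\<not> ?s < 4 ^ (m + 1)" unfolding n_def by (intro not_less_Least) simp
      then show ?thesis using Suc by simp
    qed simp
    have "(quadratic_weight x)\<^sup>2 \<le> (1 / 4 ^ n)\<^sup>2"
    proof -
      have "1 / ?s \<le> 1 / 4 ^ n" using l by (intro divide_left_mono mult_pos_pos add_pos_nonneg) auto
      then show ?thesis unfolding quadratic_weight_def by (intro power_mono) auto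
    qed
    also have "\<dots> = (1 / 16) ^ n"
    proof -
      have "((4::real) ^ n)\<^sup>2 = 16 ^ n" by (simp add: power2_eq_square power_mult_distrib[symmetric])
      then show ?thesis by (simp add: power_one_over power_divide)
    qed
    also have "\<dots> \<le> 1 / c * f n x"
    proof -
      have "(norm x)\<^sup>2 / (4 * 4 ^ n) \<le> 1" using u by (simp add: divide_le_eq)
      then have "exp (- 1) \<le> exp (- (norm x)\<^sup>2 / (4 * 4 ^ n))" by simp
      then have "c * (1 / 8) ^ n \<le> heat_kernel x (4 ^ n)"
        unfolding heat_kernel_def k c_def by (simp add: mult.assoc mult_left_mono mult.commute)
      then have "(1 / 2) ^ n * (c * (1 / 8) ^ n) \<le> f n x" unfolding f_def by (intro mult_left_mono) auto
      moreover have "(1 / 2) ^ n * (c * (1 / 8) ^ n) = c * (1 / 16 :: real) ^ n"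
        by (simp add: power_mult_distrib[symmetric])
      ultimately show ?thesis using c by (simp add: field_simps)
    qed
    also have "\<dots> \<le> 1 / c * (\<Sum>n. f n x)"
      using sum_le_suminf[OF sm, of "{n}" x] f0 c by (intro mult_left_mono) auto
    finally show ?thesis .
  qed
  moreover have "quadratic_weight \<in> borel_measurable borel"
    unfolding quadratic_weight_def[abs_def] by measurable
  ultimately show ?thesis
    using int by (intro square_integrable_bound[of _ "\<lambda>x. 1 / c * (\<Sum>n. f n x)"] integrable_mult_right) auto
qed

lemma clip_bounds: "\<bar>max (- m) (min m s)\<bar> \<le> m" "\<bar>max (- m) (min m s)\<bar> \<le> \<bar>s\<bar>" if "m \<ge> 0" for m s :: real
  using that by auto

definition hat :: "real \<Rightarrow> real^3 \<Rightarrow> real" where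
  "hat m x = max 0 (min 1 (m + 1 - norm x))"

lemma hat_bounds: "0 \<le> hat m x" "hat m x \<le> 1" "m + 1 < norm x \<Longrightarrow> hat m x = 0" "norm x \<le> m \<Longrightarrow> hat m x = 1"
  by (auto simp: hat_def)

lemma continuous_on_hat: "continuous_on A (hat m)"
  unfolding hat_def[abs_def] by (intro continuous_intros)

text \<open>A measurable function is an a.e. limit of continuous ones, which are then clipped and cut off.\<close>
lemma square_integrable_approx:
  assumes v: "square_integrable v" and e: "e > 0"
  obtains h \<rho> B where "continuous_on UNIV h" "\<And>x. \<bar>h x\<bar> \<le> B" "\<And>x. \<rho> < norm x \<Longrightarrow> h x = 0"
    "mean_square (\<lambda>x. v x - h x) < e"
proof -
  have vm [measurable]: "v \<in> borel_measurable borel" and vi: "integrable lborel (\<lambda>x. (v x)\<^sup>2)"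
    using v by (auto simp: square_integrable_def)
  have hm [measurable]: "hat m \<in> borel_measurable borel" for m
    by (intro borel_measurable_continuous_onI continuous_on_hat)
  define clip where "clip m s = max (- real m) (min (real m) s)" for m :: nat and s
  have clip: "\<bar>clip m s\<bar> \<le> real m" "\<bar>clip m s\<bar> \<le> \<bar>s\<bar>" for m s
    using clip_bounds[of "real m" s] by (auto simp: clip_def)
  define w where "w m x = clip m (v x) * hat m x" for m x
  have wm [measurable]: "w m \<in> borel_measurable borel" for m unfolding w_def clip_def by measurable
  have wsq: "square_integrable (w m)" for m
  proof (rule square_integrable_bound[OF wm vi])
    fix x
    have "\<bar>w m x\<bar> \<le> \<bar>v x\<bar> * 1"
      unfolding w_def abs_mult using clip(2) hat_bounds(1,2)[of m x] by (intro mult_mono) auto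
    then show "(w m x)\<^sup>2 \<le> (v x)\<^sup>2" by (simp add: abs_le_square_iff[symmetric])
  qed
  have "(\<lambda>m. \<integral>x. (v x - w m x)\<^sup>2 \<partial>lborel) \<longlonglongrightarrow> (\<integral>x. 0 \<partial>(lborel :: (real^3) measure))"
  proof (rule integral_dominated_convergence[where w = "\<lambda>x. (2 * v x)\<^sup>2"])
    show "integrable lborel (\<lambda>x. (2 * v x)\<^sup>2)" using vi by (simp add: power_mult_distrib)
    show "AE x in lborel. (\<lambda>m. (v x - w m x)\<^sup>2) \<longlonglongrightarrow> 0"
    proof (rule AE_I2, rule tendsto_eventually)
      fix x
      obtain N :: nat where N: "real N \<ge> max \<bar>v x\<bar> (norm x)" using real_arch_simple by blast
      show "\<forall>\<^sub>F m in sequentially. (v x - w m x)\<^sup>2 = 0"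
        using eventually_ge_at_top[of N]
      proof eventually_elim
        case (elim m)
        then have "real m \<ge> \<bar>v x\<bar>" "norm x \<le> real m" using N by auto
        then show ?case using hat_bounds(4)[of x "real m"] by (auto simp: w_def clip_def)
      qed
    qed
    show "AE x in lborel. norm ((v x - w m x)\<^sup>2) \<le> (2 * v x)\<^sup>2" for m
    proof (rule AE_I2)
      fix x
      have "\<bar>w m x\<bar> \<le> \<bar>v x\<bar> * 1"
        unfolding w_def abs_mult using clip(2) hat_bounds(1,2)[of m x] by (intro mult_mono) auto
      then have "\<bar>v x - w m x\<bar> \<le> \<bar>2 * v x\<bar>" by linarith
      then have "(v x - w m x)\<^sup>2 \<le> (2 * v x)\<^sup>2" by (simp only: abs_le_square_iff)
      then show "norm ((v x - w m x)\<^sup>2) \<le> (2 * v x)\<^sup>2" by simp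
    qed
  qed measurable
  then have "(\<lambda>m. mean_square (\<lambda>x. v x - w m x)) \<longlonglongrightarrow> 0" by (simp add: mean_square_def)
  \<comment> \<open>Two errors are added and \<open>mean_square_add\<close> doubles each of them,
    hence a quarter.\<close>
  moreover have "e / 4 > 0" using e by simp
  ultimately have "\<forall>\<^sub>F m in sequentially. mean_square (\<lambda>x. v x - w m x) < e / 4"
    by (rule order_tendstoD(2))
  then obtain m where m: "mean_square (\<lambda>x. v x - w m x) < e / 4"
    by (auto simp: eventually_sequentially)
  have "v \<in> borel_measurable lebesgue" by (intro measurable_completion) simp
  \<comment> \<open>The characterisation of measurability by almost everywhere limits supplies the
    continuous functions \<open>g n\<close>. The clipping and cut-off already chosen for
    \<open>v\<close> then make them uniformly bounded with a common support.\<close>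
  then have "v measurable_on UNIV" by (intro lebesgue_measurable_imp_measurable_on) auto
  then obtain N g where N: "negligible N" and g: "\<And>n. continuous_on UNIV (g n)"
    and lim: "\<And>x. x \<notin> N \<Longrightarrow> (\<lambda>n. g n x) \<longlonglongrightarrow> v x"
    unfolding measurable_on_def by auto
  define h where "h n x = clip m (g n x) * hat m x" for n x
  have hc: "continuous_on UNIV (h n)" for n
    unfolding h_def clip_def using g by (intro continuous_intros continuous_on_hat)
  then have [measurable]: "h n \<in> borel_measurable borel" for n by (rule borel_measurable_continuous_onI)
  have hb: "\<bar>h n x\<bar> \<le> real m" for n x
  proof -
    have "\<bar>h n x\<bar> \<le> real m * 1"
      unfolding h_def abs_mult using clip(1) hat_bounds(1,2)[of m x] by (intro mult_mono) auto
    then show ?thesis by simp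
  qed
  have wb: "\<bar>w m x\<bar> \<le> real m" for x
  proof -
    have "\<bar>w m x\<bar> \<le> real m * 1"
      unfolding w_def abs_mult using clip(1) hat_bounds(1,2)[of m x] by (intro mult_mono) auto
    then show ?thesis by simp
  qed
  have dom: "(w m x - h n x)\<^sup>2 \<le> (2 * real m)\<^sup>2 * indicator (cball 0 (real m + 1)) x" for n x
  proof (cases "norm x \<le> real m + 1")
    case True
    have "\<bar>w m x - h n x\<bar> \<le> \<bar>2 * real m\<bar>" using hb[of n x] wb[of x] by linarith
    then have "(w m x - h n x)\<^sup>2 \<le> (2 * real m)\<^sup>2" by (simp only: abs_le_square_iff)
    then show ?thesis using True by simp
  next
    case False
    then show ?thesis using hat_bounds(3)[of "real m" x] by (simp add: w_def h_def)
  qed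
  have ind: "integrable lborel (\<lambda>x::real^3. (2 * real m)\<^sup>2 * indicator (cball 0 (real m + 1)) x)"
    using emeasure_bounded_finite[of "cball (0::real^3) (real m + 1)"]
    by (intro integrable_mult_right integrable_real_indicator) auto
  have whs: "square_integrable (\<lambda>x. w m x - h n x)" for n
    by (rule square_integrable_bound[OF _ ind dom]) measurable
  have "AE x in lborel. x \<notin> N"
  proof -
    have "AE x in lebesgue. x \<notin> N" using N by (intro AE_not_in) (simp add: negligible_iff_null_sets)
    then show ?thesis by (simp add: AE_completion_iff)
  qed
  then have "AE x in lborel. (\<lambda>n. (w m x - h n x)\<^sup>2) \<longlonglongrightarrow> 0"
  proof eventually_elim
    case (elim x)
    have "(\<lambda>n. (w m x - h n x)\<^sup>2) \<longlonglongrightarrow> (w m x - clip m (v x) * hat m x)\<^sup>2"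
      unfolding h_def clip_def by (intro tendsto_intros lim elim)
    then show ?case by (simp add: w_def)
  qed
  then have "(\<lambda>n. \<integral>x. (w m x - h n x)\<^sup>2 \<partial>lborel) \<longlonglongrightarrow> (\<integral>x. 0 \<partial>(lborel :: (real^3) measure))"
    using dom by (intro integral_dominated_convergence[OF _ _ ind]) auto
  then have "(\<lambda>n. mean_square (\<lambda>x. w m x - h n x)) \<longlonglongrightarrow> 0" by (simp add: mean_square_def)
  then have "\<forall>\<^sub>F n in sequentially. mean_square (\<lambda>x. w m x - h n x) < e / 4"
    using \<open>e / 4 > 0\<close> by (rule order_tendstoD(2))
  then obtain n where n: "mean_square (\<lambda>x. w m x - h n x) < e / 4"
    by (auto simp: eventually_sequentially)
  have "mean_square (\<lambda>x. (v x - w m x) + (w m x - h n x)) \<le> 2 * mean_square (\<lambda>x. v x - w m x) + 2 * mean_square (\<lambda>x. w m x - h n x)"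
    by (rule mean_square_add[OF square_integrable_diff[OF v wsq] whs])
  then have "mean_square (\<lambda>x. v x - h n x) < e" using m n by simp
  moreover have "\<And>x. real m + 1 < norm x \<Longrightarrow> h n x = 0" using hat_bounds(3) by (simp add: h_def)
  ultimately show ?thesis using hc hb by (rule_tac that[of "h n" "real m" "real m + 1"])
qed

text \<open>Pointwise convergence together with a multiple of \<open>quadratic_weight\<close> as
  common bound, available because a convergent sequence of times is bounded.\<close>

lemma gauss_avg_compact_continuous:
  assumes h: "continuous_on UNIV h" "\<And>x. \<bar>h x\<bar> \<le> B" "\<And>x. \<rho> < norm x \<Longrightarrow> h x = 0"
    and X: "\<And>n::nat. X n \<ge> 0" "X \<longlonglongrightarrow> t"
  shows "(\<lambda>n. mean_square (\<lambda>x. gauss_avg (X n) h x - gauss_avg t h x)) \<longlonglongrightarrow> 0"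
proof -
  have [measurable]: "h \<in> borel_measurable borel" using h(1) by (rule borel_measurable_continuous_onI)
  have [measurable]: "gauss_avg r h \<in> borel_measurable borel" for r by (rule gauss_avg_measurable) fact
  have t0: "t \<ge> 0" using X(2) by (rule LIMSEQ_le_const) (use X(1) in auto)
  have B: "B \<ge> 0" using h(2)[of 0] by linarith
  obtain b where b: "\<And>n. X n \<le> b" "t \<le> b"
  proof -
    have "bounded (range X)" using X(2) by (rule convergent_imp_bounded)
    then obtain c where "\<And>n. norm (X n) \<le> c" by (auto simp: bounded_iff)
    then show ?thesis by (intro that[of "max c t"]) (auto simp: abs_le_iff intro: order_trans max.coboundedI1)
  qed
  define C where "C = B * (1 + 2 * \<rho>\<^sup>2 + 2 * b * heat_second_moment)"
  have dec: "\<bar>gauss_avg r h x\<bar> \<le> C * quadratic_weight x" if "0 \<le> r" "r \<le> b" for r x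
  proof -
    have "(1 + (norm x)\<^sup>2) * \<bar>gauss_avg r h x\<bar> \<le> B * (1 + 2 * \<rho>\<^sup>2 + 2 * r * heat_second_moment)"
      by (rule gauss_avg_decay[OF _ h(2,3) that(1)]) simp
    also have "\<dots> \<le> C"
      unfolding C_def using B that heat_second_moment_nonneg by (intro mult_left_mono add_left_mono mult_right_mono) auto
    finally have "(1 + (norm x)\<^sup>2) * \<bar>gauss_avg r h x\<bar> \<le> C" .
    moreover have "1 + (norm x)\<^sup>2 > 0" by (intro add_pos_nonneg) auto
    ultimately show ?thesis by (simp add: quadratic_weight_def pos_le_divide_eq mult.commute)
  qed
  \<comment> \<open>The function is regarded as a source constant in time, on the arbitrary interval
    [0,1), and later evaluated at time 0, to reuse the continuity of Gaussian averages.\<close>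
  have src: "continuous_source 1 \<rho> (\<lambda>_. h)"
  proof -
    have "continuous_on ({0..<1} \<times> UNIV) (\<lambda>p::real \<times> (real^3). h (snd p))"
      by (rule continuous_on_compose2[OF h(1)]) (auto intro!: continuous_intros)
    then show ?thesis using h(3) by (simp add: continuous_source_def continuous_family_def case_prod_unfold)
  qed
  have "(\<lambda>n. \<integral>x. (gauss_avg (X n) h x - gauss_avg t h x)\<^sup>2 \<partial>lborel) \<longlonglongrightarrow> (\<integral>x. 0 \<partial>(lborel :: (real^3) measure))"
  proof (rule integral_dominated_convergence[where w = "\<lambda>x. (2 * C)\<^sup>2 * (quadratic_weight x)\<^sup>2"])
    show "integrable lborel (\<lambda>x. (2 * C)\<^sup>2 * (quadratic_weight x)\<^sup>2)"
      using square_integrable_quadratic_weight by (intro integrable_mult_right) (simp add: square_integrable_def)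
    show "AE x in lborel. (\<lambda>n. (gauss_avg (X n) h x - gauss_avg t h x)\<^sup>2) \<longlonglongrightarrow> 0"
    proof (rule AE_I2)
      fix x
      have "continuous_on {0..} (\<lambda>r. gauss_avg r h x)"
        by (rule continuous_on_gauss_avg_compose[OF src, of _ "\<lambda>r. r" "\<lambda>_. 0"]) (auto intro!: continuous_intros)
      then have "(\<lambda>n. gauss_avg (X n) h x) \<longlonglongrightarrow> gauss_avg t h x"
        using continuous_on_tendsto_compose[of "{0..}" "\<lambda>r. gauss_avg r h x" X t] X t0 by auto
      then have "(\<lambda>n. (gauss_avg (X n) h x - gauss_avg t h x)\<^sup>2) \<longlonglongrightarrow> (gauss_avg t h x - gauss_avg t h x)\<^sup>2"
        by (intro tendsto_intros)
      then show "(\<lambda>n. (gauss_avg (X n) h x - gauss_avg t h x)\<^sup>2) \<longlonglongrightarrow> 0" by simp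
    qed
    show "AE x in lborel. norm ((gauss_avg (X n) h x - gauss_avg t h x)\<^sup>2) \<le> (2 * C)\<^sup>2 * (quadratic_weight x)\<^sup>2" for n
    proof (rule AE_I2)
      fix x
      have "\<bar>gauss_avg (X n) h x - gauss_avg t h x\<bar> \<le> \<bar>2 * C * quadratic_weight x\<bar>"
        using dec[OF X(1)[of n] b(1)[of n], of x] dec[OF t0 b(2), of x] by linarith
      then have "(gauss_avg (X n) h x - gauss_avg t h x)\<^sup>2 \<le> (2 * C * quadratic_weight x)\<^sup>2"
        by (simp only: abs_le_square_iff)
      then show "norm ((gauss_avg (X n) h x - gauss_avg t h x)\<^sup>2) \<le> (2 * C)\<^sup>2 * (quadratic_weight x)\<^sup>2"
        by (simp only: power_mult_distrib) simp
    qed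
  qed measurable
  then show ?thesis by (simp add: mean_square_def)
qed

lemma gauss_avg_L2_continuous:
  assumes v: "square_integrable v" and X: "\<And>n::nat. X n \<ge> 0" "X \<longlonglongrightarrow> t"
  shows "(\<lambda>n. mean_square (\<lambda>x. gauss_avg (X n) v x - gauss_avg t v x)) \<longlonglongrightarrow> 0"
proof (rule LIMSEQ_I)
  fix e :: real assume "e > 0"
  \<comment> \<open>The estimate below has the factors 8 = 2 (2 + 2) for the approximation error and
    2 for the compactly supported part; 10/16 of \<open>e\<close> is below \<open>e\<close>.\<close>
  then have e: "e / 16 > 0" by simp
  have t0: "t \<ge> 0" using X(2) by (rule LIMSEQ_le_const) (use X(1) in auto)
  obtain h \<rho> B where h: "continuous_on UNIV h" "\<And>x. \<bar>h x\<bar> \<le> B" "\<And>x. \<rho> < norm x \<Longrightarrow> h x = 0"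
    and vh: "mean_square (\<lambda>x. v x - h x) < e / 16"
    by (rule square_integrable_approx[OF v e], rule that)
  have hm [measurable]: "h \<in> borel_measurable borel" using h(1) by (rule borel_measurable_continuous_onI)
  have hs: "square_integrable h"
  proof (rule square_integrable_bound[OF hm])
    show "integrable lborel (\<lambda>x::real^3. B\<^sup>2 * indicator (cball 0 \<rho>) x)"
      using emeasure_bounded_finite[of "cball (0::real^3) \<rho>"]
      by (intro integrable_mult_right integrable_real_indicator) auto
    show "(h x)\<^sup>2 \<le> B\<^sup>2 * indicator (cball 0 \<rho>) x" for x
    proof (cases "norm x \<le> \<rho>")
      case True
      have "\<bar>h x\<bar> \<le> \<bar>B\<bar>" using h(2)[of x] by linarith
      then show ?thesis using True by (simp add: abs_le_square_iff[symmetric])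
    qed (use h(3) in auto)
  qed
  define d where "d x = v x - h x" for x
  have d: "square_integrable d" unfolding d_def[abs_def] by (rule square_integrable_diff[OF v hs])
  have split: "gauss_avg r v x = gauss_avg r d x + gauss_avg r h x" if "r \<ge> 0" for r x
    using gauss_avg_L2_add[OF d hs that, of x] by (simp add: d_def)
  have main: "mean_square (\<lambda>x. gauss_avg (X n) v x - gauss_avg t v x) \<le>
      8 * mean_square d + 2 * mean_square (\<lambda>x. gauss_avg (X n) h x - gauss_avg t h x)" for n
  proof -
    note sd = square_integrable_gauss_avg[OF d] and sh = square_integrable_gauss_avg[OF hs]
    have "mean_square (\<lambda>x. gauss_avg (X n) v x - gauss_avg t v x) =
        mean_square (\<lambda>x. (gauss_avg (X n) d x + - gauss_avg t d x) + (gauss_avg (X n) h x - gauss_avg t h x))"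
      by (simp add: split[OF X(1)] split[OF t0] algebra_simps)
    also have "\<dots> \<le> 2 * mean_square (\<lambda>x. gauss_avg (X n) d x + - gauss_avg t d x) + 2 * mean_square (\<lambda>x. gauss_avg (X n) h x - gauss_avg t h x)"
      by (intro mean_square_add square_integrable_add square_integrable_uminus square_integrable_diff sd sh X(1) t0)
    also have "mean_square (\<lambda>x. gauss_avg (X n) d x + - gauss_avg t d x) \<le> 2 * mean_square (gauss_avg (X n) d) + 2 * mean_square (\<lambda>x. - gauss_avg t d x)"
      by (intro mean_square_add square_integrable_uminus sd X(1) t0)
    also have "\<dots> \<le> 2 * mean_square d + 2 * mean_square d"
      using mean_square_gauss_avg[OF d X(1)[of n]] mean_square_gauss_avg[OF d t0] by simp
    finally show ?thesis by simp
  qed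
  have "\<forall>\<^sub>F n in sequentially. mean_square (\<lambda>x. gauss_avg (X n) h x - gauss_avg t h x) < e / 16"
    using gauss_avg_compact_continuous[OF h X] e by (rule order_tendstoD(2))
  then obtain N where N: "\<And>n. n \<ge> N \<Longrightarrow> mean_square (\<lambda>x. gauss_avg (X n) h x - gauss_avg t h x) < e / 16"
    by (auto simp: eventually_sequentially)
  show "\<exists>no. \<forall>n\<ge>no. norm (mean_square (\<lambda>x. gauss_avg (X n) v x - gauss_avg t v x) - 0) < e"
  proof (intro exI[of _ N] allI impI)
    fix n assume "n \<ge> N"
    have "mean_square d < e / 16" using vh by (simp add: d_def[abs_def])
    then have "mean_square (\<lambda>x. gauss_avg (X n) v x - gauss_avg t v x) < e"
      using main[of n] N[OF \<open>n \<ge> N\<close>] \<open>e > 0\<close> by linarith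
    then show "norm (mean_square (\<lambda>x. gauss_avg (X n) v x - gauss_avg t v x) - 0) < e"
      by (simp add: mean_square_nonneg)
  qed
qed

section \<open>Mean square continuity of the forcing velocity\<close>

context stokes_forcing
begin

lemma velocity_0: "velocity i 0 x = 0"
  by (simp add: velocity_def time_int_def)

lemma velocity_lipschitz:
  assumes T': "T' < T"
  obtains C where "\<And>s t x. s \<in> {0..T'} \<Longrightarrow> t \<in> {0..T'} \<Longrightarrow>
    \<bar>velocity i t x - velocity i s x\<bar> \<le> \<bar>t - s\<bar> * C * quadratic_weight x"
proof -
  obtain C where C: "C \<ge> 0" "\<And>t x. t \<in> {0..T'} \<Longrightarrow> (1 + (norm x)\<^sup>2) * \<bar>velocity_rate i t x\<bar> \<le> C"
    by (rule velocity_rate_decay[OF T', of i], rule that)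
  have *: "\<bar>velocity i t x - velocity i s x\<bar> \<le> \<bar>t - s\<bar> * C * quadratic_weight x"
    if st: "0 \<le> s" "s \<le> t" "t \<le> T'" for s t x
  proof -
    have c: "continuous_on {0..t} (\<lambda>\<sigma>. velocity_rate i \<sigma> x)"
      using st T' by (intro continuous_family_time[OF continuous_family_velocity_rate]) auto
    have "integral {0..s} (\<lambda>\<sigma>. velocity_rate i \<sigma> x) + integral {s..t} (\<lambda>\<sigma>. velocity_rate i \<sigma> x) = integral {0..t} (\<lambda>\<sigma>. velocity_rate i \<sigma> x)"
      using st c by (intro Henstock_Kurzweil_Integration.integral_combine integrable_continuous_interval) auto
    then have eq: "velocity i t x - velocity i s x = integral {s..t} (\<lambda>\<sigma>. velocity_rate i \<sigma> x)"
      by (simp add: velocity_def time_int_def)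
    have p: "1 + (norm x)\<^sup>2 > 0" by (intro add_pos_nonneg) auto
    have "norm (integral {s..t} (\<lambda>\<sigma>. velocity_rate i \<sigma> x)) \<le> integral {s..t} (\<lambda>\<sigma>. C * quadratic_weight x)"
    proof (rule integral_norm_bound_integral)
      show "(\<lambda>\<sigma>. velocity_rate i \<sigma> x) integrable_on {s..t}"
        using st by (intro integrable_continuous_interval continuous_on_subset[OF c]) auto
      fix \<sigma> assume "\<sigma> \<in> {s..t}"
      then have "\<sigma> \<in> {0..T'}" using st by auto
      from C(2)[OF this, of x] show "norm (velocity_rate i \<sigma> x) \<le> C * quadratic_weight x"
        using p by (simp add: quadratic_weight_def pos_le_divide_eq mult.commute)
    qed auto
    also have "\<dots> = \<bar>t - s\<bar> * C * quadratic_weight x" using st by simp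
    finally show ?thesis unfolding eq by simp
  qed
  show ?thesis
  proof (rule that)
    fix s t x assume "s \<in> {0..T'}" "t \<in> {0..T'}"
    then show "\<bar>velocity i t x - velocity i s x\<bar> \<le> \<bar>t - s\<bar> * C * quadratic_weight x"
      using *[of s t x] *[of t s x] by (cases "s \<le> t") (auto simp: abs_minus_commute)
  qed
qed

text \<open>The Lipschitz bound is compared with time 0, where the velocity vanishes.\<close>

lemma square_integrable_velocity:
  assumes t: "t \<in> {0..<T}"
  shows "square_integrable (velocity i t)"
proof -
  have tT: "t < T" using t by simp
  obtain C where C: "\<And>r s x. s \<in> {0..t} \<Longrightarrow> r \<in> {0..t} \<Longrightarrow>
    \<bar>velocity i r x - velocity i s x\<bar> \<le> \<bar>r - s\<bar> * C * quadratic_weight x"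
    by (rule velocity_lipschitz[OF tT, of i], rule that)
  have m: "velocity i t \<in> borel_measurable borel"
    using family_partial_velocity[of undefined i] t borel_measurable_continuous_family by (auto simp: family_partial_def)
  show ?thesis
  proof (rule square_integrable_bound[OF m])
    show "integrable lborel (\<lambda>x. (t * C)\<^sup>2 * (quadratic_weight x)\<^sup>2)"
      using square_integrable_quadratic_weight by (intro integrable_mult_right) (simp add: square_integrable_def)
    fix x
    have "\<bar>velocity i t x\<bar> \<le> \<bar>t * C * quadratic_weight x\<bar>"
      using C[of 0 t x] t by (simp add: velocity_0)
    then show "(velocity i t x)\<^sup>2 \<le> (t * C)\<^sup>2 * (quadratic_weight x)\<^sup>2"
      unfolding power_mult_distrib[symmetric] by (simp only: abs_le_square_iff)
  qed
qed

lemma velocity_L2_continuous: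
  assumes X: "\<And>n::nat. X n \<in> {0..<T}" "X \<longlonglongrightarrow> t" and t: "t \<in> {0..<T}"
  shows "(\<lambda>n. mean_square (\<lambda>x. velocity i (X n) x - velocity i t x)) \<longlonglongrightarrow> 0"
proof -
  \<comment> \<open>Leaves room above \<open>t\<close>, so that eventually all times lie in an
    interval with one Lipschitz constant.\<close>
  define T' where "T' = (t + T) / 2"
  have T': "t < T'" "T' < T" using t by (auto simp: T'_def)
  obtain C where C: "\<And>s t x. s \<in> {0..T'} \<Longrightarrow> t \<in> {0..T'} \<Longrightarrow>
    \<bar>velocity i t x - velocity i s x\<bar> \<le> \<bar>t - s\<bar> * C * quadratic_weight x"
    by (rule velocity_lipschitz[OF T'(2), of i], rule that)
  have ev: "\<forall>\<^sub>F n in sequentially. X n < T'" using X(2) T'(1) by (rule order_tendstoD(2))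
  have "(\<lambda>n. (\<bar>X n - t\<bar> * C)\<^sup>2 * mean_square quadratic_weight) \<longlonglongrightarrow> (\<bar>t - t\<bar> * C)\<^sup>2 * mean_square quadratic_weight"
    by (intro tendsto_intros X(2))
  then have lim: "(\<lambda>n. (\<bar>X n - t\<bar> * C)\<^sup>2 * mean_square quadratic_weight) \<longlonglongrightarrow> 0" by simp
  show ?thesis
  proof (rule tendsto_sandwich[OF _ _ tendsto_const lim])
    show "\<forall>\<^sub>F n in sequentially. mean_square (\<lambda>x. velocity i (X n) x - velocity i t x) \<le> (\<bar>X n - t\<bar> * C)\<^sup>2 * mean_square quadratic_weight"
      using ev
    proof eventually_elim
      case (elim n)
      have "mean_square (\<lambda>x. velocity i (X n) x - velocity i t x) \<le> (\<integral>x. (\<bar>X n - t\<bar> * C)\<^sup>2 * (quadratic_weight x)\<^sup>2 \<partial>lborel)"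
        unfolding mean_square_def
      proof (rule integral_mono)
        show "integrable lborel (\<lambda>x. (velocity i (X n) x - velocity i t x)\<^sup>2)"
          using square_integrable_diff[OF square_integrable_velocity[OF X(1)] square_integrable_velocity[OF t]]
          by (simp add: square_integrable_def)
        show "integrable lborel (\<lambda>x. (\<bar>X n - t\<bar> * C)\<^sup>2 * (quadratic_weight x)\<^sup>2)"
          using square_integrable_quadratic_weight by (intro integrable_mult_right) (simp add: square_integrable_def)
        fix x
        have "\<bar>velocity i (X n) x - velocity i t x\<bar> \<le> \<bar>\<bar>X n - t\<bar> * C * quadratic_weight x\<bar>"
          using C[of t "X n" x] elim X(1)[of n] t T' by auto
        then show "(velocity i (X n) x - velocity i t x)\<^sup>2 \<le> (\<bar>X n - t\<bar> * C)\<^sup>2 * (quadratic_weight x)\<^sup>2"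
          unfolding power_mult_distrib[symmetric] by (simp only: abs_le_square_iff)
      qed
      then show ?case by (simp add: mean_square_def)
    qed
  qed (auto simp: mean_square_nonneg)
qed

end

section \<open>The Stokes problem\<close>

lemma continuous_family_swap:
  assumes "continuous_family T f"
  shows "continuous_on (UNIV \<times> {0<..<T}) (\<lambda>(x, t). f t x)"
  unfolding case_prod_unfold
  by (rule continuous_family_compose[OF assms]) (auto intro!: continuous_on_fst continuous_on_snd)

lemma heat_type_convolution_continuous_swap:
  assumes "heat_type K" "square_integrable f"
  shows "continuous_on (UNIV \<times> {0<..<T}) (\<lambda>(x, t). \<integral>y. K t (x - y) * f y \<partial>lborel)"
proof -
  have "continuous_on (UNIV \<times> {0<..<T}) (\<lambda>p. case (snd p, fst p) of (t, x) \<Rightarrow> \<integral>y. K t (x - y) * f y \<partial>lborel)"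
    by (rule continuous_on_compose2[OF heat_type_convolution_continuous[OF assms]])
      (auto intro!: continuous_on_Pair continuous_on_fst continuous_on_snd)
  then show ?thesis by (simp add: case_prod_unfold)
qed

text \<open>Transfers explicit derivatives of a formula \<open>g\<close> to a function known to
  agree with it at positive times only. It is applied to the velocity, to its partial derivatives
  and to the pressure.\<close>

lemma
  assumes eq: "\<And>t x. t \<in> {0<..<T} \<Longrightarrow> f t x = g t x"
    and g: "continuous_on (UNIV \<times> {0<..<T}) (\<lambda>(x, t). g t x)"
    and g': "\<And>i. continuous_on (UNIV \<times> {0<..<T}) (\<lambda>(x, t). g' i t x)"
    and der: "\<And>i t x. t \<in> {0<..<T} \<Longrightarrow> has_partial i (g t) (g' i t x) x"
  shows C1_space_intro: "C1_space T f"
    and partial_eq_of_eq: "t \<in> {0<..<T} \<Longrightarrow> partial i (f t) x = g' i t x"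
proof -
  have hp: "has_partial i (f t) (g' i t x) x" if "t \<in> {0<..<T}" for i t x
  proof -
    have "f t = g t" using eq[OF that] by auto
    then show ?thesis using der[OF that] by simp
  qed
  show p: "t \<in> {0<..<T} \<Longrightarrow> partial i (f t) x = g' i t x" for i t x
    using hp by (rule has_partial_imp_partial)
  show "C1_space T f"
    unfolding C1_space_def
  proof (intro conjI allI ballI)
    show "continuous_on (UNIV \<times> {0<..<T}) (\<lambda>(x, t). f t x)"
      by (rule continuous_on_eq[OF g]) (auto simp: eq)
    show "continuous_on (UNIV \<times> {0<..<T}) (\<lambda>(x, t). partial i (f t) x)" for i
      by (rule continuous_on_eq[OF g'[of i]]) (auto simp: p)
    show "partial_exists i (f t) x" if "t \<in> {0<..<T}" for i t x
      using hp[OF that] by (rule has_partial_imp_partial_exists)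
  qed
qed

lemma inv_neg_laplacian_eq_conv:
  assumes [measurable]: "h \<in> borel_measurable borel"
  shows "inv_neg_laplacian h x = conv newton_kernel h x"
proof -
  have "inv_neg_laplacian h x = (LINT y|lebesgue. newton_kernel (x - y) * h y)"
    by (simp add: inv_neg_laplacian_def newton_kernel_def)
  also have "\<dots> = (\<integral>y. newton_kernel (x - y) * h y \<partial>lborel)"
    by (intro integral_completion) measurable
  finally show ?thesis by (simp add: conv_commute)
qed

text \<open>\<open>f\<close> gives the components of \<open>F\<close>, and \<open>v\<close> is a
  Borel version of the initial field, on which all integrals with the heat kernel are
  computed.\<close>

locale stokes_problem = stokes_forcing +
  fixes F :: "real \<Rightarrow> real^3 \<Rightarrow> real^3" and u :: "real^3 \<Rightarrow> real^3" and v :: "3 \<Rightarrow> real^3 \<Rightarrow> real"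
  assumes F: "\<And>t x j. F t x $ j = f j t x"
    and u: "u \<in> H_space"
    and v: "\<And>i. square_integrable (v i)"
    and ae: "AE y in lebesgue. \<forall>i. u y $ i = v i y"
begin

lemma u_measurable: "u \<in> borel_measurable lebesgue"
  using u by (auto simp: H_space_def L2_def)

lemma stokes_velocity_component:
  assumes "t \<in> {0..<T}"
  shows "stokes_velocity u F t x $ i = heat_conv t u x $ i + velocity i t x"
  using oseen_conv_time_integral[OF F assms] by (simp add: stokes_velocity_def)

lemma stokes_velocity_pos:
  assumes "t \<in> {0<..<T}"
  shows "stokes_velocity u F t x $ i = heat_flow t (v i) x + velocity i t x"
  using assms by (simp add: stokes_velocity_component heat_conv_component[OF u_measurable v ae])

lemma stokes_velocity_0: "stokes_velocity u F 0 = u"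
proof
  fix x
  have "stokes_velocity u F 0 x $ i = u x $ i" for i
    using T_pos by (simp add: stokes_velocity_component velocity_0 heat_conv_def)
  then show "stokes_velocity u F 0 x = u x" by (simp add: vec_eq_iff)
qed

text \<open>Written with \<open>gauss_avg\<close>, the formula covers t = 0 as well; there it holds
  only almost everywhere, since it compares the initial field with its Borel version.\<close>

lemma stokes_velocity_ae:
  assumes t: "t \<in> {0..<T}"
  shows "AE x in lebesgue. \<forall>i. stokes_velocity u F t x $ i = gauss_avg t (v i) x + velocity i t x"
proof (cases "t = 0")
  case True
  then show ?thesis using ae by (simp add: stokes_velocity_0 velocity_0)
next
  case False
  then have t': "t \<in> {0<..<T}" using t by auto
  have "v i \<in> borel_measurable borel" for i using v by (simp add: square_integrable_def)
  then show ?thesis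
    using t' by (simp add: stokes_velocity_pos gauss_avg_eq_heat_flow)
qed

lemma stokes_velocity_measurable:
  assumes t: "t \<in> {0..<T}"
  shows "stokes_velocity u F t \<in> borel_measurable lebesgue"
proof (cases "t = 0")
  case True
  then show ?thesis using u_measurable by (simp add: stokes_velocity_0)
next
  case False
  then have t': "t \<in> {0<..<T}" using t by auto
  have [measurable]: "v i \<in> borel_measurable borel" "velocity i t \<in> borel_measurable borel" for i
    using v square_integrable_velocity[OF t] by (auto simp: square_integrable_def)
  have "(\<lambda>x. \<chi> i. heat_flow t (v i) x + velocity i t x) \<in> borel_measurable borel"
    unfolding heat_flow_def by (intro borel_measurable_vec3) measurable
  moreover have "stokes_velocity u F t = (\<lambda>x. \<chi> i. heat_flow t (v i) x + velocity i t x)"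
    using stokes_velocity_pos[OF t'] by (auto simp: vec_eq_iff)
  ultimately show ?thesis by (intro measurable_completion) simp
qed

definition mild :: "3 \<Rightarrow> real \<Rightarrow> real^3 \<Rightarrow> real" where
  "mild i t x = gauss_avg t (v i) x + velocity i t x"

lemma square_integrable_mild: "t \<in> {0..<T} \<Longrightarrow> square_integrable (mild i t)"
  unfolding mild_def[abs_def]
  by (intro square_integrable_add square_integrable_gauss_avg v square_integrable_velocity) auto

lemma norm_sq_sum: "(norm (w::real^3))\<^sup>2 = (\<Sum>i\<in>UNIV. (w $ i)\<^sup>2)"
  unfolding power2_norm_eq_inner inner_vec_def by (simp add: power2_eq_square)

text \<open>Reduces the norm of a Lebesgue measurable vector field to the mean squares of Borel
  versions of its components.\<close>

lemma lebesgue_integral_norm_sq: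
  assumes m: "w \<in> borel_measurable lebesgue" and z: "\<And>i. square_integrable (z i)"
    and eq: "AE x in lebesgue. \<forall>i. w x $ i = z i x"
  shows "integrable lebesgue (\<lambda>x. (norm (w x))\<^sup>2)" "L2_norm w = sqrt (\<Sum>i\<in>UNIV. mean_square (z i))"
proof -
  have [measurable]: "z i \<in> borel_measurable borel" for i using z by (simp add: square_integrable_def)
  have mz: "(\<lambda>x. \<Sum>i\<in>UNIV. (z i x)\<^sup>2) \<in> borel_measurable lborel" by measurable
  have iz: "integrable lborel (\<lambda>x. \<Sum>i\<in>UNIV. (z i x)\<^sup>2)"
    using z by (auto simp: square_integrable_def)
  have mw: "(\<lambda>x. (norm (w x))\<^sup>2) \<in> borel_measurable lebesgue" using m by measurable
  have e: "AE x in lebesgue. (norm (w x))\<^sup>2 = (\<Sum>i\<in>UNIV. (z i x)\<^sup>2)"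
    using eq by eventually_elim (simp add: norm_sq_sum)
  show "integrable lebesgue (\<lambda>x. (norm (w x))\<^sup>2)"
    using integrable_cong_AE[OF mw measurable_completion[OF mz] e] iz mz by (simp add: integrable_completion)
  have "(LINT x|lebesgue. (norm (w x))\<^sup>2) = (\<integral>x. (\<Sum>i\<in>UNIV. (z i x)\<^sup>2) \<partial>lborel)"
    using integral_cong_AE[OF mw measurable_completion[OF mz] e] mz by (simp add: integral_completion)
  also have "\<dots> = (\<Sum>i\<in>UNIV. mean_square (z i))"
    unfolding mean_square_def using z by (intro Bochner_Integration.integral_sum) (auto simp: square_integrable_def)
  finally show "L2_norm w = sqrt (\<Sum>i\<in>UNIV. mean_square (z i))" by (simp add: L2_norm_def)
qed

lemma stokes_velocity_continuous_into_L2: "continuous_into_L2 {0..<T} (stokes_velocity u F)"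
  unfolding continuous_into_L2_def
proof (intro conjI ballI)
  fix t assume t: "t \<in> {0..<T}"
  show "stokes_velocity u F t \<in> L2"
    using lebesgue_integral_norm_sq(1)[OF stokes_velocity_measurable[OF t] square_integrable_mild[OF t]]
      stokes_velocity_ae[OF t] stokes_velocity_measurable[OF t]
    by (simp add: L2_def mild_def)
  have norm_diff: "L2_norm (\<lambda>x. stokes_velocity u F s x - stokes_velocity u F t x)
      = sqrt (\<Sum>i\<in>UNIV. mean_square (\<lambda>x. mild i s x - mild i t x))" if s: "s \<in> {0..<T}" for s
  proof (rule lebesgue_integral_norm_sq(2))
    show "(\<lambda>x. stokes_velocity u F s x - stokes_velocity u F t x) \<in> borel_measurable lebesgue"
      using stokes_velocity_measurable[OF s] stokes_velocity_measurable[OF t] by measurable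
    show "square_integrable (\<lambda>x. mild i s x - mild i t x)" for i
      by (intro square_integrable_diff square_integrable_mild s t)
    show "AE x in lebesgue. \<forall>i. (stokes_velocity u F s x - stokes_velocity u F t x) $ i = mild i s x - mild i t x"
      using stokes_velocity_ae[OF s] stokes_velocity_ae[OF t] by eventually_elim (simp add: mild_def)
  qed
  show "((\<lambda>s. L2_norm (\<lambda>x. stokes_velocity u F s x - stokes_velocity u F t x)) \<longlongrightarrow> 0) (at t within {0..<T})"
    unfolding tendsto_at_iff_sequentially comp_def
  proof (intro allI impI)
    fix X :: "nat \<Rightarrow> real" assume "\<forall>n. X n \<in> {0..<T} - {t}" and lim: "X \<longlonglongrightarrow> t"
    then have X: "\<And>n. X n \<in> {0..<T}" by blast
    then have X0: "\<And>n. X n \<ge> 0" by auto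
    have t0: "t \<ge> 0" using t by simp
    have "(\<lambda>n. mean_square (\<lambda>x. mild i (X n) x - mild i t x)) \<longlonglongrightarrow> 0" for i
    proof (rule tendsto_sandwich[OF _ _ tendsto_const])
      have "(\<lambda>n. 2 * mean_square (\<lambda>x. gauss_avg (X n) (v i) x - gauss_avg t (v i) x)
          + 2 * mean_square (\<lambda>x. velocity i (X n) x - velocity i t x)) \<longlonglongrightarrow> 2 * 0 + 2 * 0"
        by (intro tendsto_intros gauss_avg_L2_continuous[OF v X0 lim] velocity_L2_continuous[OF X lim t])
      then show "(\<lambda>n. 2 * mean_square (\<lambda>x. gauss_avg (X n) (v i) x - gauss_avg t (v i) x)
          + 2 * mean_square (\<lambda>x. velocity i (X n) x - velocity i t x)) \<longlonglongrightarrow> 0" by simp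
      show "\<forall>\<^sub>F n in sequentially. mean_square (\<lambda>x. mild i (X n) x - mild i t x) \<le>
          2 * mean_square (\<lambda>x. gauss_avg (X n) (v i) x - gauss_avg t (v i) x)
          + 2 * mean_square (\<lambda>x. velocity i (X n) x - velocity i t x)"
      proof (rule always_eventually, rule allI)
        fix n
        have "mean_square (\<lambda>x. mild i (X n) x - mild i t x) = mean_square (\<lambda>x.
            (gauss_avg (X n) (v i) x - gauss_avg t (v i) x) + (velocity i (X n) x - velocity i t x))"
          by (simp add: mild_def algebra_simps)
        also have "\<dots> \<le> 2 * mean_square (\<lambda>x. gauss_avg (X n) (v i) x - gauss_avg t (v i) x)
            + 2 * mean_square (\<lambda>x. velocity i (X n) x - velocity i t x)"
          by (intro mean_square_add square_integrable_diff square_integrable_gauss_avg v square_integrable_velocity X X0 t t0)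
        finally show "mean_square (\<lambda>x. mild i (X n) x - mild i t x) \<le>
            2 * mean_square (\<lambda>x. gauss_avg (X n) (v i) x - gauss_avg t (v i) x)
            + 2 * mean_square (\<lambda>x. velocity i (X n) x - velocity i t x)" .
      qed
    qed (auto simp: mean_square_nonneg)
    then have "(\<lambda>n. sqrt (\<Sum>i\<in>UNIV. mean_square (\<lambda>x. mild i (X n) x - mild i t x))) \<longlonglongrightarrow> sqrt (\<Sum>i\<in>(UNIV::3 set). 0)"
      by (intro tendsto_real_sqrt tendsto_sum)
    then show "(\<lambda>n. L2_norm (\<lambda>x. stokes_velocity u F (X n) x - stokes_velocity u F t x)) \<longlonglongrightarrow> 0"
      by (simp add: norm_diff[OF X])
  qed
qed

lemma stokes_velocity_initial:
  "((\<lambda>t. L2_norm (\<lambda>x. stokes_velocity u F t x - u x)) \<longlongrightarrow> 0) (at_right 0)"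
proof -
  have "((\<lambda>t. L2_norm (\<lambda>x. stokes_velocity u F t x - stokes_velocity u F 0 x)) \<longlongrightarrow> 0) (at 0 within {0..<T})"
    using stokes_velocity_continuous_into_L2 T_pos unfolding continuous_into_L2_def by simp
  then have "((\<lambda>t. L2_norm (\<lambda>x. stokes_velocity u F t x - u x)) \<longlongrightarrow> 0) (at 0 within {0..<T})"
    unfolding stokes_velocity_0 .
  then have "((\<lambda>t. L2_norm (\<lambda>x. stokes_velocity u F t x - u x)) \<longlongrightarrow> 0) (at 0 within {0..T / 2})"
    by (rule tendsto_within_subset) (use T_pos in auto)
  then show ?thesis using T_pos by (simp add: at_within_Icc_at_right)
qed

section \<open>Classical regularity and the equations\<close>

definition flow_partial :: "3 \<Rightarrow> 3 \<Rightarrow> real \<Rightarrow> real^3 \<Rightarrow> real" where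
  "flow_partial i j t x = (\<integral>y. heat_partial j t (x - y) * v i y \<partial>lborel) + velocity_partial i j t x"

definition flow_partial2 :: "3 \<Rightarrow> 3 \<Rightarrow> 3 \<Rightarrow> real \<Rightarrow> real^3 \<Rightarrow> real" where
  "flow_partial2 i j k t x = (\<integral>y. heat_partial2 j k t (x - y) * v i y \<partial>lborel) + velocity_partial2 i j k t x"

lemma continuous_on_add_swap:
  assumes "continuous_on S (\<lambda>(x, t). a t x)" "continuous_on S (\<lambda>(x, t). b t x)"
  shows "continuous_on S (\<lambda>(x, t). a t x + b t x :: real)"
  using continuous_on_add[OF assms] by (simp add: case_prod_unfold)

lemma continuous_velocity:
  shows "continuous_family T (velocity i)" "continuous_family T (velocity_partial i j)"
    "continuous_family T (velocity_partial2 i j k)"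
  using family_partial_velocity[of j i] family_partial_velocity_partial[of k i j]
  by (auto simp: family_partial_def)

lemma continuous_flow:
  shows "continuous_on (UNIV \<times> {0<..<T}) (\<lambda>(x, t). heat_flow t (v i) x + velocity i t x)"
    "continuous_on (UNIV \<times> {0<..<T}) (\<lambda>(x, t). flow_partial i j t x)"
    "continuous_on (UNIV \<times> {0<..<T}) (\<lambda>(x, t). flow_partial2 i j k t x)"
  unfolding flow_partial_def flow_partial2_def heat_flow_def
  by (intro continuous_on_add_swap heat_type_convolution_continuous_swap continuous_family_swap continuous_velocity v
      heat_type_heat_kernel heat_type_heat_partial heat_type_heat_partial2)+

lemma has_partial_flow:
  assumes t: "t \<in> {0<..<T}"
  shows "has_partial j (\<lambda>x. heat_flow t (v i) x + velocity i t x) (flow_partial i j t x) x"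
    and "has_partial k (flow_partial i j t) (flow_partial2 i j k t x) x"
proof -
  have t': "t > 0" "t \<in> {0..<T}" using t by auto
  show "has_partial j (\<lambda>x. heat_flow t (v i) x + velocity i t x) (flow_partial i j t x) x"
    unfolding flow_partial_def
    using family_partial_velocity[of j i] t'
    by (intro has_partial_add heat_flow_partial(1) v) (auto simp: family_partial_def)
  show "has_partial k (flow_partial i j t) (flow_partial2 i j k t x) x"
    unfolding flow_partial_def[abs_def] flow_partial2_def
    using family_partial_velocity_partial[of k i j] t'
    by (intro has_partial_add heat_flow_partial(2) v) (auto simp: family_partial_def)
qed

text \<open>The first partial derivatives are the explicit functions \<open>flow_partial\<close> at
  positive times, so the argument for C^1 can be repeated for them.\<close>

lemma stokes_velocity_C2: "C2_space T (\<lambda>t x. stokes_velocity u F t x $ i)"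
  and stokes_velocity_partial: "t \<in> {0<..<T} \<Longrightarrow> partial j (\<lambda>x. stokes_velocity u F t x $ i) x = flow_partial i j t x"
  and stokes_velocity_laplacian:
    "t \<in> {0<..<T} \<Longrightarrow> laplacian (\<lambda>x. stokes_velocity u F t x $ i) x = (\<Sum>j\<in>UNIV. flow_partial2 i j j t x)"
proof -
  let ?w = "\<lambda>t x. stokes_velocity u F t x $ i"
  note 1 = C1_space_intro[OF stokes_velocity_pos continuous_flow(1,2) has_partial_flow(1)]
  have 2: "partial j (?w t) x = flow_partial i j t x" if "t \<in> {0<..<T}" for j t x
    by (rule partial_eq_of_eq[OF stokes_velocity_pos continuous_flow(1,2) has_partial_flow(1) that])
  note 3 = C1_space_intro[OF 2 continuous_flow(2,3) has_partial_flow(2)]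
  have 4: "partial k (partial j (?w t)) x = flow_partial2 i j k t x" if "t \<in> {0<..<T}" for j k t x
    by (rule partial_eq_of_eq[OF 2 continuous_flow(2,3) has_partial_flow(2) that])
  show "C2_space T ?w" unfolding C2_space_def using 1 3 by blast
  show "t \<in> {0<..<T} \<Longrightarrow> partial j (?w t) x = flow_partial i j t x" by (rule 2)
  show "t \<in> {0<..<T} \<Longrightarrow> laplacian (?w t) x = (\<Sum>j\<in>UNIV. flow_partial2 i j j t x)"
    by (simp add: laplacian_def 4)
qed

definition flow_rate :: "3 \<Rightarrow> real \<Rightarrow> real^3 \<Rightarrow> real" where
  "flow_rate i t x = (\<Sum>j\<in>UNIV. \<integral>y. heat_partial2 j j t (x - y) * v i y \<partial>lborel) + velocity_rate i t x"

lemma stokes_velocity_time_derivative: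
  assumes t: "t \<in> {0<..<T}"
  shows "((\<lambda>s. stokes_velocity u F s x $ i) has_real_derivative flow_rate i t x) (at t)"
proof -
  have "((\<lambda>s. heat_flow s (v i) x + velocity i s x) has_real_derivative flow_rate i t x) (at t)"
    unfolding flow_rate_def
    using t by (intro DERIV_add heat_flow_time_derivative[OF v] velocity_time_derivative) auto
  then show ?thesis
    by (rule has_field_derivative_transform_within_open[of _ _ _ "{0<..<T}"])
      (use t in \<open>auto simp: stokes_velocity_pos\<close>)
qed

lemma stokes_velocity_C1_time: "C1_time T (\<lambda>t x. stokes_velocity u F t x $ i)"
  unfolding C1_time_def
proof (intro conjI ballI allI)
  fix t x assume "t \<in> {0<..<T}"
  from stokes_velocity_time_derivative[OF this]
  show "(\<lambda>s. stokes_velocity u F s x $ i) differentiable at t"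
    by (meson field_differentiable_def field_differentiable_imp_differentiable)
next
  have "continuous_on (UNIV \<times> {0<..<T}) (\<lambda>p. \<Sum>j\<in>UNIV. \<integral>y. heat_partial2 j j (snd p) (fst p - y) * v i y \<partial>lborel)"
    using heat_type_convolution_continuous_swap[OF heat_type_heat_partial2 v]
    by (intro continuous_on_sum) (simp add: case_prod_unfold)
  then have a: "continuous_on (UNIV \<times> {0<..<T}) (\<lambda>(x, t). \<Sum>j\<in>UNIV. \<integral>y. heat_partial2 j j t (x - y) * v i y \<partial>lborel)"
    by (simp add: case_prod_unfold)
  have "continuous_on (UNIV \<times> {0<..<T}) (\<lambda>(x, t). flow_rate i t x)"
    unfolding flow_rate_def
    by (rule continuous_on_add_swap[OF a continuous_family_swap[OF continuous_family_velocity_rate]])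
  then show "continuous_on (UNIV \<times> {0<..<T}) (\<lambda>(x, t). deriv (\<lambda>s. stokes_velocity u F s x $ i) t)"
    by (rule continuous_on_eq) (auto simp: DERIV_imp_deriv[OF stokes_velocity_time_derivative])
qed

lemma stokes_pressure_eq:
  assumes t: "t \<in> {0<..<T}"
  shows "stokes_pressure F t x = - conv newton_kernel (source_div t) x"
proof -
  have "divergence (F t) = source_div t"
    by (auto simp: divergence_def source_div_def F)
  moreover have "source_div t \<in> borel_measurable borel"
    using t by (intro borel_measurable_continuous_family[OF smooth_source_imp_continuous_family[OF smooth_source_div]]) auto
  ultimately show ?thesis by (simp add: stokes_pressure_def inv_neg_laplacian_eq_conv)
qed

lemma stokes_pressure_C1: "C1_space T (stokes_pressure F)"
  and stokes_pressure_partial: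
    "t \<in> {0<..<T} \<Longrightarrow> partial i (stokes_pressure F t) x = - conv newton_kernel (partial i (source_div t)) x"
proof -
  note p = family_partial_minus[OF family_partial_conv[OF locally_integrable_newton_kernel smooth_source_div]]
  have c: "continuous_on (UNIV \<times> {0<..<T}) (\<lambda>(x, t). - conv newton_kernel (source_div t) x)"
    "continuous_on (UNIV \<times> {0<..<T}) (\<lambda>(x, t). - conv newton_kernel (partial i (source_div t)) x)" for i
    using p[of i] by (auto simp: family_partial_def dest: continuous_family_swap)
  have d: "has_partial i (\<lambda>x. - conv newton_kernel (source_div t) x) (- conv newton_kernel (partial i (source_div t)) x) x"
    if "t \<in> {0<..<T}" for i t x
    using p[of i] that by (auto simp: family_partial_def)
  show "C1_space T (stokes_pressure F)"
    by (rule C1_space_intro[OF stokes_pressure_eq c d])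
  show "t \<in> {0<..<T} \<Longrightarrow> partial i (stokes_pressure F t) x = - conv newton_kernel (partial i (source_div t)) x"
    by (rule partial_eq_of_eq[OF stokes_pressure_eq c d])
qed

text \<open>In the heat flow part, time derivative and Laplacian are the same three convolutions and
  cancel; \<open>velocity_equation\<close> accounts for the rest. The divergence splits in the same
  way into two vanishing sums.\<close>

lemma stokes_classical: "classical_stokes_solution T F (stokes_velocity u F) (stokes_pressure F)"
  unfolding classical_stokes_solution_def
proof (intro conjI allI ballI)
  fix t x assume t: "t \<in> {0<..<T}"
  then have t': "t > 0" "t \<in> {0..<T}" by auto
  show "deriv (\<lambda>s. stokes_velocity u F s x $ i) t - laplacian (\<lambda>y. stokes_velocity u F t y $ i) x
      + partial i (stokes_pressure F t) x = F t x $ i" for i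
    unfolding DERIV_imp_deriv[OF stokes_velocity_time_derivative[OF t]] stokes_velocity_laplacian[OF t]
      stokes_pressure_partial[OF t] F velocity_equation[OF t'(2), of i x, symmetric]
    by (simp add: flow_rate_def flow_partial2_def sum.distrib)
  show "divergence (stokes_velocity u F t) x = 0"
    using heat_flow_divergence_free[OF u v ae t'(1), of x] velocity_divergence[OF t'(2), of x]
    by (simp add: divergence_def stokes_velocity_partial[OF t] flow_partial_def sum.distrib)
qed (rule stokes_velocity_C1_time stokes_velocity_C2 stokes_pressure_C1)+

end
theorem theorem2p2:
  fixes T R :: real and u\<^sub>0 :: "real^3 \<Rightarrow> real^3" and F :: "real \<Rightarrow> real^3 \<Rightarrow> real^3"
  assumes "T > 0"
    and "u\<^sub>0 \<in> H_space"
    and "R > 0"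
    and "smooth_on (UNIV \<times> {0..<T}) (\<lambda>(x, t). F t x)"
    and "\<And>t. t \<in> {0..<T} \<Longrightarrow> supp (F t) \<subseteq> ball 0 R"
  shows "classical_stokes_solution T F (stokes_velocity u\<^sub>0 F) (stokes_pressure F)
    \<and> ((\<lambda>t. L2_norm (\<lambda>x. stokes_velocity u\<^sub>0 F t x - u\<^sub>0 x)) \<longlongrightarrow> 0) (at_right 0)
    \<and> continuous_into_L2 {0..<T} (stokes_velocity u\<^sub>0 F)"
proof -
  have L2: "u\<^sub>0 \<in> L2" using assms(2) by (simp add: H_space_def)
  obtain v where v: "\<And>i. square_integrable (v i)" "AE y in lebesgue. \<forall>i. u\<^sub>0 y $ i = v i y"
    by (rule L2_borel_version[OF L2], rule that)
  have "smooth_source T R (\<lambda>t x. F t x $ j)" for j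
    unfolding smooth_source_def
  proof (intro conjI ballI allI impI)
    show "smooth_on (UNIV \<times> {0..<T}) (\<lambda>(x, t). F t x $ j)"
      using smooth_on_bounded_linear[OF bounded_linear_vec_nth assms(4), of j] by (simp add: case_prod_unfold)
    fix t x assume "t \<in> {0..<T}" "R < norm (x::real^3)"
    then have "x \<notin> supp (F t)" using assms(5)[of t] by auto
    then have "F t x = 0" using closure_subset[of "{x. F t x \<noteq> 0}"] by (auto simp: supp_def)
    then show "F t x $ j = 0" by simp
  qed
  then interpret stokes_problem T R "\<lambda>j t x. F t x $ j" F u\<^sub>0 v
    using assms(1,2) v by unfold_locales auto
  show ?thesis
    using stokes_classical stokes_velocity_initial stokes_velocity_continuous_into_L2 by blast
qed

end
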